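(* Let $R=\mathbb{C}[x,y]$ with a non-zero $\mathbb{C}$-derivation $\delta$, let $L=\mathbb{C}(x,y)$ be the field of fractions of $R$, with $\delta$ extended uniquely to a derivation of $L$, and let $L^{\delta}=\{w\in L \mid \delta(w)=0\}$. The following statements are equivalent: (1) $R[\theta;\delta]$ is a primitive ring; (2) $R$ is a $\delta$-$G$-ring; (3) there are only a finite number of non-associated irreducible Darboux elements in $R$; (4) $R$ is $\delta$-primitive; (5) there is a maximal ideal of $R$ that does not contain irreducible Darboux elements; (6) $L^{\delta}=\mathbb{C}$.
   Context: A $\mathbb{C}$-derivation of $R$ is a $\mathbb{C}$-linear map $\delta: R\to R$ with $\delta(ab)=\delta(a)b+a\delta(b)$; it extends to $L$ by the quotient rule. A $\delta$-ideal is an ideal $I$ of $R$ with $\delta(I)\subseteq I$. A $\delta$-ideal $P\neq R$ is $\delta$-prime if for all $\delta$-ideals $I,J$ with $IJ\subseteq P$ one has $I\subseteq P$ or $J\subseteq P$; $R$ is $\delta$-prime if $0$ is a $\delta$-prime ideal. $R$ is a $\delta$-$G$-ring if $R$ is $\delta$-prime and the intersection of all non-zero $\delta$-prime ideals of $R$ is non-zero (an empty intersection being $R$). $R$ is $\delta$-primitive if it has a maximal ideal that contains no non-zero $\delta$-ideal of $R$. A non-zero element $a\in R$ is a Darboux element (with respect to $\delta$) if $\delta(a)=ba$ for some $b\in R$. The differential operator ring $R[\theta;\delta]$ is the free left $R$-module with basis $1,\theta,\theta^2,\ldots$ with multiplication extending that of $R$ and determined by $\theta a = a\theta+\delta(a)$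 for $a\in R$. A ring is primitive if it has a faithful simple left module. *)

theory Defs
  imports
    "HOL-Computational_Algebra.Polynomial_Factorial"
    "HOL-Computational_Algebra.Fraction_Field"
    "HOL-Algebra.Ideal_Product"
    "HOL-Algebra.Module"
    "HOL-Decision_Procs.Algebra_Aux"
begin

text \<open>
  The polynomial ring in two variables over the complex numbers is the type
  \<^typ>\<open>complex poly poly\<close>, its field of fractions the type \<^typ>\<open>complex poly poly fract\<close>.
  \<^const>\<open>cring_class_ops\<close> turns a type of class \<^class>\<open>comm_ring_1\<close> into a ring record,
  so that the ideals of HOL-Algebra apply to it.
\<close>

type_synonym polyxy = "complex poly poly"

abbreviation polyxy_ring :: "polyxy ring" where
  "polyxy_ring \<equiv> cring_class_ops"

section \<open>Derivations\<close>

definition ring_derivation :: "('a::comm_ring_1 \<Rightarrow> 'a) \<Rightarrow> bool" where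
  "ring_derivation \<delta> \<longleftrightarrow>
     (\<forall>a b. \<delta> (a + b) = \<delta> a + \<delta> b) \<and>
     (\<forall>a b. \<delta> (a * b) = \<delta> a * b + a * \<delta> b)"

definition const_poly :: "complex \<Rightarrow> polyxy" where
  "const_poly c = [:[:c:]:]"

definition C_derivation :: "(polyxy \<Rightarrow> polyxy) \<Rightarrow> bool" where
  "C_derivation \<delta> \<longleftrightarrow>
     ring_derivation \<delta> \<and> (\<forall>c a. \<delta> (const_poly c * a) = const_poly c * \<delta> a)"

definition darboux :: "('a::comm_ring_1 \<Rightarrow> 'a) \<Rightarrow> 'a \<Rightarrow> bool" where
  "darboux \<delta> a \<longleftrightarrow> a \<noteq> 0 \<and> (\<exists>b. \<delta> a = b * a)"

definition irreducible_darboux :: "('a::idom \<Rightarrow> 'a) \<Rightarrow> 'a set" where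
  "irreducible_darboux \<delta> = {a. Factorial_Ring.irreducible a \<and> darboux \<delta> a}"

definition associated_rel :: "('a::idom \<times> 'a) set" where
  "associated_rel = {(a, b). a dvd b \<and> b dvd a}"

text \<open>
  The extension to the field of fractions by the quotient rule. The lemmas below show that it is
  well defined, and that it is the only derivation of the field extending \<open>\<delta>\<close>.
\<close>

definition fract_derivation :: "('a::idom \<Rightarrow> 'a) \<Rightarrow> 'a fract \<Rightarrow> 'a fract" where
  "fract_derivation \<delta> w =
     (THE z. \<exists>a b. b \<noteq> 0 \<and> w = Fraction_Field.Fract a b \<and>
                   z = Fraction_Field.Fract (\<delta> a * b - a * \<delta> b) (b * b))"

definition fract_constants :: "('a::idom \<Rightarrow> 'a) \<Rightarrow> 'a fract set" where
  "fract_constants \<delta> = {w. fract_derivation \<delta> w = 0}"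

definition const_fract :: "complex \<Rightarrow> polyxy fract" where
  "const_fract c = Fraction_Field.Fract (const_poly c) 1"

lemma ring_derivation_add: "ring_derivation \<delta> \<Longrightarrow> \<delta> (a + b) = \<delta> a + \<delta> b"
  and ring_derivation_mult: "ring_derivation \<delta> \<Longrightarrow> \<delta> (a * b) = \<delta> a * b + a * \<delta> b"
  by (auto simp: ring_derivation_def)

lemma ring_derivation_0: "ring_derivation \<delta> \<Longrightarrow> \<delta> 0 = 0"
  using ring_derivation_add[of \<delta> 0 0] by simp

lemma ring_derivation_1: "ring_derivation \<delta> \<Longrightarrow> \<delta> 1 = 0"
  using ring_derivation_mult[of \<delta> 1 1] by simp

lemma fract_derivation_Fract:
  fixes \<delta> :: "'a::idom \<Rightarrow> 'a"
  assumes "ring_derivation \<delta>" "b \<noteq> 0"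
  shows "fract_derivation \<delta> (Fraction_Field.Fract a b) =
         Fraction_Field.Fract (\<delta> a * b - a * \<delta> b) (b * b)"
  unfolding fract_derivation_def
proof (rule the_equality)
  show "\<exists>a' b'. b' \<noteq> 0 \<and> Fraction_Field.Fract a b = Fraction_Field.Fract a' b' \<and>
      Fraction_Field.Fract (\<delta> a * b - a * \<delta> b) (b * b) =
      Fraction_Field.Fract (\<delta> a' * b' - a' * \<delta> b') (b' * b')"
    using assms(2) by blast
next
  fix z
  assume "\<exists>a' b'. b' \<noteq> 0 \<and> Fraction_Field.Fract a b = Fraction_Field.Fract a' b' \<and>
      z = Fraction_Field.Fract (\<delta> a' * b' - a' * \<delta> b') (b' * b')"
  then obtain c d where d: "d \<noteq> 0" and eq: "Fraction_Field.Fract a b = Fraction_Field.Fract c d"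
    and z: "z = Fraction_Field.Fract (\<delta> c * d - c * \<delta> d) (d * d)" by blast
  have e: "a * d = c * b" using eq assms(2) d by (simp add: eq_fract)
  have "\<delta> (a * d) = \<delta> (c * b)" using e by simp
  then have e': "\<delta> a * d + a * \<delta> d = \<delta> c * b + c * \<delta> b"
    by (simp add: ring_derivation_mult[OF assms(1)])
  have "(\<delta> c * d - c * \<delta> d) * (b * b) = (\<delta> a * b - a * \<delta> b) * (d * d)"
  proof -
    have "(\<delta> c * d - c * \<delta> d) * (b * b) - (\<delta> a * b - a * \<delta> b) * (d * d) =
      d * b * (\<delta> c * b + c * \<delta> b - (\<delta> a * d + a * \<delta> d)) +
      (a * d - c * b) * (\<delta> d * b + \<delta> b * d)"
      by (simp add: algebra_simps)
    also have "\<dots> = 0" using e e' by simp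
    finally show ?thesis by simp
  qed
  then show "z = Fraction_Field.Fract (\<delta> a * b - a * \<delta> b) (b * b)"
    unfolding z using assms(2) d by (simp add: eq_fract)
qed

lemma fract_derivation_extends:
  assumes "ring_derivation \<delta>"
  shows "fract_derivation \<delta> (Fraction_Field.Fract a 1) = Fraction_Field.Fract (\<delta> a) 1"
  by (simp add: fract_derivation_Fract[OF assms] ring_derivation_1[OF assms])

lemma ring_derivation_fract_derivation:
  fixes \<delta> :: "'a::idom \<Rightarrow> 'a"
  assumes "ring_derivation \<delta>"
  shows "ring_derivation (fract_derivation \<delta>)"
proof -
  have "fract_derivation \<delta> (v + w) = fract_derivation \<delta> v + fract_derivation \<delta> w"
    and "fract_derivation \<delta> (v * w) = fract_derivation \<delta> v * w + v * fract_derivation \<delta> w"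
    for v w
  proof -
    obtain a b where v: "v = Fraction_Field.Fract a b" "b \<noteq> 0" by (cases v) auto
    obtain c d where w: "w = Fraction_Field.Fract c d" "d \<noteq> 0" by (cases w) auto
    show "fract_derivation \<delta> (v + w) = fract_derivation \<delta> v + fract_derivation \<delta> w"
      using v w
      by (simp add: fract_derivation_Fract[OF assms] ring_derivation_mult[OF assms]
            ring_derivation_add[OF assms] eq_fract) (simp add: algebra_simps)
    show "fract_derivation \<delta> (v * w) = fract_derivation \<delta> v * w + v * fract_derivation \<delta> w"
      using v w
      by (simp add: fract_derivation_Fract[OF assms] ring_derivation_mult[OF assms]
            ring_derivation_add[OF assms] eq_fract) (simp add: algebra_simps)
  qed
  then show ?thesis by (simp add: ring_derivation_def)
qed

lemma fract_derivation_unique: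
  fixes \<delta> :: "'a::idom \<Rightarrow> 'a"
  assumes "ring_derivation \<delta>" "ring_derivation D"
    and ext: "\<And>a. D (Fraction_Field.Fract a 1) = Fraction_Field.Fract (\<delta> a) 1"
  shows "D = fract_derivation \<delta>"
proof
  fix w :: "'a fract"
  obtain a b where w: "w = Fraction_Field.Fract a b" and b: "b \<noteq> 0" by (cases w) auto
  let ?a = "Fraction_Field.Fract a 1" and ?b = "Fraction_Field.Fract b 1"
  have b0: "?b \<noteq> 0" using b by (simp add: Zero_fract_def eq_fract)
  have ab: "?a = w * ?b" using b by (simp add: w eq_fract)
  have *: "E w * ?b = E ?a - w * E ?b" if "ring_derivation E" for E
    using ring_derivation_mult[OF that, of w ?b] ab by simp
  have "D w * ?b = fract_derivation \<delta> w * ?b"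
    unfolding *[OF assms(2)] *[OF ring_derivation_fract_derivation[OF assms(1)]]
    by (simp add: ext fract_derivation_extends[OF assms(1)])
  then show "D w = fract_derivation \<delta> w" using b0 by simp
qed

section \<open>Ideals stable under a derivation\<close>

definition delta_ideal :: "('a, 'm) ring_scheme \<Rightarrow> ('a \<Rightarrow> 'a) \<Rightarrow> 'a set \<Rightarrow> bool" where
  "delta_ideal R \<delta> I \<longleftrightarrow> ideal I R \<and> \<delta> ` I \<subseteq> I"

definition delta_prime_ideal :: "('a, 'm) ring_scheme \<Rightarrow> ('a \<Rightarrow> 'a) \<Rightarrow> 'a set \<Rightarrow> bool" where
  "delta_prime_ideal R \<delta> P \<longleftrightarrow>
     delta_ideal R \<delta> P \<and> P \<noteq> carrier R \<and>
     (\<forall>I J. delta_ideal R \<delta> I \<longrightarrow> delta_ideal R \<delta> J \<longrightarrow>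
            ideal_prod R I J \<subseteq> P \<longrightarrow> I \<subseteq> P \<or> J \<subseteq> P)"

definition delta_prime_ring :: "('a, 'm) ring_scheme \<Rightarrow> ('a \<Rightarrow> 'a) \<Rightarrow> bool" where
  "delta_prime_ring R \<delta> \<longleftrightarrow> delta_prime_ideal R \<delta> {\<zero>\<^bsub>R\<^esub>}"

definition delta_G_ring :: "('a, 'm) ring_scheme \<Rightarrow> ('a \<Rightarrow> 'a) \<Rightarrow> bool" where
  "delta_G_ring R \<delta> \<longleftrightarrow>
     delta_prime_ring R \<delta> \<and>
     carrier R \<inter> \<Inter> {P. delta_prime_ideal R \<delta> P \<and> P \<noteq> {\<zero>\<^bsub>R\<^esub>}} \<noteq> {\<zero>\<^bsub>R\<^esub>}"

definition delta_primitive :: "('a, 'm) ring_scheme \<Rightarrow> ('a \<Rightarrow> 'a) \<Rightarrow> bool" where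
  "delta_primitive R \<delta> \<longleftrightarrow>
     (\<exists>M. maximalideal M R \<and> (\<forall>I. delta_ideal R \<delta> I \<longrightarrow> I \<subseteq> M \<longrightarrow> I = {\<zero>\<^bsub>R\<^esub>}))"

section \<open>The differential operator ring\<close>

text \<open>
  An element of \<open>R[\<theta>;\<delta>]\<close> is written uniquely as \<open>\<Sum>i. a\<^sub>i \<theta>\<^sup>i\<close> with coefficients on the left, and
  is represented by the polynomial with coefficients \<open>a\<^sub>i\<close>. Left multiplication by \<open>\<theta>\<close> is
  \<open>\<theta> (\<Sum>i. b\<^sub>i \<theta>\<^sup>i) = \<Sum>i. b\<^sub>i \<theta>\<^bsup>i+1\<^esup> + \<Sum>i. \<delta>(b\<^sub>i) \<theta>\<^sup>i\<close>.
\<close>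

definition theta_times :: "('a::comm_ring_1 \<Rightarrow> 'a) \<Rightarrow> 'a poly \<Rightarrow> 'a poly" where
  "theta_times \<delta> q = pCons 0 q + map_poly \<delta> q"

definition diff_op_mult :: "('a::comm_ring_1 \<Rightarrow> 'a) \<Rightarrow> 'a poly \<Rightarrow> 'a poly \<Rightarrow> 'a poly" where
  "diff_op_mult \<delta> p q =
     (\<Sum>i\<le>Polynomial.degree p.
        Polynomial.smult (Polynomial.coeff p i) ((theta_times \<delta> ^^ i) q))"

definition diff_op_ring :: "('a::comm_ring_1 \<Rightarrow> 'a) \<Rightarrow> 'a poly ring" where
  "diff_op_ring \<delta> =
     \<lparr>carrier = UNIV, monoid.mult = diff_op_mult \<delta>, one = 1, zero = 0, add = (+)\<rparr>"

context
  fixes \<delta> :: "'a::comm_ring_1 \<Rightarrow> 'a"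
  assumes der: "ring_derivation \<delta>"
begin

lemma coeff_map_derivation [simp]:
  "Polynomial.coeff (map_poly \<delta> q) i = \<delta> (Polynomial.coeff q i)"
  by (simp add: coeff_map_poly ring_derivation_0[OF der])

lemma theta_times_add: "theta_times \<delta> (p + q) = theta_times \<delta> p + theta_times \<delta> q"
  unfolding theta_times_def
  by (rule poly_eqI) (auto simp: coeff_pCons ring_derivation_add[OF der] split: nat.splits)

lemma theta_times_0 [simp]: "theta_times \<delta> 0 = 0"
  by (simp add: theta_times_def)

lemma theta_times_smult:
  "theta_times \<delta> (Polynomial.smult a q) =
     Polynomial.smult a (theta_times \<delta> q) + Polynomial.smult (\<delta> a) q"
  unfolding theta_times_def
  by (rule poly_eqI)
    (auto simp: coeff_pCons ring_derivation_mult[OF der] algebra_simps split: nat.splits)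

lemma theta_times_pCons:
  "theta_times \<delta> (pCons a q) = pCons (\<delta> a) ([:a:] + theta_times \<delta> q)"
  unfolding theta_times_def
  by (rule poly_eqI) (auto simp: coeff_pCons split: nat.splits)

lemma theta_times_monom:
  "theta_times \<delta> (Polynomial.monom 1 n) = Polynomial.monom 1 (Suc n)"
  unfolding theta_times_def
  by (rule poly_eqI)
    (auto simp: coeff_pCons ring_derivation_0[OF der] ring_derivation_1[OF der] split: nat.splits)

lemma diff_op_mult_le:
  assumes "Polynomial.degree p \<le> N"
  shows "diff_op_mult \<delta> p q =
    (\<Sum>i\<le>N. Polynomial.smult (Polynomial.coeff p i) ((theta_times \<delta> ^^ i) q))"
  unfolding diff_op_mult_def
  by (rule sum.mono_neutral_left) (use assms in \<open>auto simp: coeff_eq_0\<close>)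

lemma diff_op_mult_0 [simp]: "diff_op_mult \<delta> 0 q = 0"
  by (simp add: diff_op_mult_def)

lemma diff_op_mult_add_left:
  "diff_op_mult \<delta> (p + p') q = diff_op_mult \<delta> p q + diff_op_mult \<delta> p' q"
proof -
  let ?N = "max (Polynomial.degree p) (Polynomial.degree p')"
  show ?thesis
    by (simp add: diff_op_mult_le[of _ ?N] degree_add_le smult_add_left sum.distrib)
qed

lemma diff_op_mult_smult_left:
  "diff_op_mult \<delta> (Polynomial.smult a p) q = Polynomial.smult a (diff_op_mult \<delta> p q)"
proof -
  have smult_sum: "Polynomial.smult a (sum f A) = (\<Sum>i\<in>A. Polynomial.smult a (f i))"
    for f :: "nat \<Rightarrow> 'a poly" and A
    by (induction A rule: infinite_finite_induct) (simp_all add: smult_add_right)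
  show ?thesis
    by (simp add: diff_op_mult_le[of _ "Polynomial.degree p"] degree_smult_le smult_sum)
qed

lemma diff_op_mult_pCons:
  "diff_op_mult \<delta> (pCons a p) q =
     Polynomial.smult a q + diff_op_mult \<delta> p (theta_times \<delta> q)"
proof -
  have "diff_op_mult \<delta> (pCons a p) q =
      (\<Sum>i\<le>Suc (Polynomial.degree p).
         Polynomial.smult (Polynomial.coeff (pCons a p) i) ((theta_times \<delta> ^^ i) q))"
    by (rule diff_op_mult_le) (rule degree_pCons_le)
  also have "\<dots> = Polynomial.smult a q +
      (\<Sum>i\<le>Polynomial.degree p.
         Polynomial.smult (Polynomial.coeff p i) ((theta_times \<delta> ^^ Suc i) q))"
    by (simp only: sum.atMost_Suc_shift coeff_pCons_0 coeff_pCons_Suc funpow_0)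
  also have "\<dots> = Polynomial.smult a q + diff_op_mult \<delta> p (theta_times \<delta> q)"
    by (simp add: diff_op_mult_def funpow_swap1)
  finally show ?thesis .
qed

lemma diff_op_mult_add_right:
  "diff_op_mult \<delta> p (q + q') = diff_op_mult \<delta> p q + diff_op_mult \<delta> p q'"
  by (induction p arbitrary: q q')
    (auto simp: diff_op_mult_pCons theta_times_add smult_add_right)

lemma diff_op_mult_theta_times:
  "diff_op_mult \<delta> (theta_times \<delta> q) r = theta_times \<delta> (diff_op_mult \<delta> q r)"
  by (induction q arbitrary: r)
    (auto simp: theta_times_pCons diff_op_mult_pCons diff_op_mult_add_left theta_times_add
      theta_times_smult)

lemma diff_op_mult_assoc:
  "diff_op_mult \<delta> (diff_op_mult \<delta> p q) r = diff_op_mult \<delta> p (diff_op_mult \<delta> q r)"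
  by (induction p arbitrary: q)
    (auto simp: diff_op_mult_pCons diff_op_mult_add_left diff_op_mult_smult_left
      diff_op_mult_theta_times)

lemma diff_op_mult_one_left: "diff_op_mult \<delta> 1 q = q"
  by (simp add: one_pCons diff_op_mult_pCons)

lemma diff_op_mult_const_left: "diff_op_mult \<delta> [:a:] q = Polynomial.smult a q"
  by (simp add: diff_op_mult_pCons)

lemma diff_op_mult_monom:
  "diff_op_mult \<delta> p (Polynomial.monom 1 n) = p * Polynomial.monom 1 n"
proof (induction p arbitrary: n)
  case 0
  show ?case by simp
next
  case (pCons a p)
  have "diff_op_mult \<delta> (pCons a p) (Polynomial.monom 1 n) =
      Polynomial.smult a (Polynomial.monom 1 n) + p * Polynomial.monom 1 (Suc n)"
    by (simp only: diff_op_mult_pCons theta_times_monom pCons.IH)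
  also have "\<dots> = pCons a p * Polynomial.monom 1 n"
    by (simp add: monom_Suc)
  finally show ?case .
qed

lemma diff_op_mult_one_right: "diff_op_mult \<delta> p 1 = p"
  using diff_op_mult_monom[of p 0] by simp

text \<open>The defining relation \<open>\<theta> a = a \<theta> + \<delta>(a)\<close>, and \<open>a\<close> times \<open>\<theta>\<^sup>n\<close> is \<open>a \<theta>\<^sup>n\<close>.\<close>

lemma diff_op_mult_relation:
  "diff_op_mult \<delta> [:0, 1:] [:a:] = diff_op_mult \<delta> [:a:] [:0, 1:] + [:\<delta> a:]"
  by (simp add: diff_op_mult_pCons theta_times_pCons)

lemma ring_diff_op_ring: "ring (diff_op_ring \<delta>)"
proof (rule ringI)
  show "abelian_group (diff_op_ring \<delta>)"
  proof (rule abelian_groupI)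
    fix x assume "x \<in> carrier (diff_op_ring \<delta>)"
    show "\<exists>y\<in>carrier (diff_op_ring \<delta>). y \<oplus>\<^bsub>diff_op_ring \<delta>\<^esub> x = \<zero>\<^bsub>diff_op_ring \<delta>\<^esub>"
      by (rule bexI[of _ "- x"]) (simp_all add: diff_op_ring_def)
  qed (simp_all add: diff_op_ring_def add_ac)
  show "Group.monoid (diff_op_ring \<delta>)"
    by (rule monoidI)
      (simp_all add: diff_op_ring_def diff_op_mult_assoc diff_op_mult_one_left
        diff_op_mult_one_right)
qed (simp_all add: diff_op_ring_def diff_op_mult_add_left diff_op_mult_add_right)

end

section \<open>Primitive rings\<close>

text \<open>The locale \<^locale>\<open>module\<close> of HOL-Algebra is restricted to commutative rings.\<close>

locale left_module = R?: ring R + M?: abelian_group M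
  for R :: "('a, 'm) ring_scheme" (structure)
    and M :: "('a, 'b, 'n) module_scheme" (structure) +
  assumes smult_closed:
      "\<lbrakk>a \<in> carrier R; x \<in> carrier M\<rbrakk> \<Longrightarrow> a \<odot>\<^bsub>M\<^esub> x \<in> carrier M"
    and smult_l_distr:
      "\<lbrakk>a \<in> carrier R; b \<in> carrier R; x \<in> carrier M\<rbrakk> \<Longrightarrow>
       (a \<oplus>\<^bsub>R\<^esub> b) \<odot>\<^bsub>M\<^esub> x = a \<odot>\<^bsub>M\<^esub> x \<oplus>\<^bsub>M\<^esub> b \<odot>\<^bsub>M\<^esub> x"
    and smult_r_distr:
      "\<lbrakk>a \<in> carrier R; x \<in> carrier M; y \<in> carrier M\<rbrakk> \<Longrightarrow>
       a \<odot>\<^bsub>M\<^esub> (x \<oplus>\<^bsub>M\<^esub> y) = a \<odot>\<^bsub>M\<^esub> x \<oplus>\<^bsub>M\<^esub> a \<odot>\<^bsub>M\<^esub> y"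
    and smult_assoc:
      "\<lbrakk>a \<in> carrier R; b \<in> carrier R; x \<in> carrier M\<rbrakk> \<Longrightarrow>
       (a \<otimes>\<^bsub>R\<^esub> b) \<odot>\<^bsub>M\<^esub> x = a \<odot>\<^bsub>M\<^esub> (b \<odot>\<^bsub>M\<^esub> x)"
    and smult_one: "x \<in> carrier M \<Longrightarrow> \<one>\<^bsub>R\<^esub> \<odot>\<^bsub>M\<^esub> x = x"

definition simple_left_module ::
  "('a, 'm) ring_scheme \<Rightarrow> ('a, 'b, 'n) module_scheme \<Rightarrow> bool" where
  "simple_left_module R M \<longleftrightarrow>
     left_module R M \<and> carrier M \<noteq> {\<zero>\<^bsub>M\<^esub>} \<and>
     (\<forall>N. submodule N R M \<longrightarrow> N = {\<zero>\<^bsub>M\<^esub>} \<or> N = carrier M)"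

definition faithful_module ::
  "('a, 'm) ring_scheme \<Rightarrow> ('a, 'b, 'n) module_scheme \<Rightarrow> bool" where
  "faithful_module R M \<longleftrightarrow>
     (\<forall>a\<in>carrier R. (\<forall>x\<in>carrier M. a \<odot>\<^bsub>M\<^esub> x = \<zero>\<^bsub>M\<^esub>) \<longrightarrow> a = \<zero>\<^bsub>R\<^esub>)"

text \<open>
  HOL cannot quantify over the type of the module elements inside a formula. A simple left
  module is a quotient of the ring by a left ideal, so elements of type \<^typ>\<open>'a set\<close> (cosets)
  lose no generality; \<open>primitive_ringI\<close> below states this for modules over an arbitrary type.
\<close>

definition primitive_ring :: "('a, 'm) ring_scheme \<Rightarrow> bool" where
  "primitive_ring R \<longleftrightarrow>
     (\<exists>M :: ('a, 'a set) module. simple_left_module R M \<and> faithful_module R M)"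

lemma primitive_ringI:
  fixes R :: "('a, 'm) ring_scheme" and M :: "('a, 'b, 'n) module_scheme"
  assumes "simple_left_module R M" "faithful_module R M"
  shows "primitive_ring R"
proof -
  interpret left_module R M using assms(1) by (simp add: simple_left_module_def)
  have simple: "N = {\<zero>\<^bsub>M\<^esub>} \<or> N = carrier M" if "submodule N R M" for N
    using assms(1) that by (auto simp: simple_left_module_def)
  have nz: "carrier M \<noteq> {\<zero>\<^bsub>M\<^esub>}" using assms(1) by (simp add: simple_left_module_def)
  then obtain m where m: "m \<in> carrier M" "m \<noteq> \<zero>\<^bsub>M\<^esub>" using M.zero_closed by blast
  have smult_r_null: "a \<odot>\<^bsub>M\<^esub> \<zero>\<^bsub>M\<^esub> = \<zero>\<^bsub>M\<^esub>" if "a \<in> carrier R" for a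
    using smult_r_distr[OF that, of "\<zero>\<^bsub>M\<^esub>" "\<zero>\<^bsub>M\<^esub>"] smult_closed[OF that, of "\<zero>\<^bsub>M\<^esub>"]
    by (metis M.add.r_cancel_one' M.l_zero M.zero_closed)
  have smult_l_null: "\<zero>\<^bsub>R\<^esub> \<odot>\<^bsub>M\<^esub> x = \<zero>\<^bsub>M\<^esub>" if "x \<in> carrier M" for x
    using smult_l_distr[of "\<zero>\<^bsub>R\<^esub>" "\<zero>\<^bsub>R\<^esub>" x] smult_closed[of "\<zero>\<^bsub>R\<^esub>" x] that
    by (metis M.add.r_cancel_one' R.l_zero R.zero_closed)
  have smult_minus: "(\<ominus>\<^bsub>R\<^esub> a) \<odot>\<^bsub>M\<^esub> x = \<ominus>\<^bsub>M\<^esub> (a \<odot>\<^bsub>M\<^esub> x)" if "a \<in> carrier R" "x \<in> carrier M" for a x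
    using smult_l_distr[of "\<ominus>\<^bsub>R\<^esub> a" a x] smult_l_null[of x] that
    by (simp add: R.l_neg smult_closed M.minus_equality)
  define N where "N = (\<lambda>a. a \<odot>\<^bsub>M\<^esub> m) ` carrier R"
  have "submodule N R M"
  proof (intro submodule.intro submodule_axioms.intro M.add.subgroupI)
    show "N \<noteq> {}" by (auto simp: N_def)
    show "N \<subseteq> carrier M" by (auto simp: N_def smult_closed m)
    show "\<ominus>\<^bsub>M\<^esub> x \<in> N" if "x \<in> N" for x
      using that m unfolding N_def by (auto simp flip: smult_minus)
    show "x \<oplus>\<^bsub>M\<^esub> y \<in> N" if "x \<in> N" "y \<in> N" for x y
      using that m unfolding N_def by (auto simp flip: smult_l_distr)
    show "a \<odot>\<^bsub>M\<^esub> x \<in> N" if "a \<in> carrier R" "x \<in> N" for a x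
      using that m unfolding N_def by (auto simp flip: smult_assoc)
  qed
  moreover have "m \<in> N" unfolding N_def using m smult_one[of m] by (metis R.one_closed imageI)
  ultimately have N: "N = carrier M" using simple m by blast
  define f where "f x = {a \<in> carrier R. a \<odot>\<^bsub>M\<^esub> m = x}" for x
  have inj: "inj_on f (carrier M)"
  proof (rule inj_onI)
    fix x y assume "x \<in> carrier M" and eq: "f x = f y"
    then obtain a where "a \<in> carrier R" "x = a \<odot>\<^bsub>M\<^esub> m" using N by (auto simp: N_def)
    then have "a \<in> f x" by (simp add: f_def)
    then have "a \<in> f y" by (simp add: eq)
    with \<open>x = a \<odot>\<^bsub>M\<^esub> m\<close> show "x = y" by (simp add: f_def)
  qed
  define g where "g = inv_into (carrier M) f"
  have gf [simp]: "g (f x) = x" if "x \<in> carrier M" for x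
    using inj that by (simp add: g_def inv_into_f_f)
  define M' :: "('a, 'a set) module" where
    "M' = \<lparr>carrier = f ` carrier M, monoid.mult = (\<lambda>_ _. {}), one = {}, zero = f \<zero>\<^bsub>M\<^esub>,
           add = (\<lambda>X Y. f (g X \<oplus>\<^bsub>M\<^esub> g Y)), smult = (\<lambda>a X. f (a \<odot>\<^bsub>M\<^esub> g X))\<rparr>"
  have add: "f x \<oplus>\<^bsub>M'\<^esub> f y = f (x \<oplus>\<^bsub>M\<^esub> y)" if "x \<in> carrier M" "y \<in> carrier M" for x y
    using that by (simp add: M'_def)
  have carr: "carrier M' = f ` carrier M" and zero: "\<zero>\<^bsub>M'\<^esub> = f \<zero>\<^bsub>M\<^esub>"
    by (simp_all add: M'_def)
  have smult: "a \<odot>\<^bsub>M'\<^esub> f x = f (a \<odot>\<^bsub>M\<^esub> x)" if "x \<in> carrier M" for a x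
    using that by (simp add: M'_def)
  have f_eq: "f x = f y \<longleftrightarrow> x = y" if "x \<in> carrier M" "y \<in> carrier M" for x y
    using inj that by (auto simp: inj_on_def)
  have "abelian_group M'"
  proof (rule abelian_groupI)
    fix X assume "X \<in> carrier M'"
    then obtain x where "x \<in> carrier M" "X = f x" by (auto simp: carr)
    then show "\<exists>Y\<in>carrier M'. Y \<oplus>\<^bsub>M'\<^esub> X = \<zero>\<^bsub>M'\<^esub>"
      by (intro bexI[of _ "f (\<ominus>\<^bsub>M\<^esub> x)"]) (simp_all add: carr zero add M.l_neg)
  qed (auto simp: carr zero add M.a_ac)
  then have "left_module R M'"
    by (intro left_module.intro left_module_axioms.intro R.ring_axioms)
      (auto simp: carr zero add smult smult_closed smult_l_distr smult_r_distr smult_assoc smult_one)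
  moreover have "carrier M' \<noteq> {\<zero>\<^bsub>M'\<^esub>}"
  proof -
    have "f m \<in> carrier M'" "f m \<noteq> \<zero>\<^bsub>M'\<^esub>" using m by (simp_all add: carr zero f_eq)
    then show ?thesis by blast
  qed
  moreover have "K = {\<zero>\<^bsub>M'\<^esub>} \<or> K = carrier M'" if K: "submodule K R M'" for K
  proof -
    interpret M': abelian_group M' by fact
    interpret K: subgroup K "add_monoid M'" using K by (simp add: submodule_def)
    define L where "L = {x \<in> carrier M. f x \<in> K}"
    have KL: "K = f ` L" using K.subset by (auto simp: L_def carr)
    have "submodule L R M"
    proof (intro submodule.intro submodule_axioms.intro M.add.subgroupI)
      show "L \<noteq> {}" using K.one_closed zero by (auto simp: L_def)
      show "L \<subseteq> carrier M" by (auto simp: L_def)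
      show "x \<oplus>\<^bsub>M\<^esub> y \<in> L" if "x \<in> L" "y \<in> L" for x y
        using that K.m_closed[of "f x" "f y"] by (simp add: L_def add)
      show sm: "a \<odot>\<^bsub>M\<^esub> x \<in> L" if "a \<in> carrier R" "x \<in> L" for a x
        using that submodule.smult_closed[OF K, of a "f x"] by (simp add: L_def smult smult_closed)
      show "\<ominus>\<^bsub>M\<^esub> x \<in> L" if "x \<in> L" for x
        using sm[of "\<ominus>\<^bsub>R\<^esub> \<one>\<^bsub>R\<^esub>" x] that
        by (simp add: L_def smult_minus smult_one)
    qed
    then show ?thesis using simple[of L] by (auto simp: KL carr zero)
  qed
  moreover have "faithful_module R M'"
    using assms(2) by (auto simp: faithful_module_def carr zero smult f_eq smult_closed)
  ultimately show ?thesis unfolding primitive_ring_def simple_left_module_def by blast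
qed

end

theory Submission
  imports Defs
    "HOL-Computational_Algebra.Field_as_Ring"
    "HOL-Computational_Algebra.Fundamental_Theorem_Algebra"
    "HOL-Analysis.Continuum_Not_Denumerable"
begin

text \<open>
  If \<open>L\<^sup>\<delta> \<noteq> \<complex>\<close>, a non-constant element \<open>a / b\<close> of \<open>L\<^sup>\<delta>\<close> in lowest terms gives a pencil
  \<open>a - \<lambda> b\<close> of Darboux elements with a common cofactor. In a faithful simple module each of them acts
  bijectively; since \<open>R[\<theta>;\<delta>]\<close> has countable dimension, the inverses are linearly dependent, so a
  non-zero homogeneous form in \<open>a\<close> and \<open>b\<close>, again a Darboux element, kills a non-zero vector, which is
  impossible. The same argument modulo a maximal ideal produces an irreducible Darboux element in it.

  If \<open>L\<^sup>\<delta> = \<complex>\<close>, infinitely many irreducible Darboux elements would admit two linearly independent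
  relations between their cofactors, which have bounded degree; the corresponding combinations of
  the \<open>p\<^sub>y / p\<close> are eigenvectors of \<open>\<delta>\<close> in \<open>L\<close> for the same eigenvalue, and their quotient is a
  non-constant element of \<open>L\<^sup>\<delta>\<close>.

  If there are finitely many irreducible Darboux elements, let \<open>Q\<close> be their product times \<open>\<delta>(x)\<close>.
  A non-zero \<open>\<delta>\<close>-ideal without common divisor contains a non-zero \<open>u(x)\<close>, and is contained in the
  maximal ideal of no point with \<open>\<delta>(x) \<noteq> 0\<close>; so the ideal of a point where \<open>Q \<noteq> 0\<close> contains no
  non-zero \<open>\<delta>\<close>-ideal. Moreover \<open>Q\<close> lies in every non-zero \<open>\<delta>\<close>-prime ideal, since one without
  irreducible Darboux elements is the ideal of a point where \<open>\<delta>(x)\<close> and \<open>\<delta>(y)\<close> vanish.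
\<close>

section \<open>Ideals of a commutative ring given as a type\<close>

lemma ideal_classI:
  fixes I :: "'a::comm_ring_1 set"
  assumes "0 \<in> I" "\<And>a b. a \<in> I \<Longrightarrow> b \<in> I \<Longrightarrow> a + b \<in> I" "\<And>r a. a \<in> I \<Longrightarrow> r * a \<in> I"
  shows "ideal I cring_class_ops"
proof (rule idealI)
  show "ring (cring_class_ops :: 'a ring)" by (rule cring_class.ring_axioms)
  have add: "group (add_monoid (cring_class_ops :: 'a ring))"
    by (rule abelian_group.a_group[OF ring.axioms(1)[OF cring.axioms(1)[OF cring_class]]])
  show "subgroup I (add_monoid cring_class_ops)"
  proof (rule group.subgroupI[OF add])
    show "inv\<^bsub>add_monoid cring_class_ops\<^esub> a \<in> I" if "a \<in> I" for a
    proof -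
      have "- a \<in> I" using assms(3)[OF that, of "- 1"] by simp
      then show ?thesis by (simp only: a_inv_def[symmetric] uminus_class)
    qed
  qed (use assms(1,2) in \<open>auto simp: class_simps\<close>)
  show "a \<otimes>\<^bsub>cring_class_ops\<^esub> x \<in> I" if "a \<in> I" for a x
    using assms(3)[OF that, of x] by (simp add: class_simps mult.commute)
qed (simp_all add: class_simps assms(3))

lemma
  fixes I :: "'a::comm_ring_1 set"
  assumes I: "ideal I cring_class_ops"
  shows ideal_class_0: "0 \<in> I"
    and ideal_class_add: "a \<in> I \<Longrightarrow> b \<in> I \<Longrightarrow> a + b \<in> I"
    and ideal_class_mult: "a \<in> I \<Longrightarrow> r * a \<in> I"
    and ideal_class_mult_right: "a \<in> I \<Longrightarrow> a * r \<in> I"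
    and ideal_class_minus: "a \<in> I \<Longrightarrow> - a \<in> I"
    and ideal_class_diff: "a \<in> I \<Longrightarrow> b \<in> I \<Longrightarrow> a - b \<in> I"
proof -
  interpret ideal I cring_class_ops by fact
  show "0 \<in> I" using zero_closed by (simp add: class_simps)
  show add: "a + b \<in> I" if "a \<in> I" "b \<in> I" for a b
    using a_closed[OF that] by (simp add: class_simps)
  show mult: "r * a \<in> I" if "a \<in> I" for a r
    using I_l_closed[OF that, of r] by (simp add: class_simps)
  then show "a \<in> I \<Longrightarrow> a * r \<in> I" by (simp add: mult.commute)
  show minus: "- a \<in> I" if "a \<in> I" for a using mult[OF that, of "- 1"] by simp
  show "a - b \<in> I" if "a \<in> I" "b \<in> I" using add[OF that(1) minus[OF that(2)]] by simp
qed

lemma ideal_class_add_iff: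
  fixes I :: "'a::comm_ring_1 set"
  assumes "ideal I cring_class_ops" "a \<in> I"
  shows "a + b \<in> I \<longleftrightarrow> b \<in> I"
  using ideal_class_add[OF assms] ideal_class_diff[OF assms(1) _ assms(2), of "a + b"] by auto

lemma ideal_class_power_mono:
  fixes I :: "'a::comm_ring_1 set"
  assumes "ideal I cring_class_ops" "a ^ m \<in> I" "m \<le> n"
  shows "a ^ n \<in> I"
  using ideal_class_mult[OF assms(1,2), of "a ^ (n - m)"] assms(3)
  by (simp flip: power_add)

lemma ideal_class_dvd:
  fixes I :: "'a::comm_ring_1 set"
  assumes "ideal I cring_class_ops" "a \<in> I" "a dvd b"
  shows "b \<in> I"
  using assms by (auto elim!: dvdE intro: ideal_class_mult_right)

lemma ideal_class_eq_carrier_iff: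
  fixes I :: "'a::comm_ring_1 set"
  assumes "ideal I cring_class_ops"
  shows "I = carrier cring_class_ops \<longleftrightarrow> 1 \<in> I"
  using ideal_class_dvd[OF assms, of 1] by (auto simp: class_simps cring_class_ops_def)

lemma ideal_class_principal: "ideal {a. p dvd a} (cring_class_ops :: 'a::comm_ring_1 ring)"
  by (rule ideal_classI) auto

text \<open>The ideal \<open>M + R a\<close> is strictly larger than \<open>M\<close>, hence
  contains 1. The inverse of \<open>a\<close> modulo \<open>M\<close> is all that later arguments
  use of maximality.\<close>

lemma maximalideal_class_inverse:
  fixes M :: "'a::comm_ring_1 set"
  assumes "maximalideal M cring_class_ops" "a \<notin> M"
  shows "\<exists>s. s * a - 1 \<in> M"
proof -
  interpret maximalideal M cring_class_ops by fact
  note M = is_ideal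
  define J where "J = {m + s * a |m s. m \<in> M}"
  have "ideal J cring_class_ops"
  proof (rule ideal_classI)
    have "0 = 0 + 0 * a" by simp
    then show "0 \<in> J" using ideal_class_0[OF M] unfolding J_def by blast
    show "x + y \<in> J" if xy: "x \<in> J" "y \<in> J" for x y
    proof -
      obtain m s n t where "x = m + s * a" "y = n + t * a" "m \<in> M" "n \<in> M"
        using xy unfolding J_def by blast
      then have "x + y = (m + n) + (s + t) * a" "m + n \<in> M"
        using ideal_class_add[OF M] by (simp_all add: algebra_simps)
      then show ?thesis unfolding J_def by blast
    qed
    show "r * x \<in> J" if x: "x \<in> J" for r x
    proof -
      obtain m s where "x = m + s * a" "m \<in> M" using x unfolding J_def by blast
      then have "r * x = r * m + (r * s) * a" "r * m \<in> M"
        using ideal_class_mult[OF M] by (simp_all add: algebra_simps)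
      then show ?thesis unfolding J_def by blast
    qed
  qed
  moreover have "M \<subseteq> J"
  proof
    fix m assume "m \<in> M"
    moreover have "m = m + 0 * a" by simp
    ultimately show "m \<in> J" unfolding J_def by blast
  qed
  moreover have "a \<in> J"
  proof -
    have "a = 0 + 1 * a" by simp
    then show ?thesis using ideal_class_0[OF M] unfolding J_def by blast
  qed
  ultimately have "J = carrier cring_class_ops"
    using I_maximal[of J] assms(2) by (metis carrier_class subsetI)
  then have "1 \<in> J" by (simp add: class_simps)
  then obtain m s where *: "1 = m + s * a" "m \<in> M" unfolding J_def by blast
  then have "s * a - 1 = - m" by (simp add: algebra_simps)
  then show ?thesis using ideal_class_minus[OF M *(2)] by metis
qed

lemma maximalideal_class_one: "maximalideal M cring_class_ops \<Longrightarrow> (1 :: 'a::comm_ring_1) \<notin> M"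
  using ideal_class_eq_carrier_iff[of M] maximalideal.I_notcarr[of M]
  by (auto simp: maximalideal_def)

lemma maximalideal_class_prime:
  fixes M :: "'a::comm_ring_1 set"
  assumes "maximalideal M cring_class_ops" "a * b \<in> M"
  shows "a \<in> M \<or> b \<in> M"
proof (rule ccontr)
  assume *: "\<not> ?thesis"
  have M: "ideal M cring_class_ops" using assms(1) by (simp add: maximalideal_def)
  obtain s where s: "s * a - 1 \<in> M" using maximalideal_class_inverse[OF assms(1)] * by blast
  have "b = s * (a * b) - (s * a - 1) * b" by (simp add: algebra_simps)
  then have "b \<in> M"
    using ideal_class_diff[OF M ideal_class_mult[OF M assms(2)] ideal_class_mult_right[OF M s]]
    by metis
  then show False using * by blast
qed

lemma ideal_prod_class_subset_iff:
  fixes I J P :: "'a::comm_ring_1 set"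
  assumes "ideal P cring_class_ops"
  shows "ideal_prod cring_class_ops I J \<subseteq> P \<longleftrightarrow> (\<forall>a\<in>I. \<forall>b\<in>J. a * b \<in> P)"
proof
  assume L: "ideal_prod cring_class_ops I J \<subseteq> P"
  show "\<forall>a\<in>I. \<forall>b\<in>J. a * b \<in> P"
  proof (intro ballI)
    fix a b assume "a \<in> I" "b \<in> J"
    from ideal_prod.prod[OF this, of cring_class_ops] L show "a * b \<in> P"
      by (auto simp: class_simps)
  qed
next
  assume R: "\<forall>a\<in>I. \<forall>b\<in>J. a * b \<in> P"
  show "ideal_prod cring_class_ops I J \<subseteq> P"
  proof
    fix x assume "x \<in> ideal_prod cring_class_ops I J"
    then show "x \<in> P"
      by induction (use R in \<open>auto simp: class_simps intro: ideal_class_add[OF assms]\<close>)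
  qed
qed

lemma delta_ideal_classD:
  assumes "delta_ideal cring_class_ops \<delta> I"
  shows "ideal I cring_class_ops" "a \<in> I \<Longrightarrow> \<delta> a \<in> I"
  using assms by (auto simp: delta_ideal_def)

text \<open>The product rule gives
  \<open>\<delta> r * e = \<delta> (r * e) - r * \<delta> e\<close>, so stability of the colon ideal
  only depends on how \<open>\<delta>\<close> acts on \<open>A\<close>. It is applied to a Darboux
  element, to an idempotent modulo \<open>P\<close>, and to the two generators of the ideal of a
  point.\<close>

lemma delta_ideal_class_colon:
  fixes \<delta> :: "'a::comm_ring_1 \<Rightarrow> 'a"
  assumes "ring_derivation \<delta>" "delta_ideal cring_class_ops \<delta> P"
    and A: "\<And>r e. (\<And>e. e \<in> A \<Longrightarrow> r * e \<in> P) \<Longrightarrow> e \<in> A \<Longrightarrow> r * \<delta> e \<in> P"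
  shows "delta_ideal cring_class_ops \<delta> {r. \<forall>e\<in>A. r * e \<in> P}"
proof -
  note P = delta_ideal_classD[OF assms(2)]
  have "\<delta> r * e \<in> P" if r: "\<forall>e\<in>A. r * e \<in> P" and e: "e \<in> A" for r e
  proof -
    have "\<delta> r * e = \<delta> (r * e) - r * \<delta> e" by (simp add: ring_derivation_mult[OF assms(1)])
    then show ?thesis using ideal_class_diff[OF P(1) P(2) A] r e by simp
  qed
  moreover have "ideal {r. \<forall>e\<in>A. r * e \<in> P} cring_class_ops"
    by (rule ideal_classI)
      (simp_all add: ideal_class_0[OF P(1)] ideal_class_add[OF P(1)] ideal_class_mult[OF P(1)]
        distrib_right mult.assoc)
  ultimately show ?thesis by (auto simp: delta_ideal_def)
qed

lemma delta_prime_ideal_class_iff: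
  "delta_prime_ideal cring_class_ops \<delta> P \<longleftrightarrow>
     delta_ideal cring_class_ops \<delta> P \<and> (1 :: 'a::comm_ring_1) \<notin> P \<and>
     (\<forall>I J. delta_ideal cring_class_ops \<delta> I \<longrightarrow> delta_ideal cring_class_ops \<delta> J \<longrightarrow>
        (\<forall>a\<in>I. \<forall>b\<in>J. a * b \<in> P) \<longrightarrow> I \<subseteq> P \<or> J \<subseteq> P)"
proof (cases "delta_ideal cring_class_ops \<delta> P")
  case True
  then show ?thesis
    using ideal_class_eq_carrier_iff[OF delta_ideal_classD(1)[OF True]]
    by (simp add: delta_prime_ideal_def ideal_prod_class_subset_iff[OF delta_ideal_classD(1)[OF True]])
qed (simp add: delta_prime_ideal_def)

section \<open>Darboux elements\<close>

lemma ring_derivation_minus: "ring_derivation \<delta> \<Longrightarrow> \<delta> (- a) = - \<delta> a"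
  using ring_derivation_add[of \<delta> a "- a"] ring_derivation_0[of \<delta>]
  by (simp add: eq_neg_iff_add_eq_0 add.commute)

lemma ring_derivation_diff: "ring_derivation \<delta> \<Longrightarrow> \<delta> (a - b) = \<delta> a - \<delta> b"
  using ring_derivation_add[of \<delta> a "- b"] ring_derivation_minus[of \<delta> b] by simp

lemma ring_derivation_sum: "ring_derivation \<delta> \<Longrightarrow> \<delta> (sum f F) = (\<Sum>i\<in>F. \<delta> (f i))"
  by (induction F rule: infinite_finite_induct)
    (simp_all add: ring_derivation_0 ring_derivation_add)

lemma ring_derivation_power_Suc:
  "ring_derivation \<delta> \<Longrightarrow> \<delta> (a ^ Suc n) = of_nat (Suc n) * a ^ n * \<delta> a"
  by (induction n) (simp_all add: ring_derivation_mult algebra_simps)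

lemma delta_ideal_class_principal:
  assumes "ring_derivation \<delta>" "darboux \<delta> p"
  shows "delta_ideal cring_class_ops \<delta> {a. p dvd a}"
  unfolding delta_ideal_def
  using assms(2) by (auto simp: ideal_class_principal darboux_def ring_derivation_mult[OF assms(1)])

text \<open>The cofactor of a quotient is the difference of the cofactors.\<close>

lemma darboux_cancel_left:
  assumes "ring_derivation \<delta>" "darboux \<delta> a" "darboux \<delta> (a * b :: 'a::idom)"
  shows "darboux \<delta> b"
proof -
  obtain r s where rs: "\<delta> a = r * a" "\<delta> (a * b) = s * (a * b)"
    using assms(2,3) by (auto simp: darboux_def)
  have "a * \<delta> b = a * ((s - r) * b)"
    using rs ring_derivation_mult[OF assms(1), of a b] by (simp add: algebra_simps)
  then have "\<delta> b = (s - r) * b" using assms(2) by (simp add: darboux_def)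
  then show ?thesis using assms(3) by (auto simp: darboux_def)
qed

text \<open>Characteristic zero in the form needed below: the exponent produced by differentiating a
  power can be divided out.\<close>

lemma is_unit_of_nat_polyxy: "is_unit (of_nat (Suc n) :: polyxy)"
proof -
  have "of_nat (Suc n) = [:of_nat (Suc n) :: complex poly:]" by (rule of_nat_poly)
  also have "of_nat (Suc n) = [:of_nat (Suc n) :: complex:]" by (rule of_nat_poly)
  finally show ?thesis by (simp only: is_unit_const_poly_iff dvd_field_iff of_nat_neq_0 not_False_eq_True simp_thms)
qed

text \<open>Differentiate \<open>h = p ^ Suc k * m\<close> with \<open>m\<close> prime to
  \<open>p\<close> and cancel \<open>p ^ k\<close>: then \<open>p\<close> divides
  \<open>of_nat (Suc k) * \<delta> p * m\<close>, and of the three factors only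
  \<open>\<delta> p\<close> can account for it.\<close>

lemma darboux_prime_factor:
  fixes \<delta> :: "polyxy \<Rightarrow> polyxy"
  assumes "ring_derivation \<delta>" "darboux \<delta> h" "prime_elem p" "p dvd h"
  shows "darboux \<delta> p"
proof -
  have h0: "h \<noteq> 0" using assms(2) by (simp add: darboux_def)
  obtain m where m: "h = p ^ multiplicity p h * m" "\<not> p dvd m"
    using multiplicity_decompose'[OF h0, of p] assms(3) by (auto simp: prime_elem_def)
  have "multiplicity p h \<noteq> 0"
    using h0 assms(3,4) multiplicity_eq_zero_iff by (auto simp: prime_elem_def)
  then obtain k where k: "multiplicity p h = Suc k" by (cases "multiplicity p h") auto
  obtain c where c: "\<delta> h = c * h" using assms(2) by (auto simp: darboux_def)
  have "p ^ k * (of_nat (Suc k) * \<delta> p * m) = p ^ k * (p * (c * m - \<delta> m))"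
  proof -
    have "\<delta> (p ^ Suc k * m) = c * (p ^ Suc k * m)" using c m(1) k by simp
    then have "of_nat (Suc k) * p ^ k * \<delta> p * m + p ^ Suc k * \<delta> m = c * (p ^ Suc k * m)"
      by (simp only: ring_derivation_mult[OF assms(1)] ring_derivation_power_Suc[OF assms(1)])
    then show ?thesis by (simp add: algebra_simps del: of_nat_Suc)
  qed
  then have "of_nat (Suc k) * \<delta> p * m = p * (c * m - \<delta> m)"
    using assms(3) by (auto simp: prime_elem_def)
  then have "p dvd of_nat (Suc k) * \<delta> p * m" by simp
  then have "p dvd \<delta> p"
    using assms(3) m(2) dvd_trans[OF _ is_unit_of_nat_polyxy[of k], of p]
    by (auto simp: prime_elem_dvd_mult_iff simp del: of_nat_Suc)
  then show ?thesis using assms(3) by (auto simp: darboux_def prime_elem_def elim!: dvdE)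
qed

text \<open>Prime factors are stripped from \<open>h\<close> one at a time. The hypothesis
  \<open>split\<close> asks for primeness on Darboux elements only, so that maximal ideals and
  \<open>\<delta>\<close>-prime ideals are both covered.\<close>

lemma darboux_prime_in_ideal:
  fixes \<delta> :: "polyxy \<Rightarrow> polyxy"
  assumes "ring_derivation \<delta>" "darboux \<delta> h" "h \<in> M"
    and M: "ideal M polyxy_ring" "1 \<notin> M"
    and split: "\<And>a b. darboux \<delta> a \<Longrightarrow> darboux \<delta> b \<Longrightarrow> a * b \<in> M \<Longrightarrow> a \<in> M \<or> b \<in> M"
  shows "\<exists>p\<in>M. prime p \<and> darboux \<delta> p"
  using assms(2,3)
proof (induction h rule: prime_divisors_induct)
  case zero
  then show ?case by (simp add: darboux_def)
next
  case (unit x)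
  then show ?case using ideal_class_dvd[OF M(1), of x 1] M(2) by blast
next
  case (factor p x)
  have p: "darboux \<delta> p"
    using darboux_prime_factor[OF assms(1) factor.prems(1), of p] factor.hyps by simp
  moreover have "darboux \<delta> x" using darboux_cancel_left[OF assms(1) p factor.prems(1)] .
  ultimately show ?case using split[of p x] factor by blast
qed

text \<open>Being \<open>prime\<close> includes being normalized, so each class of associates
  contains exactly one such element. From here on finiteness is stated for the set of these
  representatives.\<close>

lemma finite_irreducible_darboux_iff:
  fixes \<delta> :: "polyxy \<Rightarrow> polyxy"
  assumes "ring_derivation \<delta>"
  shows "finite (irreducible_darboux \<delta> // associated_rel) \<longleftrightarrow> finite {p. prime p \<and> darboux \<delta> p}"
proof -
  have "bij_betw (\<lambda>p. associated_rel `` {p}) {p. prime p \<and> darboux \<delta> p}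
          (irreducible_darboux \<delta> // associated_rel)"
  proof (rule bij_betw_imageI)
    show "inj_on (\<lambda>p. associated_rel `` {p}) {p. prime p \<and> darboux \<delta> p}"
    proof (rule inj_onI)
      fix p q assume *: "p \<in> {p. prime p \<and> darboux \<delta> p}" "q \<in> {p. prime p \<and> darboux \<delta> p}"
        "associated_rel `` {p} = associated_rel `` {q}"
      then have "q \<in> associated_rel `` {p}" by (auto simp: associated_rel_def)
      then have "p dvd q" "q dvd p" by (simp_all add: associated_rel_def)
      moreover have "normalize p = p" "normalize q = q" using *(1,2) by (simp_all add: prime_def)
      ultimately show "p = q" by (rule associated_eqI)
    qed
    show "(\<lambda>p. associated_rel `` {p}) ` {p. prime p \<and> darboux \<delta> p} =
        irreducible_darboux \<delta> // associated_rel"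
    proof (intro subset_antisym subsetI)
      fix X assume "X \<in> (\<lambda>p. associated_rel `` {p}) ` {p. prime p \<and> darboux \<delta> p}"
      then obtain p where "X = associated_rel `` {p}" "prime p" "darboux \<delta> p" by auto
      then show "X \<in> irreducible_darboux \<delta> // associated_rel"
        by (simp add: quotientI irreducible_darboux_def prime_elem_imp_irreducible)
    next
      fix X assume "X \<in> irreducible_darboux \<delta> // associated_rel"
      then obtain a where a: "irreducible a" "darboux \<delta> a" and X: "X = associated_rel `` {a}"
        by (auto simp: irreducible_darboux_def elim!: quotientE)
      have n: "prime (normalize a)"
        using a(1) by (simp add: prime_normalize_iff irreducible_imp_prime_elem)
      \<comment> \<open>The normalized associate is a prime divisor of \<open>a\<close>, so it
        inherits the Darboux property.\<close>
      moreover have "darboux \<delta> (normalize a)"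
        by (rule darboux_prime_factor[OF assms a(2)]) (use n in simp_all)
      moreover have "X = associated_rel `` {normalize a}"
        by (simp add: X associated_rel_def)
      ultimately show "X \<in> (\<lambda>p. associated_rel `` {p}) ` {p. prime p \<and> darboux \<delta> p}"
        by (intro image_eqI[of _ _ "normalize a"]) simp_all
    qed
  qed
  from bij_betw_finite[OF this] show ?thesis by simp
qed

section \<open>Dividing a \<open>\<delta>\<close>-ideal by its greatest common divisor\<close>

lemma delta_ideal_class_quotient:
  fixes \<delta> :: "'a::idom \<Rightarrow> 'a"
  assumes "ring_derivation \<delta>" "delta_ideal cring_class_ops \<delta> I" "darboux \<delta> h"
  shows "delta_ideal cring_class_ops \<delta> {a. h * a \<in> I}"
proof -
  obtain b where b: "\<delta> h = b * h" using assms(3) by (auto simp: darboux_def)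
  \<comment> \<open>This is what the colon lemma demands for the singleton of \<open>h\<close>; it
    holds because \<open>\<delta> h\<close> is a multiple of \<open>h\<close>.\<close>
  have "r * \<delta> h \<in> I" if "r * h \<in> I" for r
    using ideal_class_mult[OF delta_ideal_classD(1)[OF assms(2)] that, of b]
    by (simp add: b mult.left_commute)
  then have "delta_ideal cring_class_ops \<delta> {a. \<forall>e\<in>{h}. a * e \<in> I}"
    by (intro delta_ideal_class_colon[OF assms(1,2)]) auto
  then show ?thesis by (simp add: mult.commute)
qed

text \<open>If \<open>?d\<close> is the gcd of the quotient, then \<open>Gcd I * ?d\<close> still
  divides all of \<open>I\<close>, hence divides \<open>Gcd I\<close>; so \<open>?d\<close> is a
  unit, and it is normalized.\<close>

lemma Gcd_quotient_eq_1:
  fixes I :: "polyxy set"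
  assumes "I \<noteq> {0}" "I \<noteq> {}"
  shows "Gcd {a. Gcd I * a \<in> I} = 1"
proof -
  have h0: "Gcd I \<noteq> 0" using assms by (auto simp: Gcd_0_iff)
  let ?d = "Gcd {a. Gcd I * a \<in> I}"
  have "Gcd I * ?d dvd Gcd I"
  proof (rule Gcd_greatest)
    fix i assume i: "i \<in> I"
    then obtain a where a: "i = Gcd I * a" by (meson Gcd_dvd dvdE)
    then have "?d dvd a" using i by (intro Gcd_dvd) simp
    then show "Gcd I * ?d dvd i" using a by simp
  qed
  then have "is_unit ?d" using h0 dvd_mult_cancel_left[of "Gcd I" ?d 1] by simp
  then have "normalize ?d = 1" by (simp only: is_unit_normalize)
  then show ?thesis by simp
qed

text \<open>With \<open>h = Gcd I\<close>: whenever \<open>h * a\<close> lies in \<open>I\<close>,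
  so does \<open>\<delta> (h * a)\<close>, and therefore \<open>h\<close> divides
  \<open>\<delta> h * a\<close>. Such \<open>a\<close> have gcd 1, so the gcd of these products is
  \<open>\<delta> h\<close> up to a unit.\<close>

lemma darboux_Gcd:
  fixes \<delta> :: "polyxy \<Rightarrow> polyxy"
  assumes "ring_derivation \<delta>" "delta_ideal polyxy_ring \<delta> I" "I \<noteq> {0}"
  shows "darboux \<delta> (Gcd I)"
proof -
  have ne: "I \<noteq> {}" using ideal_class_0[OF delta_ideal_classD(1)[OF assms(2)]] by blast
  have h0: "Gcd I \<noteq> 0" using assms(3) ne by (auto simp: Gcd_0_iff)
  let ?J = "{a. Gcd I * a \<in> I}"
  have "Gcd I dvd Gcd ((*) (\<delta> (Gcd I)) ` ?J)"
  proof (rule Gcd_greatest, clarify)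
    fix a assume a: "Gcd I * a \<in> I"
    then have "Gcd I dvd \<delta> (Gcd I * a)"
      using delta_ideal_classD(2)[OF assms(2)] by (intro Gcd_dvd)
    then show "Gcd I dvd \<delta> (Gcd I) * a"
      by (simp add: ring_derivation_mult[OF assms(1)] dvd_add_left_iff)
  qed
  then have "Gcd I dvd \<delta> (Gcd I)"
    by (simp add: Gcd_mult Gcd_quotient_eq_1[OF assms(3) ne])
  then show ?thesis using h0 by (auto simp: darboux_def elim!: dvdE)
qed

section \<open>Linear relations\<close>

text \<open>Induction on the coordinates: two relations with disjoint supports \<open>F\<close> and
  \<open>G\<close> for the old coordinates combine into one that also kills the new coordinate.
  Infinity of \<open>I\<close> leaves room for the second support.\<close>

lemma exists_linear_relation:
  fixes t :: "'i \<Rightarrow> 'k \<Rightarrow> 'a::field"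
  assumes "finite K" "infinite I"
  shows "\<exists>F c. finite F \<and> F \<subseteq> I \<and> (\<exists>i\<in>F. c i \<noteq> 0) \<and> (\<forall>k\<in>K. (\<Sum>i\<in>F. c i * t i k) = 0)"
  using assms
proof (induction K arbitrary: I rule: finite_induct)
  case empty
  then obtain i where "i \<in> I" using infinite_imp_nonempty by blast
  then show ?case by (intro exI[of _ "{i}"] exI[of _ "\<lambda>_. 1"]) simp
next
  case (insert k K)
  obtain F c where F: "finite F" "F \<subseteq> I" "\<exists>i\<in>F. c i \<noteq> 0" "\<forall>k\<in>K. (\<Sum>i\<in>F. c i * t i k) = 0"
    using insert.IH[OF insert.prems] by blast
  obtain G d where G: "finite G" "G \<subseteq> I - F" "\<exists>i\<in>G. d i \<noteq> 0" "\<forall>k\<in>K. (\<Sum>i\<in>G. d i * t i k) = 0"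
    using insert.IH[of "I - F"] insert.prems F(1) by (meson Diff_infinite_finite)
  define \<alpha> where "\<alpha> = (\<Sum>i\<in>F. c i * t i k)"
  define \<beta> where "\<beta> = (\<Sum>i\<in>G. d i * t i k)"
  show ?case
  proof (cases "\<alpha> = 0")
    case True
    then show ?thesis using F unfolding \<alpha>_def by blast
  next
    case False
    \<comment> \<open>The values \<open>\<alpha>\<close> and \<open>\<beta>\<close> at the new
      coordinate cancel. Since \<open>\<alpha>\<close> is non-zero, the coefficients on
      \<open>G\<close> remain non-trivial even if \<open>\<beta>\<close> vanishes.\<close>
    define e where "e i = (if i \<in> F then \<beta> * c i else - \<alpha> * d i)" for i
    have disj: "F \<inter> G = {}" using G(2) by blast
    have e: "(\<Sum>i\<in>F \<union> G. e i * t i l) = \<beta> * (\<Sum>i\<in>F. c i * t i l) - \<alpha> * (\<Sum>i\<in>G. d i * t i l)" for l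
    proof -
      have "(\<Sum>i\<in>F. e i * t i l) = \<beta> * (\<Sum>i\<in>F. c i * t i l)"
        by (simp add: e_def sum_distrib_left mult.assoc)
      moreover have "(\<Sum>i\<in>G. e i * t i l) = (\<Sum>i\<in>G. - \<alpha> * (d i * t i l))"
        by (rule sum.cong) (use disj in \<open>auto simp: e_def\<close>)
      ultimately show ?thesis
        by (simp add: sum.union_disjoint[OF F(1) G(1) disj] sum_distrib_left sum_negf)
    qed
    have "\<forall>l\<in>insert k K. (\<Sum>i\<in>F \<union> G. e i * t i l) = 0"
      unfolding e using F(4) G(4) by (auto simp: \<alpha>_def \<beta>_def)
    moreover have "\<exists>i\<in>F \<union> G. e i \<noteq> 0"
    proof -
      obtain i where "i \<in> G" "d i \<noteq> 0" using G(3) by blast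
      then show ?thesis using disj False by (intro bexI[of _ i]) (auto simp: e_def)
    qed
    ultimately show ?thesis using F(1,2) G(1,2)
      by (intro exI[of _ "F \<union> G"] exI[of _ e]) auto
  qed
qed

section \<open>Coefficient bounds for polynomials and operators\<close>

lemma coeff_const_poly_mult:
  "coeff (coeff (const_poly c * q) j) i = c * coeff (coeff q j) i"
  by (simp add: const_poly_def)

lemma polyxy_coeffs_bounded:
  "\<exists>n. \<forall>i j. coeff (coeff (q::polyxy) j) i \<noteq> 0 \<longrightarrow> i \<le> n \<and> j \<le> n"
proof (intro exI allI impI)
  fix i j assume ij: "coeff (coeff q j) i \<noteq> 0"
  then have j: "j \<le> degree q" by (intro le_degree) auto
  moreover have "i \<le> degree (coeff q j)" using ij by (rule le_degree)
  moreover have "degree (coeff q j) \<le> (\<Sum>j\<le>degree q. degree (coeff q j))"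
    by (rule member_le_sum) (use j in auto)
  ultimately show "i \<le> degree q + (\<Sum>j\<le>degree q. degree (coeff q j)) \<and>
      j \<le> degree q + (\<Sum>j\<le>degree q. degree (coeff q j))" by linarith
qed

lemma diff_op_coeffs_bounded:
  "\<exists>n. \<forall>i j k. coeff (coeff (coeff (p::polyxy poly) k) j) i \<noteq> 0 \<longrightarrow> i \<le> n \<and> j \<le> n \<and> k \<le> n"
proof -
  from polyxy_coeffs_bounded
  obtain f where f: "\<And>q i j. coeff (coeff (q::polyxy) j) i \<noteq> 0 \<Longrightarrow> i \<le> f q \<and> j \<le> f q"
    by metis
  show ?thesis
  proof (intro exI allI impI)
    fix i j k assume ijk: "coeff (coeff (coeff p k) j) i \<noteq> 0"
    then have k: "k \<le> degree p" by (intro le_degree) auto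
    moreover have "f (coeff p k) \<le> (\<Sum>k\<le>degree p. f (coeff p k))"
      by (rule member_le_sum) (use k in auto)
    ultimately show "i \<le> degree p + (\<Sum>k\<le>degree p. f (coeff p k)) \<and>
        j \<le> degree p + (\<Sum>k\<le>degree p. f (coeff p k)) \<and>
        k \<le> degree p + (\<Sum>k\<le>degree p. f (coeff p k))"
      using f[OF ijk] by linarith
  qed
qed

text \<open>The operators form a complex vector space of countable dimension.\<close>

lemma uncountable_family_relation:
  fixes s :: "complex \<Rightarrow> polyxy poly"
  assumes "uncountable \<Lambda>"
  shows "\<exists>F c. finite F \<and> F \<subseteq> \<Lambda> \<and> (\<exists>l\<in>F. c l \<noteq> 0) \<and>
    (\<Sum>l\<in>F. Polynomial.smult (const_poly (c l)) (s l)) = 0"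
proof -
  from diff_op_coeffs_bounded obtain N where
    N: "\<And>p i j k. coeff (coeff (coeff (p::polyxy poly) k) j) i \<noteq> 0 \<Longrightarrow> i \<le> N p \<and> j \<le> N p \<and> k \<le> N p"
    by metis
  \<comment> \<open>An uncountable set split into countably many pieces has an infinite piece; there
    all \<open>s l\<close> lie in one finite-dimensional space, cut out by the exponent bound
    \<open>n\<close>.\<close>
  have "\<exists>n. infinite {l\<in>\<Lambda>. N (s l) = n}"
  proof (rule ccontr)
    assume "\<not> ?thesis"
    then have "countable (\<Union>n. {l\<in>\<Lambda>. N (s l) = n})"
      by (intro countable_UN) (auto intro: countable_finite)
    moreover have "(\<Union>n. {l\<in>\<Lambda>. N (s l) = n}) = \<Lambda>" by auto
    ultimately show False using assms by simp
  qed
  then obtain n where n: "infinite {l\<in>\<Lambda>. N (s l) = n}" ..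
  define t where "t l = (\<lambda>(i, j, k). coeff (coeff (coeff (s l) k) j) i)" for l
  have "finite ({..n} \<times> {..n} \<times> {..n})" by simp
  from exists_linear_relation[OF this n, of t] obtain F c where
    F: "finite F" "F \<subseteq> {l\<in>\<Lambda>. N (s l) = n}" "\<exists>l\<in>F. c l \<noteq> 0"
    and 0: "\<forall>x\<in>{..n} \<times> {..n} \<times> {..n}. (\<Sum>l\<in>F. c l * t l x) = 0"
    by blast
  have "(\<Sum>l\<in>F. Polynomial.smult (const_poly (c l)) (s l)) = 0"
  proof (intro poly_eqI)
    fix k j i
    have eq: "coeff (coeff (coeff (\<Sum>l\<in>F. Polynomial.smult (const_poly (c l)) (s l)) k) j) i =
        (\<Sum>l\<in>F. c l * t l (i, j, k))"
      by (simp add: coeff_sum coeff_const_poly_mult t_def)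
    show "coeff (coeff (coeff (\<Sum>l\<in>F. Polynomial.smult (const_poly (c l)) (s l)) k) j) i =
        coeff (coeff (coeff 0 k) j) i"
    proof (cases "i \<le> n \<and> j \<le> n \<and> k \<le> n")
      case True
      then show ?thesis using 0 by (simp add: eq)
    next
      case False
      then have "t l (i, j, k) = 0" if "l \<in> F" for l
        using N[of "s l" k j i] F(2) that by (auto simp: t_def)
      then show ?thesis by (simp add: eq)
    qed
  qed
  then show ?thesis using F by blast
qed

section \<open>Pencils of Darboux elements\<close>

lemma const_poly_simps:
  "const_poly (a + b) = const_poly a + const_poly b" "const_poly (a - b) = const_poly a - const_poly b"
  "const_poly (a * b) = const_poly a * const_poly b" "const_poly 0 = 0" "const_poly 1 = 1"
  "const_poly a = 0 \<longleftrightarrow> a = 0" "const_poly a = const_poly b \<longleftrightarrow> a = b"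
  by (simp_all add: const_poly_def one_pCons)

lemma is_unit_const_poly: "is_unit (const_poly c) \<longleftrightarrow> c \<noteq> 0"
  by (simp add: const_poly_def is_unit_const_poly_iff dvd_field_iff)

lemma is_unit_polyxyE:
  assumes "is_unit (u :: polyxy)"
  obtains c where "u = const_poly c" "c \<noteq> 0"
proof -
  obtain v where v: "u = [:v:]" "is_unit v" using assms by (auto simp: is_unit_poly_iff)
  then obtain c where "v = [:c:]" "is_unit c" by (auto simp: is_unit_poly_iff)
  then show ?thesis using v that[of c] by (simp add: const_poly_def dvd_field_iff)
qed

lemma C_derivation_const: "C_derivation \<delta> \<Longrightarrow> \<delta> (const_poly c) = 0"
  using ring_derivation_1[of \<delta>] unfolding C_derivation_def
  by (metis mult.right_neutral mult_zero_right)

lemma C_derivation_smult: "C_derivation \<delta> \<Longrightarrow> \<delta> (const_poly c * a) = const_poly c * \<delta> a"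
  by (simp add: C_derivation_def)

lemma C_derivation_ring: "C_derivation \<delta> \<Longrightarrow> ring_derivation \<delta>"
  by (simp add: C_derivation_def)

lemma const_fract_subset_fract_constants:
  "C_derivation \<delta> \<Longrightarrow> range const_fract \<subseteq> fract_constants \<delta>"
  by (auto simp: fract_constants_def const_fract_def fract_derivation_Fract C_derivation_ring
      C_derivation_const ring_derivation_1 Zero_fract_def eq_fract)

text \<open>All summands but the one for \<open>i\<close> contain the factor \<open>z i\<close>, so
  \<open>z i\<close> divides that one as well, where it is coprime to the product. This is the
  independence of partial fractions with denominators cleared.\<close>

lemma partial_fractions_dvd:
  fixes z u :: "'i \<Rightarrow> 'a::{semiring_gcd, comm_ring_1}"
  assumes "finite F" "i \<in> F"
    and coprime: "\<And>j. j \<in> F \<Longrightarrow> j \<noteq> i \<Longrightarrow> coprime (z i) (z j)"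
    and 0: "(\<Sum>k\<in>F. u k * (\<Prod>j\<in>F - {k}. z j)) = 0"
  shows "z i dvd u i"
proof -
  have "z i dvd (\<Sum>k\<in>F - {i}. u k * (\<Prod>j\<in>F - {k}. z j))"
  proof (rule dvd_sum)
    fix k assume "k \<in> F - {i}"
    then have "z i dvd (\<Prod>j\<in>F - {k}. z j)"
      using assms(1,2) by (intro dvd_prodI) auto
    then show "z i dvd u k * (\<Prod>j\<in>F - {k}. z j)" by simp
  qed
  moreover have "u i * (\<Prod>j\<in>F - {i}. z j) = - (\<Sum>k\<in>F - {i}. u k * (\<Prod>j\<in>F - {k}. z j))"
    using 0 sum.remove[OF assms(1,2), of "\<lambda>k. u k * (\<Prod>j\<in>F - {k}. z j)"]
    by (simp add: eq_neg_iff_add_eq_0)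
  ultimately have "z i dvd u i * (\<Prod>j\<in>F - {i}. z j)" by simp
  moreover have "coprime (z i) (\<Prod>j\<in>F - {i}. z j)"
    by (rule prod_coprime_right) (use coprime in auto)
  ultimately show ?thesis by (simp add: coprime_dvd_mult_left_iff)
qed

text \<open>Equality of the two cofactors says that \<open>a / b\<close> is killed by the extended
  derivation, and \<open>not_const\<close> that \<open>a / b\<close> is not a complex
  number.\<close>

locale darboux_pencil =
  fixes \<delta> :: "polyxy \<Rightarrow> polyxy" and a b c :: polyxy
  assumes C_der: "C_derivation \<delta>"
    and coprime_ab: "coprime a b" and b0: "b \<noteq> 0"
    and not_const: "\<And>k. a \<noteq> const_poly k * b"
    and der_a: "\<delta> a = c * a" and der_b: "\<delta> b = c * b"
begin

lemma der: "ring_derivation \<delta>" by (rule C_derivation_ring[OF C_der])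

definition z :: "complex \<Rightarrow> polyxy" where
  "z l = a - const_poly l * b"

lemma z_neq_0: "z l \<noteq> 0"
  using not_const[of l] by (simp add: z_def)

lemma der_z: "\<delta> (z l) = c * z l"
  by (simp add: z_def ring_derivation_diff[OF der] C_derivation_smult[OF C_der] der_a der_b)
    (simp add: algebra_simps)

lemma darboux_z: "darboux \<delta> (z l)"
  unfolding darboux_def using der_z z_neq_0 by blast

text \<open>A common divisor of two members divides their difference, a non-zero constant times
  \<open>b\<close>, and then also \<open>a\<close>.\<close>

lemma coprime_z:
  assumes "l \<noteq> m"
  shows "coprime (z l) (z m)"
proof (rule coprimeI)
  fix d assume d: "d dvd z l" "d dvd z m"
  have "const_poly (m - l) * b = z l - z m"
    by (simp add: z_def const_poly_simps algebra_simps)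
  then have "d dvd const_poly (m - l) * b" using d by simp
  moreover have "is_unit (const_poly (m - l))" using assms by (simp add: is_unit_const_poly)
  ultimately have db: "d dvd b" by (simp add: dvd_mult_unit_iff')
  then have "d dvd z l + const_poly l * b" using d(1) by simp
  then have "d dvd a" by (simp add: z_def)
  with db show "is_unit d" using coprime_ab by (meson coprime_common_divisor)
qed

text \<open>At most one member is a unit: if two members are constants, so are \<open>b\<close> and
  \<open>a\<close>, and then \<open>a\<close> is a constant multiple of \<open>b\<close>.\<close>

lemma uncountable_nonunit: "uncountable {l. \<not> is_unit (z l)}"
proof -
  have "l = m" if zl: "is_unit (z l)" and zm: "is_unit (z m)" for l m
  proof (rule ccontr)
    assume "l \<noteq> m"
    obtain u where u: "z l = const_poly u" using is_unit_polyxyE[OF zl] by metis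
    obtain v where v: "z m = const_poly v" using is_unit_polyxyE[OF zm] by metis
    have "const_poly (m - l) * b = z l - z m"
      by (simp add: z_def const_poly_simps algebra_simps)
    then have "const_poly (m - l) * b = const_poly (u - v)"
      by (simp add: u v const_poly_simps)
    then have "const_poly (1 / (m - l)) * (const_poly (m - l) * b) =
        const_poly (1 / (m - l)) * const_poly (u - v)" by simp
    then have b: "b = const_poly ((u - v) / (m - l))"
      using \<open>l \<noteq> m\<close> by (simp add: mult.assoc[symmetric] const_poly_simps(3)[symmetric] const_poly_simps(5))
    define w where "w = (u - v) / (m - l)"
    have w: "b = const_poly w" "w \<noteq> 0" using b b0 by (auto simp: w_def const_poly_simps)
    have "a = z l + const_poly l * b" by (simp add: z_def)
    also have "\<dots> = const_poly (u + l * w)" unfolding u by (simp add: w const_poly_simps)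
    also have "\<dots> = const_poly ((u + l * w) / w) * b"
      unfolding w(1) const_poly_simps(3)[symmetric] nonzero_eq_divide_eq[OF w(2), THEN iffD1, OF refl] ..
    finally show False using not_const by blast
  qed
  then have "{l. is_unit (z l)} = {} \<or> (\<exists>l. {l. is_unit (z l)} = {l})" by blast
  then have "countable {l. is_unit (z l)}" by (auto simp: countable_finite)
  then have "uncountable (UNIV - {l. is_unit (z l)})"
    using uncountable_UNIV_complex by (rule uncountable_minus_countable[rotated])
  moreover have "UNIV - {l. is_unit (z l)} = {l. \<not> is_unit (z l)}" by blast
  ultimately show ?thesis by simp
qed

lemma der_prod_z: "finite G \<Longrightarrow> \<delta> (\<Prod>j\<in>G. z j) = of_nat (card G) * c * (\<Prod>j\<in>G. z j)"
  by (induction G rule: finite_induct)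
    (simp_all add: ring_derivation_1[OF der] ring_derivation_mult[OF der] der_z algebra_simps)

text \<open>Each summand is a constant times a product of \<open>card F - 1\<close> members, so all
  have the same cofactor. If the sum vanished, \<open>partial_fractions_dvd\<close> would make a
  non-unit \<open>z l\<close> divide the non-zero constant \<open>e l\<close>.\<close>

lemma darboux_combination:
  assumes F: "finite F" "F \<subseteq> {l. \<not> is_unit (z l)}" "\<exists>l\<in>F. e l \<noteq> 0"
  shows "darboux \<delta> (\<Sum>l\<in>F. const_poly (e l) * (\<Prod>j\<in>F - {l}. z j))" (is "darboux \<delta> ?h")
proof -
  have "?h \<noteq> 0"
  proof
    assume 0: "?h = 0"
    obtain l where l: "l \<in> F" "e l \<noteq> 0" using F(3) by blast
    have "z l dvd const_poly (e l)"
      by (rule partial_fractions_dvd[OF F(1) l(1) coprime_z 0]) simp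
    then have "is_unit (z l)" using l(2) is_unit_const_poly dvd_trans by blast
    then show False using F(2) l(1) by blast
  qed
  moreover have "\<delta> (const_poly (e l) * (\<Prod>j\<in>F - {l}. z j)) =
      of_nat (card F - 1) * c * (const_poly (e l) * (\<Prod>j\<in>F - {l}. z j))" if "l \<in> F" for l
    using F(1) that by (simp add: C_derivation_smult[OF C_der] der_prod_z mult_ac)
  then have "\<delta> ?h = of_nat (card F - 1) * c * ?h"
    by (simp add: ring_derivation_sum[OF der] sum_distrib_left)
  ultimately show ?thesis unfolding darboux_def by blast
qed

text \<open>
  The argument of Amitsur: the inverses of \<open>z l\<close> for uncountably many \<open>l\<close> satisfy a linear relation.
\<close>

lemma exists_darboux_in_submodule:
  fixes A :: "polyxy poly set"
  assumes A: "0 \<in> A" "\<And>p q. p \<in> A \<Longrightarrow> q \<in> A \<Longrightarrow> p + q \<in> A"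
      "\<And>r p. p \<in> A \<Longrightarrow> Polynomial.smult r p \<in> A"
    and inv: "\<And>l. \<exists>s. Polynomial.smult (z l) s - 1 \<in> A"
  shows "\<exists>h. darboux \<delta> h \<and> [:h:] \<in> A"
proof -
  from inv obtain s where s: "\<And>l. Polynomial.smult (z l) (s l) - 1 \<in> A" by metis
  from uncountable_family_relation[OF uncountable_nonunit, of s] obtain F e where
    F: "finite F" "F \<subseteq> {l. \<not> is_unit (z l)}" "\<exists>l\<in>F. e l \<noteq> 0"
    and 0: "(\<Sum>l\<in>F. Polynomial.smult (const_poly (e l)) (s l)) = 0" by blast
  define P where "P l = (\<Prod>j\<in>F - {l}. z j)" for l
  define h where "h = (\<Sum>l\<in>F. const_poly (e l) * P l)"
  have smult_sum: "Polynomial.smult r (sum f G) = (\<Sum>i\<in>G. Polynomial.smult r (f i))"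
    for r :: polyxy and f :: "complex \<Rightarrow> polyxy poly" and G
    by (induction G rule: infinite_finite_induct) (simp_all add: smult_add_right)
  have h: "[:h:] = (\<Sum>l\<in>F. [:const_poly (e l) * P l:])"
    unfolding h_def by (rule poly_eqI) (simp add: coeff_sum coeff_pCons split: nat.splits)
  \<comment> \<open>Multiplying \<open>z l * s l = 1\<close> modulo \<open>A\<close> by
    \<open>e l * P l\<close> gives every term in \<open>s\<close> the common factor
    \<open>\<Prod>j\<in>F. z j\<close>. By the relation \<open>0\<close> these terms add up to zero,
    which leaves \<open>h\<close> in \<open>A\<close>.\<close>
  have "Polynomial.smult (- (const_poly (e l) * P l)) (Polynomial.smult (z l) (s l) - 1) =
      [:const_poly (e l) * P l:] - Polynomial.smult (const_poly (e l) * P l * z l) (s l)" for l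
    by (simp add: smult_diff_right)
  then have "(\<Sum>l\<in>F. Polynomial.smult (- (const_poly (e l) * P l)) (Polynomial.smult (z l) (s l) - 1)) =
      [:h:] - (\<Sum>l\<in>F. Polynomial.smult (const_poly (e l) * P l * z l) (s l))"
    by (simp only: h sum_subtractf)
  also have "(\<Sum>l\<in>F. Polynomial.smult (const_poly (e l) * P l * z l) (s l)) =
      (\<Sum>l\<in>F. Polynomial.smult (\<Prod>j\<in>F. z j) (Polynomial.smult (const_poly (e l)) (s l)))"
  proof (rule sum.cong)
    fix l assume "l \<in> F"
    then have "(\<Prod>j\<in>F. z j) = z l * P l" unfolding P_def using F(1) by (rule prod.remove[rotated])
    then show "Polynomial.smult (const_poly (e l) * P l * z l) (s l) =
        Polynomial.smult (\<Prod>j\<in>F. z j) (Polynomial.smult (const_poly (e l)) (s l))"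
      by (simp add: mult_ac)
  qed simp
  also have "\<dots> = 0" by (simp only: smult_sum[symmetric] 0 smult_0_right)
  finally have "[:h:] = (\<Sum>l\<in>F. Polynomial.smult (- (const_poly (e l) * P l))
      (Polynomial.smult (z l) (s l) - 1))" by simp
  also have "\<dots> \<in> A"
    using F(1) by (induction F rule: finite_induct) (simp_all add: A s del: smult_minus_left)
  finally show ?thesis using darboux_combination[OF F] unfolding h_def P_def by blast
qed

text \<open>Unless a member of the pencil already lies in \<open>M\<close>, all members are
  invertible modulo \<open>M\<close>, and Amitsur's argument yields a Darboux element of
  \<open>M\<close>; one of its prime factors is again in \<open>M\<close>.\<close>

lemma exists_darboux_in_maximalideal:
  assumes "maximalideal M polyxy_ring"
  shows "M \<inter> irreducible_darboux \<delta> \<noteq> {}"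
proof -
  have M: "ideal M polyxy_ring" using assms by (simp add: maximalideal_def)
  note one = maximalideal_class_one[OF assms]
  have "\<exists>h\<in>M. darboux \<delta> h"
  proof (cases "\<exists>l. z l \<in> M")
    case True
    then show ?thesis using darboux_z by blast
  next
    case False
    \<comment> \<open>The submodule lemma speaks of operators, so \<open>M\<close> is replaced by
      the operators with constant term in \<open>M\<close>.\<close>
    have "\<exists>s. Polynomial.smult (z l) s - 1 \<in> {q. coeff q 0 \<in> M}" for l
    proof -
      obtain s where "s * z l - 1 \<in> M"
        using maximalideal_class_inverse[OF assms, of "z l"] False by blast
      then show ?thesis by (intro exI[of _ "[:s:]"]) (simp add: mult.commute)
    qed
    then have "\<exists>h. darboux \<delta> h \<and> [:h:] \<in> {q. coeff q 0 \<in> M}"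
      by (intro exists_darboux_in_submodule)
        (auto simp: ideal_class_0[OF M] intro: ideal_class_add[OF M] ideal_class_mult[OF M])
    then show ?thesis by auto
  qed
  then obtain h where "h \<in> M" "darboux \<delta> h" by blast
  from darboux_prime_in_ideal[OF der this(2,1) M one maximalideal_class_prime[OF assms]]
  show ?thesis by (auto simp: irreducible_darboux_def prime_elem_imp_irreducible)
qed

end

text \<open>Write a non-constant \<open>w\<close> killed by the derivation as \<open>a / b\<close>
  in lowest terms. Then \<open>\<delta> a * b = a * \<delta> b\<close>, so coprimality makes
  \<open>a\<close> divide \<open>\<delta> a\<close>, and cancelling \<open>a\<close> shows that
  \<open>b\<close> has the same cofactor.\<close>

lemma exists_darboux_pencil:
  assumes "C_derivation \<delta>" "fract_constants \<delta> \<noteq> range const_fract"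
  shows "\<exists>a b c. darboux_pencil \<delta> a b c"
proof -
  note der = C_derivation_ring[OF assms(1)]
  obtain w where w: "fract_derivation \<delta> w = 0" "w \<notin> range const_fract"
    using assms(2) const_fract_subset_fract_constants[OF assms(1)]
    by (auto simp: fract_constants_def)
  obtain a' b' where ab': "w = Fract a' b'" "b' \<noteq> 0" by (cases w) auto
  obtain a b where ab: "a' = a * gcd a' b'" "b' = b * gcd a' b'" "coprime a b"
    using gcd_coprime_exists[of a' b'] ab'(2) by auto
  have b0: "b \<noteq> 0" using ab(2) ab'(2) by auto
  have "gcd a' b' \<noteq> 0" using ab'(2) by simp
  then have wab: "w = Fract a b" using ab'(1) ab(1,2) b0 ab'(2)
    by (metis (no_types, lifting) eq_fract(1) mult.assoc mult.commute)
  have eq: "\<delta> a * b = a * \<delta> b"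
    using w(1) b0 by (simp add: wab fract_derivation_Fract[OF der] Zero_fract_def eq_fract)
  then have "a dvd \<delta> a * b" by simp
  then have "a dvd \<delta> a" using ab(3) by (simp add: coprime_dvd_mult_left_iff)
  then obtain c where c: "\<delta> a = c * a" by (metis dvdE mult.commute)
  have ne: "a \<noteq> const_poly k * b" for k
  proof
    assume "a = const_poly k * b"
    then have "w = const_fract k" using b0 by (simp add: wab const_fract_def eq_fract)
    then show False using w(2) by blast
  qed
  have "a \<noteq> 0" using ne[of 0] by (simp add: const_poly_simps)
  moreover have "a * \<delta> b = a * (c * b)" unfolding eq[symmetric] c by (simp only: mult_ac)
  ultimately have "\<delta> b = c * b" by (metis mult_left_cancel)
  then have "darboux_pencil \<delta> a b c"
    by unfold_locales (use assms ab(3) b0 ne c in auto)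
  then show ?thesis by blast
qed

section \<open>Primitivity of the differential operator ring\<close>

context left_module
begin

lemma smult_r_null: "a \<in> carrier R \<Longrightarrow> a \<odot>\<^bsub>M\<^esub> \<zero>\<^bsub>M\<^esub> = \<zero>\<^bsub>M\<^esub>"
  using smult_r_distr[of a "\<zero>\<^bsub>M\<^esub>" "\<zero>\<^bsub>M\<^esub>"] smult_closed[of a "\<zero>\<^bsub>M\<^esub>"]
  by (metis M.add.r_cancel_one' M.l_zero M.zero_closed)

lemma smult_l_null: "x \<in> carrier M \<Longrightarrow> \<zero> \<odot>\<^bsub>M\<^esub> x = \<zero>\<^bsub>M\<^esub>"
  using smult_l_distr[of "\<zero>" "\<zero>" x] smult_closed[of "\<zero>" x]
  by (metis M.add.r_cancel_one' R.l_zero R.zero_closed)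

lemma submoduleI:
  assumes "N \<subseteq> carrier M" "\<zero>\<^bsub>M\<^esub> \<in> N"
    and add: "\<And>x y. x \<in> N \<Longrightarrow> y \<in> N \<Longrightarrow> x \<oplus>\<^bsub>M\<^esub> y \<in> N"
    and smult: "\<And>a x. a \<in> carrier R \<Longrightarrow> x \<in> N \<Longrightarrow> a \<odot>\<^bsub>M\<^esub> x \<in> N"
  shows "submodule N R M"
proof (intro submodule.intro submodule_axioms.intro M.add.subgroupI)
  show "\<ominus>\<^bsub>M\<^esub> x \<in> N" if x: "x \<in> N" for x
  proof -
    have xM: "x \<in> carrier M" using x assms(1) by blast
    have "(\<ominus> \<one>) \<odot>\<^bsub>M\<^esub> x \<oplus>\<^bsub>M\<^esub> x = (\<ominus> \<one> \<oplus> \<one>) \<odot>\<^bsub>M\<^esub> x"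
      using xM by (simp add: smult_l_distr smult_one)
    also have "\<dots> = \<zero>\<^bsub>M\<^esub>" using xM by (simp add: R.l_neg smult_l_null)
    finally have "\<ominus>\<^bsub>M\<^esub> x = (\<ominus> \<one>) \<odot>\<^bsub>M\<^esub> x"
      using xM by (intro M.minus_equality smult_closed) simp_all
    then show ?thesis using smult[OF _ x] by simp
  qed
qed (use assms in auto)

lemma submodule_orbit:
  assumes m: "m \<in> carrier M"
  shows "submodule ((\<lambda>a. a \<odot>\<^bsub>M\<^esub> m) ` carrier R) R M"
proof (rule submoduleI)
  show "\<zero>\<^bsub>M\<^esub> \<in> (\<lambda>a. a \<odot>\<^bsub>M\<^esub> m) ` carrier R"
    using smult_l_null[OF m] by (metis R.zero_closed imageI)
qed (auto simp: smult_closed m simp flip: smult_l_distr smult_assoc)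

text \<open>The inclusion of \<open>R z\<close> in \<open>z R\<close> lets scalars pass through
  \<open>z\<close>. Together with the kernel below, this controls how a normal element acts on a
  simple module.\<close>

lemma submodule_image:
  assumes z: "z \<in> carrier R" and normal: "\<And>a. a \<in> carrier R \<Longrightarrow> \<exists>b\<in>carrier R. a \<otimes> z = z \<otimes> b"
  shows "submodule ((\<lambda>x. z \<odot>\<^bsub>M\<^esub> x) ` carrier M) R M"
proof (rule submoduleI)
  show "\<zero>\<^bsub>M\<^esub> \<in> (\<lambda>x. z \<odot>\<^bsub>M\<^esub> x) ` carrier M"
    using smult_r_null[OF z] by (metis M.zero_closed imageI)
next
  fix a y assume a: "a \<in> carrier R" and "y \<in> (\<lambda>x. z \<odot>\<^bsub>M\<^esub> x) ` carrier M"
  then obtain x where x: "x \<in> carrier M" "y = z \<odot>\<^bsub>M\<^esub> x" by blast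
  obtain b where b: "b \<in> carrier R" "a \<otimes> z = z \<otimes> b" using normal[OF a] by blast
  have "a \<odot>\<^bsub>M\<^esub> y = z \<odot>\<^bsub>M\<^esub> (b \<odot>\<^bsub>M\<^esub> x)"
    using smult_assoc[OF a z x(1)] smult_assoc[OF z b(1) x(1)] b(2) x(2) by simp
  then show "a \<odot>\<^bsub>M\<^esub> y \<in> (\<lambda>x. z \<odot>\<^bsub>M\<^esub> x) ` carrier M"
    using smult_closed[OF b(1) x(1)] by blast
qed (auto simp: smult_closed z simp flip: smult_r_distr)

text \<open>Here the opposite inclusion, of \<open>z R\<close> in \<open>R z\<close>, is what is
  needed.\<close>

lemma submodule_kernel:
  assumes z: "z \<in> carrier R" and normal: "\<And>a. a \<in> carrier R \<Longrightarrow> \<exists>b\<in>carrier R. z \<otimes> a = b \<otimes> z"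
  shows "submodule {x \<in> carrier M. z \<odot>\<^bsub>M\<^esub> x = \<zero>\<^bsub>M\<^esub>} R M"
proof (rule submoduleI)
  fix a x assume a: "a \<in> carrier R" and "x \<in> {x \<in> carrier M. z \<odot>\<^bsub>M\<^esub> x = \<zero>\<^bsub>M\<^esub>}"
  then have x: "x \<in> carrier M" "z \<odot>\<^bsub>M\<^esub> x = \<zero>\<^bsub>M\<^esub>" by blast+
  obtain b where b: "b \<in> carrier R" "z \<otimes> a = b \<otimes> z" using normal[OF a] by blast
  have "z \<odot>\<^bsub>M\<^esub> (a \<odot>\<^bsub>M\<^esub> x) = \<zero>\<^bsub>M\<^esub>"
    using smult_assoc[OF z a x(1)] smult_assoc[OF b(1) z x(1)] b x(2) by (simp add: smult_r_null)
  then show "a \<odot>\<^bsub>M\<^esub> x \<in> {x \<in> carrier M. z \<odot>\<^bsub>M\<^esub> x = \<zero>\<^bsub>M\<^esub>}"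
    using smult_closed[OF a x(1)] by blast
qed (auto simp: smult_r_null z smult_r_distr)

end

section \<open>Darboux elements are normal in the operator ring\<close>

lemma theta_times_const:
  "ring_derivation \<delta> \<Longrightarrow> theta_times \<delta> [:r:] = [:\<delta> r, r:]"
  by (simp add: theta_times_pCons)

lemma diff_op_mult_theta_right: "ring_derivation \<delta> \<Longrightarrow> diff_op_mult \<delta> p [:0, 1:] = pCons 0 p"
  using diff_op_mult_monom[of \<delta> p 1] by (simp add: monom_altdef mult.commute[of p])

text \<open>If \<open>\<delta> z = c * z\<close>, then \<open>\<theta> z = z (\<theta> + c)\<close>,
  so \<open>z\<close> moves to the left past one \<open>\<theta>\<close> at a time.\<close>

lemma darboux_normal_left:
  assumes der: "ring_derivation \<delta>" and "darboux \<delta> z"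
  shows "\<exists>s'. diff_op_mult \<delta> s [:z:] = Polynomial.smult z s'"
proof (induction s)
  case 0
  show ?case using der by (intro exI[of _ 0]) simp
next
  case (pCons a s)
  obtain c where c: "\<delta> z = c * z" using assms(2) by (auto simp: darboux_def)
  obtain s' where s': "diff_op_mult \<delta> s [:z:] = Polynomial.smult z s'" using pCons.IH by blast
  have "theta_times \<delta> [:z:] = diff_op_mult \<delta> [:z:] [:c, 1:]"
    by (simp add: theta_times_const[OF der] diff_op_mult_const_left[OF der] c mult.commute)
  then have "diff_op_mult \<delta> s (theta_times \<delta> [:z:]) = Polynomial.smult z (diff_op_mult \<delta> s' [:c, 1:])"
    by (simp only: diff_op_mult_assoc[OF der, symmetric] s' diff_op_mult_smult_left[OF der])
  then have "diff_op_mult \<delta> (pCons a s) [:z:] = Polynomial.smult z ([:a:] + diff_op_mult \<delta> s' [:c, 1:])"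
    unfolding diff_op_mult_pCons[OF der] by (simp add: smult_add_right mult.commute)
  then show ?case by blast
qed

text \<open>The same relation read as \<open>z \<theta> = (\<theta> - c) z\<close> moves
  \<open>z\<close> to the right.\<close>

lemma darboux_normal_right:
  assumes der: "ring_derivation \<delta>" and "darboux \<delta> z"
  shows "\<exists>s'. Polynomial.smult z s = diff_op_mult \<delta> s' [:z:]"
proof (induction s)
  case 0
  show ?case using der by (intro exI[of _ 0]) simp
next
  case (pCons a s)
  obtain c where c: "\<delta> z = c * z" using assms(2) by (auto simp: darboux_def)
  obtain s' where s': "Polynomial.smult z s = diff_op_mult \<delta> s' [:z:]" using pCons.IH by blast
  have "diff_op_mult \<delta> [:z:] [:0, 1:] = diff_op_mult \<delta> [:- c, 1:] [:z:]"
    by (simp add: diff_op_mult_pCons[OF der] diff_op_mult_0[OF der] theta_times_const[OF der] c)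
  then have "diff_op_mult \<delta> (diff_op_mult \<delta> s' [:z:]) [:0, 1:] =
      diff_op_mult \<delta> (diff_op_mult \<delta> s' [:- c, 1:]) [:z:]"
    by (simp only: diff_op_mult_assoc[OF der])
  then have "pCons 0 (Polynomial.smult z s) = diff_op_mult \<delta> (diff_op_mult \<delta> s' [:- c, 1:]) [:z:]"
    by (simp only: diff_op_mult_theta_right[OF der] s')
  moreover have "[:z * a:] = diff_op_mult \<delta> [:a:] [:z:]"
    by (simp add: diff_op_mult_const_left[OF der] mult.commute)
  moreover have "Polynomial.smult z (pCons a s) = [:z * a:] + pCons 0 (Polynomial.smult z s)"
    by simp
  ultimately have "Polynomial.smult z (pCons a s) =
      diff_op_mult \<delta> ([:a:] + diff_op_mult \<delta> s' [:- c, 1:]) [:z:]"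
    by (simp only: diff_op_mult_add_left[OF der])
  then show ?case by blast
qed

lemma diff_op_ring_simps [simp]:
  "carrier (diff_op_ring \<delta>) = UNIV" "p \<otimes>\<^bsub>diff_op_ring \<delta>\<^esub> q = diff_op_mult \<delta> p q"
  "\<one>\<^bsub>diff_op_ring \<delta>\<^esub> = 1" "\<zero>\<^bsub>diff_op_ring \<delta>\<^esub> = 0" "p \<oplus>\<^bsub>diff_op_ring \<delta>\<^esub> q = p + q"
  by (simp_all add: diff_op_ring_def)

context darboux_pencil
begin

lemma not_primitive_ring: "\<not> primitive_ring (diff_op_ring \<delta>)"
proof
  assume "primitive_ring (diff_op_ring \<delta>)"
  then obtain V :: "(polyxy poly, polyxy poly set) module" where
    V: "simple_left_module (diff_op_ring \<delta>) V" "faithful_module (diff_op_ring \<delta>) V"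
    unfolding primitive_ring_def by blast
  interpret left_module "diff_op_ring \<delta>" V using V(1) by (simp add: simple_left_module_def)
  have simple: "N = {\<zero>\<^bsub>V\<^esub>} \<or> N = carrier V" if "submodule N (diff_op_ring \<delta>) V" for N
    using V(1) that by (simp add: simple_left_module_def)
  obtain v where v: "v \<in> carrier V" "v \<noteq> \<zero>\<^bsub>V\<^esub>"
    using V(1) M.zero_closed unfolding simple_left_module_def by blast
  have faithful: "\<exists>x\<in>carrier V. [:h:] \<odot>\<^bsub>V\<^esub> x \<noteq> \<zero>\<^bsub>V\<^esub>" if "h \<noteq> 0" for h
  proof -
    have "[:h:] \<noteq> 0" using that by simp
    then show ?thesis using V(2) unfolding faithful_module_def by fastforce
  qed
  have orbit: "\<exists>s. x = s \<odot>\<^bsub>V\<^esub> v" if "x \<in> carrier V" for x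
  proof -
    have "v \<in> (\<lambda>a. a \<odot>\<^bsub>V\<^esub> v) ` carrier (diff_op_ring \<delta>)"
      using smult_one[OF v(1)] by (metis R.one_closed imageI)
    then have "(\<lambda>a. a \<odot>\<^bsub>V\<^esub> v) ` carrier (diff_op_ring \<delta>) = carrier V"
      using simple[OF submodule_orbit[OF v(1)]] v(2) by blast
    then show ?thesis using that by blast
  qed
  \<comment> \<open>The kernel of the normal element \<open>h\<close> is a submodule, and
    faithfulness keeps it from being all of \<open>V\<close>.\<close>
  have injective: "[:h:] \<odot>\<^bsub>V\<^esub> v \<noteq> \<zero>\<^bsub>V\<^esub>" if h: "darboux \<delta> h" for h
  proof
    assume "[:h:] \<odot>\<^bsub>V\<^esub> v = \<zero>\<^bsub>V\<^esub>"
    then have "v \<in> {x \<in> carrier V. [:h:] \<odot>\<^bsub>V\<^esub> x = \<zero>\<^bsub>V\<^esub>}" using v(1) by blast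
    moreover have "submodule {x \<in> carrier V. [:h:] \<odot>\<^bsub>V\<^esub> x = \<zero>\<^bsub>V\<^esub>} (diff_op_ring \<delta>) V"
      by (rule submodule_kernel)
        (use darboux_normal_right[OF der h] in \<open>simp_all add: diff_op_mult_const_left[OF der]\<close>)
    ultimately have "{x \<in> carrier V. [:h:] \<odot>\<^bsub>V\<^esub> x = \<zero>\<^bsub>V\<^esub>} = carrier V"
      using simple v(2) by blast
    then show False using faithful[of h] h by (auto simp: darboux_def)
  qed
  have surjective: "\<exists>x\<in>carrier V. [:h:] \<odot>\<^bsub>V\<^esub> x = v" if h: "darboux \<delta> h" for h
  proof -
    have "submodule ((\<lambda>x. [:h:] \<odot>\<^bsub>V\<^esub> x) ` carrier V) (diff_op_ring \<delta>) V"
      by (rule submodule_image)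
        (use darboux_normal_left[OF der h] in \<open>simp_all add: diff_op_mult_const_left[OF der]\<close>)
    moreover have "[:h:] \<odot>\<^bsub>V\<^esub> v \<in> (\<lambda>x. [:h:] \<odot>\<^bsub>V\<^esub> x) ` carrier V" using v(1) by blast
    ultimately have "(\<lambda>x. [:h:] \<odot>\<^bsub>V\<^esub> x) ` carrier V = carrier V"
      using simple injective[OF h] by blast
    then show ?thesis using v(1) by (metis imageE)
  qed
  \<comment> \<open>The annihilator of \<open>v\<close>. Since \<open>z l\<close> reaches
    \<open>v\<close> and \<open>V\<close> is the orbit of \<open>v\<close>, some \<open>s\<close>
    has \<open>z l * s\<close> acting on \<open>v\<close> as the identity, that is, \<open>s\<close>
    inverts \<open>z l\<close> modulo \<open>A\<close>.\<close>
  define A where "A = {s. s \<odot>\<^bsub>V\<^esub> v = \<zero>\<^bsub>V\<^esub>}"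
  have "\<exists>h. darboux \<delta> h \<and> [:h:] \<in> A"
  proof (rule exists_darboux_in_submodule)
    show "0 \<in> A" using smult_l_null[OF v(1)] by (simp add: A_def)
    show "p + q \<in> A" if "p \<in> A" "q \<in> A" for p q
      using that smult_l_distr[of p q v] v(1) by (simp add: A_def)
    show "Polynomial.smult r p \<in> A" if "p \<in> A" for r p
      using that smult_assoc[of "[:r:]" p v] smult_r_null[of "[:r:]"] v(1)
      by (simp add: A_def diff_op_mult_const_left[OF der])
    fix l
    obtain x where x: "x \<in> carrier V" "[:z l:] \<odot>\<^bsub>V\<^esub> x = v" using surjective[OF darboux_z] by blast
    obtain s where s: "x = s \<odot>\<^bsub>V\<^esub> v" using orbit[OF x(1)] by blast
    have "Polynomial.smult (z l) s \<odot>\<^bsub>V\<^esub> v = v"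
      using smult_assoc[of "[:z l:]" s v] x(2) v(1) by (simp add: s diff_op_mult_const_left[OF der])
    moreover have "(- 1) \<odot>\<^bsub>V\<^esub> v \<oplus>\<^bsub>V\<^esub> v = \<zero>\<^bsub>V\<^esub>"
      using smult_l_distr[of "- 1" 1 v] smult_one[OF v(1)] smult_l_null[OF v(1)] v(1) by simp
    ultimately have "(Polynomial.smult (z l) s - 1) \<odot>\<^bsub>V\<^esub> v = \<zero>\<^bsub>V\<^esub>"
      using smult_l_distr[of "- 1" "Polynomial.smult (z l) s" v] v(1) by simp
    then show "\<exists>s. Polynomial.smult (z l) s - 1 \<in> A" by (auto simp: A_def)
  qed
  then show False using injective by (auto simp: A_def)
qed

end

section \<open>Maximal left ideals and simple quotients of the operator ring\<close>

definition left_ideal :: "('a::comm_ring_1 \<Rightarrow> 'a) \<Rightarrow> 'a poly set \<Rightarrow> bool" where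
  "left_ideal \<delta> N \<longleftrightarrow> 0 \<in> N \<and> (\<forall>p\<in>N. \<forall>q\<in>N. p + q \<in> N) \<and> (\<forall>s. \<forall>p\<in>N. diff_op_mult \<delta> s p \<in> N)"

lemma left_ideal_smult:
  "ring_derivation \<delta> \<Longrightarrow> left_ideal \<delta> N \<Longrightarrow> p \<in> N \<Longrightarrow> Polynomial.smult r p \<in> N"
  using diff_op_mult_const_left[of \<delta> r p] by (metis left_ideal_def)

lemma left_ideal_diff:
  assumes "ring_derivation \<delta>" "left_ideal \<delta> N" "p \<in> N" "q \<in> N"
  shows "p - q \<in> N"
  using assms(2,3) left_ideal_smult[OF assms(1,2,4), of "- 1"] unfolding left_ideal_def by force

lemma left_ideal_one: "ring_derivation \<delta> \<Longrightarrow> left_ideal \<delta> N \<Longrightarrow> 1 \<in> N \<Longrightarrow> p \<in> N"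
  using diff_op_mult_one_right[of \<delta> p] by (metis left_ideal_def)

text \<open>Zorn's lemma; properness in the form \<open>1 \<notin> N\<close> passes to unions of
  chains.\<close>

lemma exists_maximal_left_ideal:
  assumes "left_ideal \<delta> K" "1 \<notin> K"
  shows "\<exists>N. left_ideal \<delta> N \<and> K \<subseteq> N \<and> 1 \<notin> N \<and>
    (\<forall>N'. left_ideal \<delta> N' \<longrightarrow> N \<subseteq> N' \<longrightarrow> 1 \<notin> N' \<longrightarrow> N' = N)"
proof -
  let ?A = "{N. left_ideal \<delta> N \<and> K \<subseteq> N \<and> 1 \<notin> N}"
  have "\<exists>N\<in>?A. \<forall>X\<in>?A. N \<subseteq> X \<longrightarrow> X = N"
  proof (rule subset_Zorn_nonempty)
    show "?A \<noteq> {}" using assms by blast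
    fix \<C> assume ne: "\<C> \<noteq> {}" and chain: "subset.chain ?A \<C>"
    have in_A: "X \<in> ?A" if "X \<in> \<C>" for X using chain that by (auto simp: subset_chain_def)
    have total: "X \<subseteq> Y \<or> Y \<subseteq> X" if "X \<in> \<C>" "Y \<in> \<C>" for X Y
      using chain that by (auto simp: subset_chain_def)
    have "p + q \<in> \<Union>\<C>" if pq: "p \<in> \<Union>\<C>" "q \<in> \<Union>\<C>" for p q
    proof -
      obtain X Y where "X \<in> \<C>" "p \<in> X" "Y \<in> \<C>" "q \<in> Y" using pq by blast
      then obtain Z where Z: "Z \<in> \<C>" "p \<in> Z" "q \<in> Z" using total by blast
      then have "p + q \<in> Z" using in_A[of Z] by (auto simp: left_ideal_def)
      then show ?thesis using Z(1) by blast
    qed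
    moreover have "diff_op_mult \<delta> s p \<in> \<Union>\<C>" if p: "p \<in> \<Union>\<C>" for s p
    proof -
      obtain X where X: "X \<in> \<C>" "p \<in> X" using p by blast
      then have "diff_op_mult \<delta> s p \<in> X" using in_A[OF X(1)] by (auto simp: left_ideal_def)
      then show ?thesis using X(1) by blast
    qed
    moreover have "0 \<in> \<Union>\<C>" using ne in_A by (auto simp: left_ideal_def)
    ultimately have "left_ideal \<delta> (\<Union>\<C>)" unfolding left_ideal_def by blast
    moreover have "K \<subseteq> \<Union>\<C>"
    proof -
      obtain X where "X \<in> \<C>" using ne by blast
      then show ?thesis using in_A[of X] by auto
    qed
    moreover have "1 \<notin> \<Union>\<C>" using in_A by auto
    ultimately show "\<Union>\<C> \<in> ?A" by (intro CollectI conjI)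
  qed
  then obtain N where N: "N \<in> ?A" and max: "\<forall>X\<in>?A. N \<subseteq> X \<longrightarrow> X = N" ..
  have "N' = N" if N': "left_ideal \<delta> N'" "N \<subseteq> N'" "1 \<notin> N'" for N'
  proof -
    have "N' \<in> ?A" using N N' by (intro CollectI conjI) auto
    then show ?thesis using max N'(2) by metis
  qed
  then show ?thesis using N by (intro exI[of _ N]) simp
qed

text \<open>The quotient by the maximal left ideal \<open>N\<close> is simple, and its annihilator
  consists of the \<open>s\<close> that multiply every operator into \<open>N\<close>; the last
  hypothesis says that this annihilator is zero.\<close>

lemma primitive_diff_op_ringI:
  fixes \<delta> :: "'a::comm_ring_1 \<Rightarrow> 'a"
  assumes der: "ring_derivation \<delta>" and N: "left_ideal \<delta> N" "1 \<notin> N"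
    and maximal: "\<And>N'. left_ideal \<delta> N' \<Longrightarrow> N \<subseteq> N' \<Longrightarrow> 1 \<notin> N' \<Longrightarrow> N' = N"
    and faithful: "\<And>s. (\<And>t. diff_op_mult \<delta> s t \<in> N) \<Longrightarrow> s = 0"
  shows "primitive_ring (diff_op_ring \<delta>)"
proof -
  define cl where "cl x = {y. y - x \<in> N}" for x
  have N0: "0 \<in> N" and N_add: "\<And>p q. p \<in> N \<Longrightarrow> q \<in> N \<Longrightarrow> p + q \<in> N"
    and N_mult: "\<And>s p. p \<in> N \<Longrightarrow> diff_op_mult \<delta> s p \<in> N"
    using N(1) by (auto simp: left_ideal_def)
  note N_diff = left_ideal_diff[OF der N(1)]
  have cl_eq: "cl x = cl y \<longleftrightarrow> x - y \<in> N" for x y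
  proof
    assume "cl x = cl y"
    moreover have "x \<in> cl x" using N0 by (simp add: cl_def)
    ultimately show "x - y \<in> N" by (simp add: cl_def)
  next
    assume xy: "x - y \<in> N"
    have "w - x \<in> N \<longleftrightarrow> w - y \<in> N" for w
      using N_add[OF _ xy, of "w - x"] N_diff[OF _ xy, of "w - y"] by auto
    then show "cl x = cl y" by (simp add: cl_def)
  qed
  \<comment> \<open>The module operations go through chosen representatives; \<open>add\<close> and
    \<open>smult\<close> below show that the choice does not matter.\<close>
  define rep where "rep X = (SOME x. cl x = X)" for X
  have rep: "rep (cl x) - x \<in> N" for x
    unfolding cl_eq[symmetric] rep_def by (rule someI) simp
  have mult_diff: "diff_op_mult \<delta> s (x - y) = diff_op_mult \<delta> s x - diff_op_mult \<delta> s y" for s x y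
    using diff_op_mult_add_right[OF der, of s "x - y" y] by simp
  define V :: "('a poly, 'a poly set) module" where
    "V = \<lparr>carrier = range cl, monoid.mult = (\<lambda>_ _. {}), one = {}, zero = cl 0,
          add = (\<lambda>X Y. cl (rep X + rep Y)), smult = (\<lambda>s X. cl (diff_op_mult \<delta> s (rep X)))\<rparr>"
  have carr: "carrier V = range cl" and zero: "\<zero>\<^bsub>V\<^esub> = cl 0" by (simp_all add: V_def)
  have add: "cl x \<oplus>\<^bsub>V\<^esub> cl y = cl (x + y)" for x y
    using N_add[OF rep[of x] rep[of y]] by (simp add: V_def cl_eq algebra_simps)
  have smult: "s \<odot>\<^bsub>V\<^esub> cl x = cl (diff_op_mult \<delta> s x)" for s x
    using N_mult[OF rep[of x], of s] by (simp add: V_def cl_eq mult_diff)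
  have "abelian_group V"
  proof (rule abelian_groupI)
    fix X assume "X \<in> carrier V"
    then obtain x where "X = cl x" by (auto simp: carr)
    then show "\<exists>Y\<in>carrier V. Y \<oplus>\<^bsub>V\<^esub> X = \<zero>\<^bsub>V\<^esub>"
      by (intro bexI[of _ "cl (- x)"]) (simp_all add: carr zero add)
  qed (auto simp: carr zero add add_ac)
  then have lm: "left_module (diff_op_ring \<delta>) V"
    by (intro left_module.intro left_module_axioms.intro ring_diff_op_ring[OF der])
      (auto simp: carr zero add smult diff_op_mult_add_left[OF der] diff_op_mult_add_right[OF der]
        diff_op_mult_assoc[OF der] diff_op_mult_one_left[OF der])
  moreover have "carrier V \<noteq> {\<zero>\<^bsub>V\<^esub>}"
  proof -
    have "cl 1 \<noteq> cl 0" using N(2) by (simp add: cl_eq)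
    then show ?thesis unfolding carr zero by blast
  qed
  moreover have "K = {\<zero>\<^bsub>V\<^esub>} \<or> K = carrier V" if K: "submodule K (diff_op_ring \<delta>) V" for K
  proof -
    interpret K: subgroup K "add_monoid V" using K by (simp add: submodule_def)
    \<comment> \<open>Submodules of the quotient correspond to left ideals above \<open>N\<close>,
      of which maximality leaves only \<open>N\<close> and the whole ring.\<close>
    define L where "L = {x. cl x \<in> K}"
    have KL: "K = cl ` L" using K.subset by (auto simp: L_def carr)
    have L: "left_ideal \<delta> L"
      unfolding left_ideal_def
    proof (intro conjI ballI allI)
      show "0 \<in> L" using K.one_closed zero by (simp add: L_def)
      show "p + q \<in> L" if "p \<in> L" "q \<in> L" for p q
        using K.m_closed[of "cl p" "cl q"] that by (simp add: L_def add)
      show "diff_op_mult \<delta> s p \<in> L" if "p \<in> L" for s p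
        using submodule.smult_closed[OF K, of s "cl p"] that by (simp add: L_def smult)
    qed
    have "N \<subseteq> L"
    proof
      fix x assume "x \<in> N"
      then have "cl x = cl 0" by (simp add: cl_eq)
      then show "x \<in> L" using K.one_closed zero by (simp add: L_def)
    qed
    show ?thesis
    proof (cases "1 \<in> L")
      case True
      then have "L = UNIV" using left_ideal_one[OF der L] by blast
      then show ?thesis by (simp add: KL carr)
    next
      case False
      then have "L = N" using maximal[OF L \<open>N \<subseteq> L\<close>] by blast
      then have "cl x = cl 0" if "x \<in> L" for x using that by (simp add: cl_eq)
      then have "K \<subseteq> {cl 0}" unfolding KL by blast
      then show ?thesis using K.one_closed unfolding zero by auto
    qed
  qed
  moreover have "faithful_module (diff_op_ring \<delta>) V"
    unfolding faithful_module_def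
  proof (intro ballI impI)
    fix s assume s: "\<forall>X\<in>carrier V. s \<odot>\<^bsub>V\<^esub> X = \<zero>\<^bsub>V\<^esub>"
    have "diff_op_mult \<delta> s t \<in> N" for t
      using s[rule_format, unfolded carr, OF rangeI, of t] by (simp add: zero smult cl_eq)
    then show "s = \<zero>\<^bsub>diff_op_ring \<delta>\<^esub>" using faithful by simp
  qed
  ultimately show ?thesis unfolding primitive_ring_def simple_left_module_def by blast
qed

text \<open>The left ideal generated by \<open>M\<close>: all \<open>\<Sum>i. \<theta>\<^sup>i m\<^sub>i\<close> with \<open>m\<^sub>i \<in> M\<close>.\<close>

inductive_set right_coeff_span :: "('a::comm_ring_1 \<Rightarrow> 'a) \<Rightarrow> 'a set \<Rightarrow> 'a poly set"
  for \<delta> M where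
    zero: "0 \<in> right_coeff_span \<delta> M"
  | step: "m \<in> M \<Longrightarrow> p \<in> right_coeff_span \<delta> M \<Longrightarrow> [:m:] + theta_times \<delta> p \<in> right_coeff_span \<delta> M"

text \<open>Left multiplication by \<open>\<theta>\<close> shifts the leading term up by one degree;
  the terms produced by \<open>\<delta>\<close> and by \<open>m\<close> stay below it.\<close>

lemma lead_coeff_theta_times:
  fixes p :: "'a::comm_ring_1 poly"
  assumes "ring_derivation \<delta>" "p \<noteq> 0"
  shows "lead_coeff ([:m:] + theta_times \<delta> p) = lead_coeff p"
proof -
  let ?q = "[:m:] + theta_times \<delta> p"
  have q: "coeff ?q (Suc n) = coeff p n + \<delta> (coeff p (Suc n))" for n
    by (simp add: theta_times_def coeff_map_derivation[OF assms(1)])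
  have "coeff ?q (Suc n) = 0" if "n > degree p" for n
    unfolding q using that by (simp add: coeff_eq_0 ring_derivation_0[OF assms(1)])
  then have "degree ?q \<le> Suc (degree p)"
    by (intro degree_le allI impI) (metis Suc_lessE)
  moreover have c: "coeff ?q (Suc (degree p)) = lead_coeff p"
    unfolding q by (simp add: coeff_eq_0 ring_derivation_0[OF assms(1)])
  ultimately have "degree ?q = Suc (degree p)"
    using assms(2) by (intro antisym le_degree) auto
  then show ?thesis using c by simp
qed

text \<open>Scalars enter from the left by
  \<open>r \<theta> p = \<theta> (r p) - \<delta>(r) p\<close>. The correction involves the scalar
  \<open>- \<delta> r\<close>, hence an induction over \<open>p\<close> with \<open>r\<close>
  arbitrary.\<close>

lemma left_ideal_right_coeff_span:
  fixes \<delta> :: "'a::comm_ring_1 \<Rightarrow> 'a"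
  assumes der: "ring_derivation \<delta>" and M: "ideal M cring_class_ops"
  shows "left_ideal \<delta> (right_coeff_span \<delta> M)"
proof -
  let ?K = "right_coeff_span \<delta> M"
  have add: "p + q \<in> ?K" if "p \<in> ?K" "q \<in> ?K" for p q
    using that
  proof (induction p arbitrary: q)
    case (step m p)
    from step.prems show ?case
    proof cases
      case zero
      then show ?thesis using right_coeff_span.step[OF step.hyps] by simp
    next
      case (step m' p')
      have "[:m:] + theta_times \<delta> p + q = [:m + m':] + theta_times \<delta> (p + p')"
        by (simp add: step theta_times_add[OF der])
      then show ?thesis
        using right_coeff_span.step[OF ideal_class_add[OF M \<open>m \<in> M\<close> step(2)] step.IH[OF step(3)]]
        by simp
    qed
  qed simp
  have theta: "theta_times \<delta> p \<in> ?K" if "p \<in> ?K" for p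
    using right_coeff_span.step[OF ideal_class_0[OF M] that] by simp
  have smult: "Polynomial.smult r p \<in> ?K" if "p \<in> ?K" for r p
    using that
  proof (induction p arbitrary: r)
    case zero
    show ?case by (simp add: right_coeff_span.zero)
  next
    case (step m p)
    have "Polynomial.smult r ([:m:] + theta_times \<delta> p) =
        ([:r * m:] + theta_times \<delta> (Polynomial.smult r p)) + Polynomial.smult (- \<delta> r) p"
      by (simp add: smult_add_right theta_times_smult[OF der])
    then show ?case
      using add[OF right_coeff_span.step[OF ideal_class_mult[OF M step.hyps(1)] step.IH] step.IH] by metis
  qed
  have "diff_op_mult \<delta> s p \<in> ?K" if "p \<in> ?K" for s p
    using that
    by (induction s arbitrary: p)
      (auto simp: diff_op_mult_pCons[OF der] diff_op_mult_0[OF der] right_coeff_span.zero intro: add smult theta)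
  then show ?thesis using add right_coeff_span.zero by (auto simp: left_ideal_def)
qed

text \<open>Leading coefficients of the elements of the span lie in \<open>M\<close>, since
  multiplication by \<open>\<theta>\<close> preserves them.\<close>

lemma one_notin_right_coeff_span:
  fixes \<delta> :: "'a::comm_ring_1 \<Rightarrow> 'a"
  assumes der: "ring_derivation \<delta>" and M: "ideal M cring_class_ops" "1 \<notin> M"
  shows "1 \<notin> right_coeff_span \<delta> M"
proof
  have "lead_coeff p \<in> M" if "p \<in> right_coeff_span \<delta> M" for p
    using that
  proof induction
    case zero
    then show ?case using ideal_class_0[OF M(1)] by simp
  next
    case (step m p)
    then show ?case
      using lead_coeff_theta_times[OF der, of p m] theta_times_0[OF der] by (cases "p = 0") auto
  qed
  moreover assume "1 \<in> right_coeff_span \<delta> M"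
  ultimately show False using M(2) by fastforce
qed

text \<open>The first two terms of the Leibniz expansion \<open>\<theta>^n r = r \<theta>^n + n
  \<delta>(r) \<theta>^(n-1) + ...\<close>; the second is stated for \<open>n = Suc i\<close> to
  avoid subtraction.\<close>

lemma theta_times_funpow_const:
  fixes \<delta> :: "'a::comm_ring_1 \<Rightarrow> 'a"
  assumes der: "ring_derivation \<delta>"
  shows "coeff ((theta_times \<delta> ^^ i) [:r:]) i = r \<and>
    (\<forall>j>i. coeff ((theta_times \<delta> ^^ i) [:r:]) j = 0) \<and>
    coeff ((theta_times \<delta> ^^ Suc i) [:r:]) i = of_nat (Suc i) * \<delta> r"
proof (induction i)
  case 0
  show ?case by (auto simp: theta_times_const[OF der] coeff_pCons split: nat.splits)
next
  case (Suc i)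
  have step: "coeff (theta_times \<delta> q) (Suc n) = coeff q n + \<delta> (coeff q (Suc n))" for q n
    by (simp add: theta_times_def coeff_map_derivation[OF der])
  have top: "coeff ((theta_times \<delta> ^^ Suc i) [:r:]) (Suc i) = r"
    using Suc by (simp add: step ring_derivation_0[OF der])
  moreover have "coeff ((theta_times \<delta> ^^ Suc i) [:r:]) j = 0" if j: "j > Suc i" for j
  proof -
    obtain k where "j = Suc k" "k > i" using j by (cases j) auto
    then show ?thesis using Suc by (simp add: step ring_derivation_0[OF der])
  qed
  moreover have "coeff ((theta_times \<delta> ^^ Suc (Suc i)) [:r:]) (Suc i) = of_nat (Suc (Suc i)) * \<delta> r"
  proof -
    have "coeff ((theta_times \<delta> ^^ Suc (Suc i)) [:r:]) (Suc i) =
        coeff ((theta_times \<delta> ^^ Suc i) [:r:]) i + \<delta> (coeff ((theta_times \<delta> ^^ Suc i) [:r:]) (Suc i))"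
      by (simp only: funpow.simps(2) o_apply step)
    also have "\<dots> = of_nat (Suc i) * \<delta> r + \<delta> r" using Suc top by (simp only:)
    finally show ?thesis by (simp add: algebra_simps)
  qed
  ultimately show ?case by blast
qed

text \<open>
  Taking the commutator with some \<open>r\<close> such that \<open>\<delta> r \<noteq> 0\<close> lowers the degree by exactly one.
\<close>

lemma two_sided_ideal_meets_base:
  fixes \<delta> :: "'a::{idom, ring_char_0} \<Rightarrow> 'a"
  assumes der: "ring_derivation \<delta>" and "\<delta> r \<noteq> 0"
    and P: "\<And>p q. p \<in> P \<Longrightarrow> q \<in> P \<Longrightarrow> p - q \<in> P"
      "\<And>s p. p \<in> P \<Longrightarrow> diff_op_mult \<delta> s p \<in> P" "\<And>s p. p \<in> P \<Longrightarrow> diff_op_mult \<delta> p s \<in> P"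
    and "p \<in> P" "p \<noteq> 0"
  shows "\<exists>a. a \<noteq> 0 \<and> [:a:] \<in> P"
  using assms(6,7)
proof (induction "degree p" arbitrary: p)
  case 0
  then obtain a where "p = [:a:]" by (metis degree_eq_zeroE)
  then show ?case using 0 by (auto simp: pCons_eq_0_iff)
next
  case (Suc n)
  let ?q = "diff_op_mult \<delta> p [:r:] - diff_op_mult \<delta> [:r:] p"
  have q: "coeff ?q j =
      (\<Sum>i\<le>Suc n. coeff p i * coeff ((theta_times \<delta> ^^ i) [:r:]) j) - r * coeff p j" for j
    unfolding diff_op_mult_const_left[OF der] diff_op_mult_def Suc.hyps(2)[symmetric]
    by (simp add: coeff_sum)
  note fp = theta_times_funpow_const[OF der]
  have "coeff ?q j = 0" if j: "j > n" for j
  proof (cases "j = Suc n")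
    case True
    have "(\<Sum>i\<le>n. coeff p i * coeff ((theta_times \<delta> ^^ i) [:r:]) (Suc n)) = 0"
      by (rule sum.neutral) (use fp[of _ r] in auto)
    then show ?thesis using fp[of "Suc n" r] unfolding q True sum.atMost_Suc by (simp only: mult.commute) simp
  next
    case False
    then have "j > Suc n" using j by simp
    then show ?thesis unfolding q using fp[of _ r] Suc.hyps(2) by (simp add: coeff_eq_0)
  qed
  then have deg: "degree ?q \<le> n" by (intro degree_le) blast
  \<comment> \<open>In degree \<open>n\<close> the term \<open>i = n\<close> cancels against
    \<open>r * coeff p n\<close>, and only the second Leibniz term of \<open>i = Suc n\<close>
    survives. It is non-zero in a domain of characteristic zero.\<close>
  have "(\<Sum>i\<le>Suc n. coeff p i * coeff ((theta_times \<delta> ^^ i) [:r:]) n) =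
      (\<Sum>i<n. coeff p i * coeff ((theta_times \<delta> ^^ i) [:r:]) n) + coeff p n * r +
      coeff p (Suc n) * (of_nat (Suc n) * \<delta> r)"
    using fp[of n r] by (simp only: sum.atMost_Suc lessThan_Suc_atMost[symmetric] sum.lessThan_Suc)
  also have "(\<Sum>i<n. coeff p i * coeff ((theta_times \<delta> ^^ i) [:r:]) n) = 0"
    by (rule sum.neutral) (use fp[of _ r] in auto)
  finally have cn: "coeff ?q n = coeff p (Suc n) * (of_nat (Suc n) * \<delta> r)" unfolding q by simp
  have "coeff p (Suc n) \<noteq> 0" using Suc.hyps(2) Suc.prems(2) by (metis leading_coeff_0_iff)
  then have "coeff ?q n \<noteq> 0" unfolding cn using assms(2) of_nat_neq_0[of n, where ?'a = 'a]
    by (simp del: of_nat_Suc)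
  then have "?q \<noteq> 0" "n = degree ?q" using deg le_degree[of ?q n] by auto
  moreover have "?q \<in> P" using P(1)[OF P(3) P(2)] Suc.prems(1) by blast
  ultimately show ?case using Suc.hyps(1) by blast
qed

text \<open>Enlarge the left ideal generated by \<open>M\<close> to a maximal one, \<open>N\<close>.
  The largest two-sided ideal \<open>P\<close> inside \<open>N\<close> meets the base ring in a
  \<open>\<delta>\<close>-ideal contained in \<open>M\<close>, hence in zero, and then
  \<open>P\<close> itself is zero by the commutator argument.\<close>

lemma delta_primitive_imp_primitive_ring:
  fixes \<delta> :: "'a::{idom, ring_char_0} \<Rightarrow> 'a"
  assumes der: "ring_derivation \<delta>" and "\<delta> \<noteq> (\<lambda>_. 0)" and "delta_primitive cring_class_ops \<delta>"
  shows "primitive_ring (diff_op_ring \<delta>)"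
proof -
  obtain r where r: "\<delta> r \<noteq> 0" using assms(2) by blast
  obtain M :: "'a set" where M: "maximalideal M cring_class_ops"
    and no_delta: "\<And>I. delta_ideal cring_class_ops \<delta> I \<Longrightarrow> I \<subseteq> M \<Longrightarrow> I = {0}"
    using assms(3) unfolding delta_primitive_def zero_class by blast
  have MI: "ideal M cring_class_ops" using M by (simp add: maximalideal_def)
  obtain N where N: "left_ideal \<delta> N" "right_coeff_span \<delta> M \<subseteq> N" "1 \<notin> N"
    and maximal: "\<And>N'. left_ideal \<delta> N' \<Longrightarrow> N \<subseteq> N' \<Longrightarrow> 1 \<notin> N' \<Longrightarrow> N' = N"
    using exists_maximal_left_ideal[OF left_ideal_right_coeff_span[OF der MI]
        one_notin_right_coeff_span[OF der MI maximalideal_class_one[OF M]]] by blast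
  have N_add: "\<And>p q. p \<in> N \<Longrightarrow> q \<in> N \<Longrightarrow> p + q \<in> N"
    and N_mult: "\<And>s p. p \<in> N \<Longrightarrow> diff_op_mult \<delta> s p \<in> N" and N0: "0 \<in> N"
    using N(1) by (auto simp: left_ideal_def)
  note N_smult = left_ideal_smult[OF der N(1)]
  \<comment> \<open>A base element of \<open>N\<close> outside \<open>M\<close> would be invertible
    modulo \<open>M\<close>, and as \<open>M\<close> lies in \<open>N\<close>, this would put 1 into
    \<open>N\<close>.\<close>
  have in_M: "a \<in> M" if "[:a:] \<in> N" for a
  proof (rule ccontr)
    assume "a \<notin> M"
    then obtain s where s: "s * a - 1 \<in> M" using maximalideal_class_inverse[OF M] by blast
    have "[:s * a - 1:] \<in> N"
      using right_coeff_span.step[OF s right_coeff_span.zero, of \<delta>] N(2)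
      by (auto simp: theta_times_0[OF der])
    moreover have "[:s * a:] \<in> N" using N_smult[OF that, of s] by simp
    ultimately have "[:s * a:] - [:s * a - 1:] \<in> N" using left_ideal_diff[OF der N(1)] by blast
    then show False using N(3) by (simp add: one_pCons)
  qed
  define P where "P = {s. \<forall>t. diff_op_mult \<delta> s t \<in> N}"
  have P_in: "p \<in> N" if "p \<in> P" for p
    using that diff_op_mult_one_right[OF der, of p] unfolding P_def by (metis mem_Collect_eq)
  have mult_diff: "diff_op_mult \<delta> (p - q) t = diff_op_mult \<delta> p t - diff_op_mult \<delta> q t" for p q t
    using diff_op_mult_add_left[OF der, of "p - q" q t] by simp
  have P_diff: "p - q \<in> P" if "p \<in> P" "q \<in> P" for p q
    using that by (simp add: P_def mult_diff left_ideal_diff[OF der N(1)])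
  have P_left: "diff_op_mult \<delta> s p \<in> P" if "p \<in> P" for s p
    using that by (simp add: P_def diff_op_mult_assoc[OF der] N_mult)
  have P_right: "diff_op_mult \<delta> p s \<in> P" if "p \<in> P" for s p
    using that by (simp add: P_def diff_op_mult_assoc[OF der])
  define I where "I = {a. [:a:] \<in> P}"
  have mult_I: "s * a \<in> I" if "a \<in> I" for s a
    using P_left[of "[:a:]" "[:s:]"] that by (simp add: I_def diff_op_mult_const_left[OF der])
  have "ideal I cring_class_ops"
  proof (rule ideal_classI)
    show I0: "0 \<in> I" by (simp add: I_def P_def diff_op_mult_0[OF der] N0)
    show "a + b \<in> I" if "a \<in> I" "b \<in> I" for a b
      using P_diff[of "[:a:]" "[:- b:]"] that mult_I[of b "- 1"] by (simp add: I_def)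
  qed (rule mult_I)
  \<comment> \<open>On the base ring, \<open>\<delta> a\<close> is the commutator of
    \<open>\<theta>\<close> and \<open>a\<close>, which stays in a two-sided ideal.\<close>
  moreover have "\<delta> a \<in> I" if "a \<in> I" for a
    using P_diff[OF P_left[of "[:a:]" "[:0, 1:]"] P_right[of "[:a:]" "[:0, 1:]"]] that
    by (simp add: I_def diff_op_mult_pCons[OF der] diff_op_mult_0[OF der] theta_times_const[OF der])
  ultimately have "delta_ideal cring_class_ops \<delta> I" by (auto simp: delta_ideal_def)
  moreover have "I \<subseteq> M" using in_M P_in by (auto simp: I_def)
  ultimately have I: "I = {0}" by (rule no_delta)
  have "s = 0" if "\<And>t. diff_op_mult \<delta> s t \<in> N" for s
  proof (rule ccontr)
    assume "s \<noteq> 0"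
    moreover have "s \<in> P" using that by (simp add: P_def)
    ultimately have "\<exists>a. a \<noteq> 0 \<and> [:a:] \<in> P"
      using two_sided_ideal_meets_base[OF der r P_diff P_left P_right] by blast
    then show False using I by (auto simp: I_def)
  qed
  from primitive_diff_op_ringI[OF der N(1,3) maximal this] show ?thesis by blast
qed

section \<open>Derivations in coordinates\<close>

text \<open>\<open>x\<close> is the inner and \<open>y\<close> the outer variable, so
  \<open>pderiv\<close> differentiates by \<open>y\<close>, and \<open>map_poly pderiv\<close> by
  \<open>x\<close>.\<close>

definition poly_x :: polyxy where "poly_x = [:[:0, 1:]:]"
definition poly_y :: polyxy where "poly_y = [:0, 1:]"

abbreviation pderiv_x :: "polyxy \<Rightarrow> polyxy" where "pderiv_x \<equiv> map_poly pderiv"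

lemma ring_derivation_pderiv: "ring_derivation (pderiv :: 'a::idom poly \<Rightarrow> 'a poly)"
  by (simp add: ring_derivation_def pderiv_add pderiv_mult mult.commute)

lemma ring_derivation_map_poly:
  assumes d: "ring_derivation d"
  shows "ring_derivation (map_poly d)"
  unfolding ring_derivation_def
proof (intro conjI allI poly_eqI)
  fix p q n
  show "coeff (map_poly d (p + q)) n = coeff (map_poly d p + map_poly d q) n"
    by (simp add: coeff_map_derivation[OF d] ring_derivation_add[OF d])
  show "coeff (map_poly d (p * q)) n = coeff (map_poly d p * q + p * map_poly d q) n"
    by (simp add: coeff_map_derivation[OF d] coeff_mult ring_derivation_sum[OF d]
        ring_derivation_mult[OF d] sum.distrib)
qed

text \<open>Constants, \<open>x\<close> and \<open>y\<close> generate the ring; the outer induction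
  splits off \<open>y\<close>, the inner one \<open>x\<close>.\<close>

lemma ring_derivation_eqI:
  fixes d e :: "polyxy \<Rightarrow> polyxy"
  assumes d: "ring_derivation d" and e: "ring_derivation e"
    and const: "\<And>c. d (const_poly c) = e (const_poly c)"
    and "d poly_x = e poly_x" "d poly_y = e poly_y"
  shows "d a = e a"
proof (induction a)
  case 0
  show ?case by (simp add: ring_derivation_0[OF d] ring_derivation_0[OF e])
next
  case (pCons u q)
  have "d [:u:] = e [:u:]"
  proof (induction u)
    case 0
    show ?case by (simp add: ring_derivation_0[OF d] ring_derivation_0[OF e])
  next
    case (pCons c v)
    have "[:pCons c v:] = const_poly c + poly_x * [:v:]"
      by (simp add: const_poly_def poly_x_def)
    then show ?case
      by (simp only: ring_derivation_add[OF d] ring_derivation_add[OF e] ring_derivation_mult[OF d]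
          ring_derivation_mult[OF e] const assms(4) pCons.IH)
  qed
  moreover have "pCons u q = [:u:] + poly_y * q" by (simp add: poly_y_def)
  ultimately show ?case
    by (simp only: ring_derivation_add[OF d] ring_derivation_add[OF e] ring_derivation_mult[OF d]
        ring_derivation_mult[OF e] assms(5) pCons.IH)
qed

lemma pderiv_coordinates:
  "pderiv poly_x = 0" "pderiv poly_y = 1" "pderiv_x poly_x = 1" "pderiv_x poly_y = 0"
  "pderiv (const_poly c) = 0" "pderiv_x (const_poly c) = 0"
  by (simp_all add: poly_x_def poly_y_def const_poly_def pderiv_pCons map_poly_pCons one_pCons)

lemma C_derivation_coordinates:
  assumes "C_derivation \<delta>"
  shows "\<delta> a = \<delta> poly_x * pderiv_x a + \<delta> poly_y * pderiv a"
proof (rule ring_derivation_eqI[OF C_derivation_ring[OF assms]])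
  note dx = ring_derivation_map_poly[OF ring_derivation_pderiv[where 'a = complex]]
  note dy = ring_derivation_pderiv[where 'a = "complex poly"]
  show "ring_derivation (\<lambda>a. \<delta> poly_x * pderiv_x a + \<delta> poly_y * pderiv a)"
    unfolding ring_derivation_def
    by (simp add: ring_derivation_add[OF dx] ring_derivation_add[OF dy]
        ring_derivation_mult[OF dx] ring_derivation_mult[OF dy] algebra_simps)
qed (simp_all add: pderiv_coordinates C_derivation_const[OF assms])

lemma pderiv_pderiv_x: "pderiv (pderiv_x a) = pderiv_x (pderiv a)"
proof (rule poly_eqI)
  fix n
  have "pderiv (of_nat m * u) = of_nat m * pderiv u" for m and u :: "complex poly"
    by (simp add: pderiv_mult)
  then show "coeff (pderiv (pderiv_x a)) n = coeff (pderiv_x (pderiv a)) n"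
    by (simp only: coeff_pderiv coeff_map_derivation[OF ring_derivation_pderiv])
qed

section \<open>Degrees of cofactors\<close>

text \<open>Degree in the inner variable. The value at 0 is unspecified, which is why
  \<open>x_degree_le_iff\<close> treats 0 separately.\<close>

definition x_degree :: "polyxy \<Rightarrow> nat" where
  "x_degree a = (GREATEST i. \<exists>j. coeff (coeff a j) i \<noteq> 0)"

lemma x_degree_ge:
  assumes "coeff (coeff a j) i \<noteq> 0"
  shows "i \<le> x_degree a"
proof -
  obtain n where n: "\<forall>i j. coeff (coeff a j) i \<noteq> 0 \<longrightarrow> i \<le> n \<and> j \<le> n"
    using polyxy_coeffs_bounded[of a] ..
  show ?thesis
    unfolding x_degree_def
  proof (rule Greatest_le_nat[where P = "\<lambda>i. \<exists>j. coeff (coeff a j) i \<noteq> 0"])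
    show "\<exists>j. coeff (coeff a j) i \<noteq> 0" using assms ..
    show "k \<le> n" if "\<exists>j. coeff (coeff a j) k \<noteq> 0" for k using n that by blast
  qed
qed

lemma x_degree_attained:
  assumes "a \<noteq> 0"
  shows "\<exists>j. coeff (coeff a j) (x_degree a) \<noteq> 0"
proof -
  have *: "\<exists>i j. coeff (coeff a j) i \<noteq> 0"
    using assms by (intro exI[of _ "degree (lead_coeff a)"] exI[of _ "degree a"]) simp
  show ?thesis
    unfolding x_degree_def
  proof (rule GreatestI_ex_nat[where P = "\<lambda>i. \<exists>j. coeff (coeff a j) i \<noteq> 0", OF *])
    show "k \<le> x_degree a" if "\<exists>j. coeff (coeff a j) k \<noteq> 0" for k
      using that x_degree_ge[of a _ k] by auto
  qed
qed

lemma degree_coeff_le_x_degree: "degree (coeff a j) \<le> x_degree a"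
proof (cases "coeff a j = 0")
  case False
  then have "coeff (coeff a j) (degree (coeff a j)) \<noteq> 0" by simp
  then show ?thesis by (rule x_degree_ge)
qed simp

lemma coeff_mult_top:
  fixes u v :: "'a::comm_semiring_0 poly"
  assumes "degree u \<le> d" "degree v \<le> e"
  shows "coeff (u * v) (d + e) = coeff u d * coeff v e"
proof -
  have "coeff (u * v) (d + e) = (\<Sum>i\<le>d + e. coeff u i * coeff v (d + e - i))" by (rule coeff_mult)
  also have "\<dots> = (\<Sum>i\<in>{d}. coeff u i * coeff v (d + e - i))"
  proof (rule sum.mono_neutral_right)
    show "\<forall>i\<in>{..d + e} - {d}. coeff u i * coeff v (d + e - i) = 0"
    proof
      fix i assume i: "i \<in> {..d + e} - {d}"
      show "coeff u i * coeff v (d + e - i) = 0"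
      proof (cases "i < d")
        case True
        then have "coeff v (d + e - i) = 0" using assms(2) by (intro coeff_eq_0) simp
        then show ?thesis by simp
      next
        case False
        then have "coeff u i = 0" using assms(1) i by (intro coeff_eq_0) simp
        then show ?thesis by simp
      qed
    qed
  qed simp_all
  finally show ?thesis by simp
qed

text \<open>
  The leading coefficients with respect to \<open>x\<close> are polynomials in \<open>y\<close>, and they multiply.
\<close>

lemma x_degree_mult_ge:
  assumes "a \<noteq> 0" "b \<noteq> 0"
  shows "x_degree a + x_degree b \<le> x_degree (a * b)"
proof -
  define top where "top a = map_poly (\<lambda>u. coeff u (x_degree a)) a" for a :: polyxy
  have top: "coeff (top a) j = coeff (coeff a j) (x_degree a)" for a j
    by (simp add: top_def coeff_map_poly)
  have nz: "top a \<noteq> 0" if "a \<noteq> 0" for a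
    using x_degree_attained[OF that] by (metis top coeff_0)
  have "coeff (top a * top b) n = coeff (coeff (a * b) n) (x_degree a + x_degree b)" for n
    by (simp add: coeff_mult[of _ _ n] coeff_sum top coeff_mult_top degree_coeff_le_x_degree)
  moreover have "top a * top b \<noteq> 0" using nz assms by simp
  ultimately obtain n where "coeff (coeff (a * b) n) (x_degree a + x_degree b) \<noteq> 0"
    by (metis leading_coeff_0_iff)
  then show ?thesis by (rule x_degree_ge)
qed

lemma x_degree_le_iff:
  "(\<forall>j. degree (coeff a j) \<le> n) \<longleftrightarrow> (a = 0 \<or> x_degree a \<le> n)"
proof (cases "a = 0")
  case False
  then obtain j where "coeff (coeff a j) (x_degree a) \<noteq> 0" using x_degree_attained by blast
  then have "x_degree a \<le> degree (coeff a j)" by (rule le_degree)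
  then show ?thesis using False degree_coeff_le_x_degree[of a] by (metis le_trans)
qed simp

lemma degree_coeff_mult_le:
  fixes a b :: polyxy
  assumes "\<And>j. degree (coeff a j) \<le> m" "\<And>j. degree (coeff b j) \<le> n"
  shows "degree (coeff (a * b) j) \<le> m + n"
  unfolding coeff_mult
  by (intro degree_sum_le) (auto intro: order.trans[OF degree_mult_le] add_mono assms)

text \<open>Partial derivatives do not raise degrees, and degrees in each variable add up in
  products, so the degrees of \<open>p\<close> cancel in the comparison. The bounds are independent
  of \<open>p\<close>: all cofactors lie in one finite-dimensional space.\<close>

lemma darboux_cofactor_bounded:
  assumes "C_derivation \<delta>" "p \<noteq> 0" and b: "\<delta> p = b * p"
    and f: "\<And>j. degree (coeff (\<delta> poly_x) j) \<le> m" "degree (\<delta> poly_x) \<le> n"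
    and g: "\<And>j. degree (coeff (\<delta> poly_y) j) \<le> m" "degree (\<delta> poly_y) \<le> n"
    and nz: "coeff (coeff b j) i \<noteq> 0"
  shows "i \<le> m \<and> j \<le> n"
proof -
  have b0: "b \<noteq> 0" using nz by auto
  have eq: "b * p = \<delta> poly_x * pderiv_x p + \<delta> poly_y * pderiv p"
    using C_derivation_coordinates[OF assms(1), of p] b by simp
  have "degree (pderiv_x p) \<le> degree p"
    by (rule degree_le) (simp add: coeff_map_derivation[OF ring_derivation_pderiv] coeff_eq_0)
  then have "degree (\<delta> poly_x * pderiv_x p) \<le> n + degree p"
    using f(2) degree_mult_le[of "\<delta> poly_x" "pderiv_x p"] by linarith
  moreover have "degree (\<delta> poly_y * pderiv p) \<le> n + degree p"
    using g(2) degree_mult_le[of "\<delta> poly_y" "pderiv p"] degree_pderiv[of p] by linarith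
  ultimately have "degree (b * p) \<le> n + degree p" unfolding eq by (rule degree_add_le)
  then have "degree b \<le> n" using b0 assms(2) by (simp add: degree_mult_eq)
  moreover have "j \<le> degree b" using nz by (intro le_degree) auto
  moreover have "x_degree b + x_degree p \<le> m + x_degree p"
  proof -
    have px: "degree (coeff (pderiv_x p) j) \<le> x_degree p" for j
      unfolding coeff_map_derivation[OF ring_derivation_pderiv]
      using degree_pderiv[of "coeff p j"] degree_coeff_le_x_degree[of p j] by linarith
    have py: "degree (coeff (pderiv p) j) \<le> x_degree p" for j
      unfolding coeff_pderiv
      using degree_mult_le[of "of_nat (Suc j)" "coeff p (Suc j)"] degree_of_nat[of "Suc j", where ?'a = complex]
        degree_coeff_le_x_degree[of p "Suc j"] by linarith
    have "\<forall>j. degree (coeff (b * p) j) \<le> m + x_degree p"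
      unfolding eq coeff_add
      by (intro allI degree_add_le degree_coeff_mult_le f(1) g(1) px py)
    then have "x_degree (b * p) \<le> m + x_degree p"
      using x_degree_le_iff b0 assms(2) by simp
    then show ?thesis using x_degree_mult_ge[OF b0 assms(2)] by linarith
  qed
  ultimately show ?thesis using x_degree_ge[OF nz] by linarith
qed

section \<open>The theorem of Darboux and Jouanolou\<close>

lemma const_fract_simps:
  "const_fract (a + b) = const_fract a + const_fract b" "const_fract (a * b) = const_fract a * const_fract b"
  "const_fract 0 = 0" "const_fract a = 0 \<longleftrightarrow> a = 0"
  by (simp_all add: const_fract_def const_poly_simps Zero_fract_def eq_fract)

lemma Fract_sum:
  assumes "c \<noteq> 0"
  shows "Fract (sum f F) c = (\<Sum>i\<in>F. Fract (f i) c)"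
proof -
  have "Fract (a + b) c = Fract a c + Fract b c" for a b
    using assms by (simp add: eq_fract algebra_simps)
  moreover have "Fract 0 c = 0" using assms by (simp add: Zero_fract_def eq_fract)
  ultimately show ?thesis
    by (induction F rule: infinite_finite_induct) (simp_all del: add_fract)
qed

text \<open>The derivative of \<open>log p\<close> by \<open>y\<close>; unlike \<open>log p\<close>
  itself it lives in the field of fractions.\<close>

definition log_pderiv :: "polyxy \<Rightarrow> polyxy fract" where
  "log_pderiv p = Fract (pderiv p) p"

text \<open>With denominators cleared, \<open>partial_fractions_dvd\<close> makes \<open>q\<close>
  divide \<open>pderiv q\<close>, which has smaller degree in \<open>y\<close> and is not
  zero.\<close>

lemma log_pderiv_independent:
  assumes F: "finite F" "\<And>p. p \<in> F \<Longrightarrow> prime p \<and> pderiv p \<noteq> 0"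
    and 0: "(\<Sum>p\<in>F. const_fract (c p) * log_pderiv p) = 0" and q: "q \<in> F"
  shows "c q = 0"
proof (rule ccontr)
  assume cq: "c q \<noteq> 0"
  have nz: "p \<noteq> 0" if "p \<in> F" for p using F(2)[OF that] by auto
  have summand: "const_fract (c p) * log_pderiv p * Fract (\<Prod>q\<in>F. q) 1 =
      Fract (const_poly (c p) * pderiv p * (\<Prod>q\<in>F - {p}. q)) 1" if p: "p \<in> F" for p
    using nz[OF p] prod.remove[OF F(1) p, of "\<lambda>q. q"]
    by (simp add: const_fract_def log_pderiv_def eq_fract mult_ac)
  have "Fract (\<Sum>p\<in>F. const_poly (c p) * pderiv p * (\<Prod>q\<in>F - {p}. q)) 1 =
      (\<Sum>p\<in>F. const_fract (c p) * log_pderiv p) * Fract (\<Prod>q\<in>F. q) 1"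
    by (simp add: Fract_sum sum_distrib_right summand)
  then have "(\<Sum>p\<in>F. const_poly (c p) * pderiv p * (\<Prod>q\<in>F - {p}. q)) = 0"
    by (simp add: 0 Zero_fract_def eq_fract)
  then have "q dvd const_poly (c q) * pderiv q"
    by (rule partial_fractions_dvd[OF F(1) q, rotated])
      (use F(2) q in \<open>auto intro: primes_coprime\<close>)
  then have "q dvd pderiv q"
    using is_unit_const_poly[of "c q"] cq by (simp add: dvd_mult_unit_iff')
  then have "degree q \<le> degree (pderiv q)" using F(2)[OF q] by (intro dvd_imp_degree_le) auto
  then have "degree q = 0" by (simp add: degree_pderiv)
  then show False using F(2)[OF q] by (auto elim: degree_eq_zeroE simp: pderiv_pCons)
qed

text \<open>Differentiate \<open>f * px + g * py = b * p\<close> by \<open>y\<close> and eliminate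
  \<open>px\<close> with the same equation. The outcome matters by its shape: a term linear in the
  cofactor \<open>b\<close>, plus \<open>log_pderiv p\<close> times a factor that depends on
  \<open>\<delta>\<close> only.\<close>

lemma fract_derivation_log_pderiv:
  assumes "C_derivation \<delta>" "p \<noteq> 0" and b: "\<delta> p = b * p" and f0: "\<delta> poly_x \<noteq> 0"
  shows "fract_derivation \<delta> (log_pderiv p) =
    Fract (pderiv b * \<delta> poly_x - pderiv (\<delta> poly_x) * b) (\<delta> poly_x) +
    Fract (pderiv (\<delta> poly_x) * \<delta> poly_y - pderiv (\<delta> poly_y) * \<delta> poly_x) (\<delta> poly_x) * log_pderiv p"
proof -
  note der = C_derivation_ring[OF assms(1)]
  note coord = C_derivation_coordinates[OF assms(1)]
  define f g where "f = \<delta> poly_x" and "g = \<delta> poly_y"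
  define px py where "px = pderiv_x p" and "py = pderiv p"
  have 1: "b * p = f * px + g * py"
    using coord[of p] b by (simp add: f_def g_def px_def py_def)
  \<comment> \<open>As partial derivatives commute, the second derivatives of \<open>p\<close> enter
    only through this expression for \<open>\<delta> py\<close>.\<close>
  have "\<delta> py = f * pderiv_x py + g * pderiv py" unfolding f_def g_def by (rule coord)
  moreover have "pderiv (b * p) = pderiv (f * px + g * py)" by (simp only: 1)
  then have "b * py + pderiv b * p = f * pderiv_x py + px * pderiv f + (g * pderiv py + py * pderiv g)"
    by (simp add: pderiv_add pderiv_mult pderiv_pderiv_x px_def py_def algebra_simps)
  ultimately have "\<delta> py = b * py + pderiv b * p - px * pderiv f - py * pderiv g"
    by (simp add: algebra_simps)
  then have "\<delta> py * p - py * \<delta> p = (pderiv b * p - px * pderiv f - py * pderiv g) * p"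
    by (simp only: b) (simp add: algebra_simps)
  then have L: "fract_derivation \<delta> (log_pderiv p) = Fract (pderiv b * p - px * pderiv f - py * pderiv g) p"
    using assms(2) by (simp add: log_pderiv_def fract_derivation_Fract[OF der] py_def eq_fract)
  \<comment> \<open>Multiplication by \<open>f\<close> allows \<open>f * px\<close> to be traded for
    \<open>b * p - g * py\<close>.\<close>
  have "(pderiv b * p - px * pderiv f - py * pderiv g) * f =
      (pderiv b * f - pderiv f * b) * p + (pderiv f * g - pderiv g * f) * py +
      pderiv f * (b * p - (f * px + g * py))"
    by (simp add: algebra_simps)
  then have N: "(pderiv b * p - px * pderiv f - py * pderiv g) * f =
      (pderiv b * f - pderiv f * b) * p + (pderiv f * g - pderiv g * f) * py" by (simp add: 1)
  have "(pderiv b * p - px * pderiv f - py * pderiv g) * (f * (f * p)) =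
      ((pderiv b * p - px * pderiv f - py * pderiv g) * f) * (f * p)" by (simp only: mult.assoc)
  also have "\<dots> = ((pderiv b * f - pderiv f * b) * (f * p) + (pderiv f * g - pderiv g * f) * py * f) * p"
    unfolding N by (simp add: algebra_simps)
  finally have "(pderiv b * p - px * pderiv f - py * pderiv g) * (f * (f * p)) =
      ((pderiv b * f - pderiv f * b) * (f * p) + (pderiv f * g - pderiv g * f) * py * f) * p" .
  then show ?thesis
    unfolding L using assms(2) f0
    by (simp add: f_def[symmetric] g_def[symmetric] log_pderiv_def py_def[symmetric] eq_fract)
qed

lemma fract_derivation_const_fract_mult:
  assumes "C_derivation \<delta>"
  shows "fract_derivation \<delta> (const_fract c * w) = const_fract c * fract_derivation \<delta> w"
proof -
  have "fract_derivation \<delta> (const_fract c) = 0"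
    using const_fract_subset_fract_constants[OF assms] by (auto simp: fract_constants_def)
  then show ?thesis
    by (simp add: ring_derivation_mult[OF ring_derivation_fract_derivation[OF C_derivation_ring[OF assms]]])
qed

text \<open>
  The eigenvalue does not depend on the relation, so the quotient of two such combinations is a
  constant of \<open>\<delta>\<close>.
\<close>

lemma fract_derivation_combination:
  assumes "C_derivation \<delta>" and f0: "\<delta> poly_x \<noteq> 0"
    and F: "\<And>p. p \<in> F \<Longrightarrow> p \<noteq> 0 \<and> \<delta> p = b p * p"
    and rel: "(\<Sum>p\<in>F. const_poly (c p) * b p) = 0"
  shows "fract_derivation \<delta> (\<Sum>p\<in>F. const_fract (c p) * log_pderiv p) =
    Fract (pderiv (\<delta> poly_x) * \<delta> poly_y - pderiv (\<delta> poly_y) * \<delta> poly_x) (\<delta> poly_x) *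
    (\<Sum>p\<in>F. const_fract (c p) * log_pderiv p)" (is "?l = ?C * ?B")
proof -
  define f where "f = \<delta> poly_x"
  have "?l = (\<Sum>p\<in>F. const_fract (c p) * fract_derivation \<delta> (log_pderiv p))"
    by (simp add: ring_derivation_sum[OF ring_derivation_fract_derivation[OF C_derivation_ring[OF assms(1)]]]
        fract_derivation_const_fract_mult[OF assms(1)])
  also have "\<dots> = (\<Sum>p\<in>F. const_fract (c p) * (Fract (pderiv (b p) * f - pderiv f * b p) f + ?C * log_pderiv p))"
    by (rule sum.cong) (use F in \<open>simp_all add: fract_derivation_log_pderiv[OF assms(1) _ _ f0] f_def\<close>)
  also have "\<dots> = (\<Sum>p\<in>F. const_fract (c p) * Fract (pderiv (b p) * f - pderiv f * b p) f) + ?C * ?B"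
    by (simp only: distrib_left sum.distrib sum_distrib_left mult.left_commute)
  also have "(\<Sum>p\<in>F. const_fract (c p) * Fract (pderiv (b p) * f - pderiv f * b p) f) =
      Fract (\<Sum>p\<in>F. const_poly (c p) * (pderiv (b p) * f - pderiv f * b p)) f"
    using f0 by (simp add: Fract_sum f_def const_fract_def)
  \<comment> \<open>The numerators are linear in the cofactors over the constants, so the relation
    makes them cancel.\<close>
  also have "(\<Sum>p\<in>F. const_poly (c p) * (pderiv (b p) * f - pderiv f * b p)) =
      pderiv (\<Sum>p\<in>F. const_poly (c p) * b p) * f - pderiv f * (\<Sum>p\<in>F. const_poly (c p) * b p)"
    by (simp add: ring_derivation_sum[OF ring_derivation_pderiv] pderiv_mult pderiv_coordinates sum_distrib_left sum_distrib_right
        sum_subtractf algebra_simps)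
  finally have "?l = Fract (pderiv 0 * f - pderiv f * 0) f + ?C * ?B" by (simp only: rel)
  moreover have "Fract 0 f = 0" using f0 by (simp add: Zero_fract_def eq_fract f_def)
  ultimately show ?thesis by (simp only: pderiv_0 mult_zero_left mult_zero_right diff_self add_0_left)
qed

text \<open>For \<open>p\<close> in \<open>x\<close> alone, \<open>\<delta> p\<close> is
  \<open>\<delta> poly_x\<close> times the derivative of \<open>p\<close> by \<open>x\<close>. So
  \<open>p\<close> would divide \<open>\<delta> poly_x\<close> or its own derivative, and the latter
  happens for constants only.\<close>

lemma pderiv_darboux_prime_neq_0:
  assumes "C_derivation \<delta>" "prime p" "darboux \<delta> p" "\<not> p dvd \<delta> poly_x"
  shows "pderiv p \<noteq> 0"
proof
  assume "pderiv p = 0"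
  then obtain u where p: "p = [:u:]" using pderiv_eq_0_iff by (metis degree_eq_zeroE)
  have "p dvd \<delta> p" using assms(3) by (auto simp: darboux_def)
  then have "p dvd \<delta> poly_x * pderiv_x p"
    using C_derivation_coordinates[OF assms(1), of p] \<open>pderiv p = 0\<close> by simp
  then have "p dvd pderiv_x p" using assms(2,4) by (simp add: prime_dvd_mult_iff)
  then have "u dvd pderiv u" by (simp add: p map_poly_pCons)
  have "pderiv u = 0"
  proof (rule ccontr)
    assume *: "pderiv u \<noteq> 0"
    then have "degree u \<le> degree (pderiv u)" using \<open>u dvd pderiv u\<close> by (intro dvd_imp_degree_le)
    then have "degree u = 0" by (simp add: degree_pderiv)
    then show False using * pderiv_eq_0_iff by blast
  qed
  then obtain c where "u = [:c:]" using pderiv_eq_0_iff by (metis degree_eq_zeroE)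
  then have "p = const_poly c" by (simp add: p const_poly_def)
  then show False using assms(2) is_unit_const_poly[of c] by (auto simp: const_poly_simps)
qed

text \<open>Otherwise \<open>x\<close> would be a non-constant element killed by the derivation.
  This permits division by \<open>\<delta> poly_x\<close>.\<close>

lemma delta_poly_x_neq_0:
  assumes "C_derivation \<delta>" "fract_constants \<delta> = range const_fract"
  shows "\<delta> poly_x \<noteq> 0"
proof
  assume "\<delta> poly_x = 0"
  then have "Fract poly_x 1 \<in> fract_constants \<delta>"
    by (simp add: fract_constants_def fract_derivation_extends[OF C_derivation_ring[OF assms(1)]] Zero_fract_def)
  then obtain c where "Fract poly_x 1 = const_fract c" unfolding assms(2) by blast
  then show False by (simp add: const_fract_def eq_fract poly_x_def const_poly_def)
qed

lemma finite_darboux_primes: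
  assumes C: "C_derivation \<delta>" and const: "fract_constants \<delta> = range const_fract"
  shows "finite {p. prime p \<and> darboux \<delta> p}"
proof (rule ccontr)
  assume inf: "infinite {p. prime p \<and> darboux \<delta> p}"
  note f0 = delta_poly_x_neq_0[OF C const]
  \<comment> \<open>Only finitely many primes divide \<open>\<delta> poly_x\<close>; the others have
    non-zero derivative by \<open>y\<close>, as the independence of logarithmic derivatives
    requires.\<close>
  define I where "I = {p. prime p \<and> darboux \<delta> p} - {p. prime p \<and> p dvd \<delta> poly_x}"
  have "{p. prime p \<and> p dvd \<delta> poly_x} = prime_factors (\<delta> poly_x)"
    using f0 by (auto simp: prime_factors_dvd)
  then have "finite {p. prime p \<and> p dvd \<delta> poly_x}" by simp
  then have infI: "infinite I" unfolding I_def using inf by (rule Diff_infinite_finite)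
  have I: "prime p \<and> pderiv p \<noteq> 0" if "p \<in> I" for p
    using that pderiv_darboux_prime_neq_0[OF C] by (auto simp: I_def)
  have "\<forall>p\<in>I. \<exists>b. \<delta> p = b * p" by (auto simp: I_def darboux_def)
  then obtain b where b: "\<And>p. p \<in> I \<Longrightarrow> \<delta> p = b p * p" by metis
  define m where "m = max (x_degree (\<delta> poly_x)) (x_degree (\<delta> poly_y))"
  define n where "n = max (degree (\<delta> poly_x)) (degree (\<delta> poly_y))"
  have bounded: "i \<le> m \<and> j \<le> n" if "p \<in> I" "coeff (coeff (b p) j) i \<noteq> 0" for p i j
  proof (rule darboux_cofactor_bounded[OF C _ b[OF that(1)]])
    show "p \<noteq> 0" using I[OF that(1)] by auto
    show "degree (coeff (\<delta> poly_x) j) \<le> m" "degree (coeff (\<delta> poly_y) j) \<le> m" for j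
      unfolding m_def using degree_coeff_le_x_degree by (meson le_max_iff_disj)+
  qed (use that in \<open>auto simp: n_def\<close>)
  have relation: "\<exists>F c. finite F \<and> F \<subseteq> J \<and> (\<exists>p\<in>F. c p \<noteq> 0) \<and> (\<Sum>p\<in>F. const_poly (c p) * b p) = 0"
    if J: "infinite J" "J \<subseteq> I" for J
  proof -
    have "finite ({..m} \<times> {..n})" by simp
    from exists_linear_relation[OF this J(1), of "\<lambda>p (i, j). coeff (coeff (b p) j) i"]
    obtain F c where F: "finite F" "F \<subseteq> J" "\<exists>p\<in>F. c p \<noteq> 0"
      and 0: "\<forall>x\<in>{..m} \<times> {..n}. (\<Sum>p\<in>F. c p * (case x of (i, j) \<Rightarrow> coeff (coeff (b p) j) i)) = 0"
      by blast
    have "(\<Sum>p\<in>F. const_poly (c p) * b p) = 0"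
    proof (intro poly_eqI)
      fix j i
      have "(\<Sum>p\<in>F. c p * coeff (coeff (b p) j) i) = 0"
      proof (cases "i \<le> m \<and> j \<le> n")
        case True
        then show ?thesis using 0[rule_format, of "(i, j)"] by simp
      next
        case False
        then have "coeff (coeff (b p) j) i = 0" if "p \<in> F" for p
          using bounded that F(2) J(2) by blast
        then show ?thesis by simp
      qed
      then show "coeff (coeff (\<Sum>p\<in>F. const_poly (c p) * b p) j) i = coeff (coeff 0 j) i"
        by (simp add: coeff_sum coeff_const_poly_mult)
    qed
    then show ?thesis using F by blast
  qed
  obtain F c where F: "finite F" "F \<subseteq> I" "\<exists>p\<in>F. c p \<noteq> 0" "(\<Sum>p\<in>F. const_poly (c p) * b p) = 0"
    using relation[OF infI] by blast
  \<comment> \<open>The second relation is taken on indices disjoint from \<open>F\<close>, so that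
    a proportionality between the two combinations contradicts independence.\<close>
  obtain G d where G: "finite G" "G \<subseteq> I - F" "\<exists>p\<in>G. d p \<noteq> 0" "(\<Sum>p\<in>G. const_poly (d p) * b p) = 0"
    using relation[OF Diff_infinite_finite[OF F(1) infI]] by blast
  define B where "B F c = (\<Sum>p\<in>F. const_fract (c p) * log_pderiv p)" for F c
  define w where "w = B F c / B G d"
  have nz: "B G d \<noteq> 0"
    using log_pderiv_independent[OF G(1), of d] G(2,3) I unfolding B_def by blast
  then have BF: "B F c = w * B G d" by (simp add: w_def)
  define C' where "C' = Fract (pderiv (\<delta> poly_x) * \<delta> poly_y - pderiv (\<delta> poly_y) * \<delta> poly_x) (\<delta> poly_x)"
  have I0: "p \<noteq> 0 \<and> \<delta> p = b p * p" if "p \<in> I" for p using I[OF that] b[OF that] by auto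
  have 1: "fract_derivation \<delta> (B F c) = C' * B F c" unfolding B_def C'_def
    by (rule fract_derivation_combination[OF C f0 _ F(4)]) (use I0 F(2) in blast)
  have 2: "fract_derivation \<delta> (B G d) = C' * B G d" unfolding B_def C'_def
    by (rule fract_derivation_combination[OF C f0 _ G(4)]) (use I0 G(2) in blast)
  have "fract_derivation \<delta> w * B G d = 0"
    using 1 unfolding BF ring_derivation_mult[OF ring_derivation_fract_derivation[OF C_derivation_ring[OF C]]] 2
    by (simp add: mult_ac)
  then have "w \<in> fract_constants \<delta>" using nz by (simp add: fract_constants_def)
  then obtain k where k: "w = const_fract k" unfolding const by blast
  \<comment> \<open>If the quotient \<open>w\<close> is the constant \<open>k\<close>, this is a
    relation among logarithmic derivatives; independence makes it trivial, although \<open>c\<close>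
    is non-zero somewhere on \<open>F\<close>.\<close>
  define e where "e p = (if p \<in> F then c p else - (k * d p))" for p
  have disj: "F \<inter> G = {}" using G(2) by blast
  have "B (F \<union> G) e = B F e + B G e"
    unfolding B_def by (rule sum.union_disjoint[OF F(1) G(1) disj])
  also have "B F e = B F c" unfolding B_def by (rule sum.cong) (simp_all add: e_def)
  also have "B G e = const_fract (- k) * B G d"
    unfolding B_def sum_distrib_left
    by (rule sum.cong) (use disj in \<open>auto simp: e_def mult.assoc[symmetric] const_fract_simps(2)[symmetric]\<close>)
  also have "B F c + const_fract (- k) * B G d = (const_fract k + const_fract (- k)) * B G d"
    by (simp add: BF k distrib_right)
  also have "const_fract k + const_fract (- k) = const_fract 0"
    by (simp add: const_fract_simps(1)[symmetric])
  finally have "(\<Sum>p\<in>F \<union> G. const_fract (e p) * log_pderiv p) = 0"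
    by (simp add: const_fract_simps B_def)
  then have "e p = 0" if "p \<in> F" for p
    by (rule log_pderiv_independent[rotated 2]) (use that I F(1,2) G(1,2) in auto)
  then show False using F(3) by (simp add: e_def)
qed

section \<open>Points of the plane\<close>

text \<open>The polynomials vanishing at \<open>x = c\<close>, \<open>y = d\<close>; the outer
  variable is evaluated first, at a constant polynomial.\<close>

definition point_ideal :: "complex \<Rightarrow> complex \<Rightarrow> polyxy set" where
  "point_ideal c d = {a. poly (poly a [:d:]) c = 0}"

definition line_x :: "complex \<Rightarrow> polyxy" where "line_x c = [:[:- c, 1:]:]"
definition line_y :: "complex \<Rightarrow> polyxy" where "line_y d = [:[:- d:], 1:]"

lemma line_x_altdef: "line_x c = poly_x - const_poly c"
  by (simp add: line_x_def poly_x_def const_poly_def)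

lemma C_derivation_line_x: "C_derivation \<delta> \<Longrightarrow> \<delta> (line_x c) = \<delta> poly_x"
  by (simp add: line_x_altdef ring_derivation_diff[OF C_derivation_ring] C_derivation_const)

text \<open>Division by \<open>y - d\<close> leaves a remainder in \<open>x\<close>, which is then
  divided by \<open>x - c\<close>.\<close>

lemma polyxy_taylor: "\<exists>u v. a = const_poly (poly (poly a [:d:]) c) + u * line_x c + v * line_y d"
proof -
  have "[:- [:d:], 1:] dvd a - [:poly a [:d:]:]"
    by (subst poly_eq_0_iff_dvd[symmetric]) simp
  then obtain v where v: "a - [:poly a [:d:]:] = [:- [:d:], 1:] * v" by (elim dvdE)
  have "[:- c, 1:] dvd poly a [:d:] - [:poly (poly a [:d:]) c:]"
    by (simp add: poly_eq_0_iff_dvd[symmetric])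
  then obtain u where u: "poly a [:d:] - [:poly (poly a [:d:]) c:] = [:- c, 1:] * u" by (elim dvdE)
  have "a = (a - [:poly a [:d:]:]) + [:poly a [:d:] - [:poly (poly a [:d:]) c:]:] + const_poly (poly (poly a [:d:]) c)"
    by (simp add: const_poly_def)
  also have "\<dots> = v * line_y d + [:u:] * line_x c + const_poly (poly (poly a [:d:]) c)"
    unfolding u v by (simp add: line_x_def line_y_def mult.commute)
  finally show ?thesis by (intro exI[of _ "[:u:]"] exI[of _ v]) (simp only: add_ac)
qed

text \<open>Modulo the ideal an element equals its value at the point, so any larger ideal contains
  a non-zero constant.\<close>

lemma maximalideal_point_ideal: "maximalideal (point_ideal c d) polyxy_ring"
proof (rule maximalidealI)
  show I: "ideal (point_ideal c d) polyxy_ring"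
    by (rule ideal_classI) (simp_all add: point_ideal_def)
  show "carrier polyxy_ring \<noteq> point_ideal c d"
    using ideal_class_eq_carrier_iff[OF I] by (auto simp: point_ideal_def)
  fix J assume J: "ideal J polyxy_ring" "point_ideal c d \<subseteq> J"
  show "J = point_ideal c d \<or> J = carrier polyxy_ring"
  proof (rule disjCI)
    assume "J \<noteq> carrier polyxy_ring"
    then have one: "1 \<notin> J" using ideal_class_eq_carrier_iff[OF J(1)] by simp
    have "a \<in> point_ideal c d" if a: "a \<in> J" for a
    proof (rule ccontr)
      define e where "e = poly (poly a [:d:]) c"
      assume "a \<notin> point_ideal c d"
      then have e: "e \<noteq> 0" by (simp add: point_ideal_def e_def)
      have "a - const_poly e \<in> J"
        using J(2) by (auto simp: point_ideal_def e_def const_poly_def)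
      then have "a - (a - const_poly e) \<in> J" using ideal_class_diff[OF J(1) a] by blast
      moreover have "const_poly e dvd 1" using e by (simp add: is_unit_const_poly)
      ultimately show False using ideal_class_dvd[OF J(1)] one by simp
    qed
    then show "J = point_ideal c d" using J(2) by blast
  qed
qed

lemma exists_point_nonzero:
  assumes "(Q :: polyxy) \<noteq> 0"
  shows "\<exists>c d. Q \<notin> point_ideal c d"
proof -
  have "infinite (range (\<lambda>d :: complex. [:d:]))"
    using infinite_UNIV_char_0[where 'a = complex] by (auto simp: inj_def dest: finite_imageD)
  moreover have "finite {e. poly Q e = 0}" using assms by (rule poly_roots_finite)
  ultimately have "\<not> range (\<lambda>d. [:d:]) \<subseteq> {e. poly Q e = 0}" by (metis finite_subset)
  then obtain d where "poly Q [:d:] \<noteq> 0" by auto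
  then have "finite {c. poly (poly Q [:d:]) c = 0}" by (rule poly_roots_finite)
  then have "{c. poly (poly Q [:d:]) c = 0} \<noteq> UNIV"
    using infinite_UNIV_char_0[where 'a = complex] by metis
  then obtain c where "poly (poly Q [:d:]) c \<noteq> 0" by auto
  then show ?thesis by (auto simp: point_ideal_def)
qed

section \<open>Ideals without common divisor\<close>

lemma exists_prime_factor_positive_degree:
  fixes a :: polyxy
  assumes "degree a > 0"
  shows "\<exists>p. prime p \<and> p dvd a \<and> degree p > 0"
  using assms
proof (induction a rule: prime_divisors_induct)
  case (unit x)
  then show ?case by (auto elim: is_unit_polyE)
next
  case (factor p x)
  show ?case
  proof (cases "degree p > 0")
    case True
    then show ?thesis using factor.hyps by (intro exI[of _ p]) simp
  next
    case False
    have "x \<noteq> 0" using factor.prems by auto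
    then have "degree x > 0" using factor False by (simp add: degree_mult_eq)
    then obtain q where "prime q \<and> q dvd x \<and> degree q > 0" using factor.IH by blast
    then show ?thesis by (intro exI[of _ q]) simp
  qed
qed simp

text \<open>Take a non-zero \<open>a\<close> in \<open>J\<close> of least degree in
  \<open>y\<close>. Pseudo-division shows that \<open>a\<close> divides every element of
  \<open>J\<close> up to a factor in \<open>x\<close> alone, so a prime factor of \<open>a\<close>
  involving \<open>y\<close> would divide all of \<open>J\<close>.\<close>

lemma Gcd_1_imp_contains_poly_in_x:
  fixes J :: "polyxy set"
  assumes J: "ideal J polyxy_ring" and gcd: "Gcd J = 1"
  shows "\<exists>u. u \<noteq> 0 \<and> [:u:] \<in> J"
proof -
  have "\<exists>a. a \<in> J \<and> a \<noteq> 0"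
  proof (rule ccontr)
    assume "\<not> ?thesis"
    then have "Gcd J = 0" by (auto simp: Gcd_0_iff)
    then show False using gcd by simp
  qed
  then obtain a where a: "a \<in> J" "a \<noteq> 0" and least: "\<And>b. b \<in> J \<Longrightarrow> b \<noteq> 0 \<Longrightarrow> degree a \<le> degree b"
    using ex_has_least_nat[of "\<lambda>a. a \<in> J \<and> a \<noteq> 0" _ degree] by blast
  have "degree a = 0"
  proof (rule ccontr)
    assume "degree a \<noteq> 0"
    then obtain p where p: "prime p" "p dvd a" "degree p > 0"
      using exists_prime_factor_positive_degree[of a] by blast
    have "p dvd b" if b: "b \<in> J" for b
    proof -
      obtain q r where qr: "pseudo_divmod b a = (q, r)" by (cases "pseudo_divmod b a") auto
      define k where "k = lead_coeff a ^ (Suc (degree b) - degree a)"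
      have eq: "Polynomial.smult k b = a * q + r" and r: "r = 0 \<or> degree r < degree a"
        using pseudo_divmod[OF a(2) qr] by (simp_all add: k_def)
      have "[:k:] * b - a * q = r" using eq by simp
      then have "r \<in> J"
        using ideal_class_diff[OF J ideal_class_mult[OF J b] ideal_class_mult_right[OF J a(1)]] by metis
      then have "r = 0" using r least[of r] by (metis leD)
      then have "p dvd [:k:] * b" using eq p(2) by simp
      moreover have "\<not> p dvd [:k:]"
      proof
        assume "p dvd [:k:]"
        moreover have "[:k:] \<noteq> 0" using a(2) by (simp add: k_def)
        ultimately have "degree p \<le> degree [:k:]" by (rule dvd_imp_degree_le)
        then show False using p(3) by simp
      qed
      ultimately show "p dvd b" using prime_dvd_multD[OF p(1)] by blast
    qed
    then have "p dvd 1" using Gcd_greatest[of J p] gcd by simp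
    then show False using p(1) by simp
  qed
  then obtain u where "a = [:u:]" by (rule degree_eq_zeroE)
  then show ?thesis using a by auto
qed

text \<open>Applying \<open>\<delta>\<close> lowers the power of \<open>t\<close> by one while the
  other factor stays outside \<open>M\<close>; after \<open>k\<close> steps an element outside
  \<open>M\<close> would be in \<open>J\<close>.\<close>

lemma delta_ideal_power_not_in:
  fixes \<delta> :: "polyxy \<Rightarrow> polyxy"
  assumes der: "ring_derivation \<delta>" and J: "delta_ideal polyxy_ring \<delta> J"
    and M: "maximalideal M polyxy_ring" "J \<subseteq> M" and t: "t \<in> M" "\<delta> t \<notin> M"
    and "w \<notin> M"
  shows "t ^ k * w \<notin> J"
  using assms(7)
proof (induction k arbitrary: w)
  case 0
  then show ?case using M(2) by auto
next
  case (Suc k)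
  have MI: "ideal M polyxy_ring" using M(1) by (simp add: maximalideal_def)
  \<comment> \<open>Modulo \<open>M\<close> only the first summand counts, and it is a product of
    elements outside the prime ideal \<open>M\<close>.\<close>
  define v where "v = of_nat (Suc k) * \<delta> t * w + t * \<delta> w"
  have "of_nat (Suc k) \<notin> M"
    using ideal_class_dvd[OF MI _ is_unit_of_nat_polyxy] maximalideal_class_one[OF M(1)] by blast
  then have "of_nat (Suc k) * \<delta> t * w \<notin> M"
    using maximalideal_class_prime[OF M(1)] t(2) Suc.prems by blast
  then have "v \<notin> M"
    using ideal_class_add_iff[OF MI ideal_class_mult_right[OF MI t(1), of "\<delta> w"]]
    unfolding v_def by (metis add.commute)
  then have "t ^ k * v \<notin> J" by (rule Suc.IH)
  moreover have "\<delta> (t ^ Suc k * w) = t ^ k * v"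
    unfolding ring_derivation_mult[OF der] ring_derivation_power_Suc[OF der] v_def
    by (simp add: algebra_simps del: of_nat_Suc)
  ultimately show ?case using delta_ideal_classD(2)[OF J] by metis
qed

text \<open>Split \<open>u\<close> into a power of \<open>x - c\<close> and a factor not vanishing
  at \<open>c\<close>, and use \<open>delta_ideal_power_not_in\<close> with
  \<open>t = x - c\<close>, whose derivative is \<open>\<delta> poly_x\<close>.\<close>

lemma delta_ideal_in_point_ideal:
  assumes C: "C_derivation \<delta>" and J: "delta_ideal polyxy_ring \<delta> J" "J \<subseteq> point_ideal c d"
    and u: "u \<noteq> 0" "[:u:] \<in> J"
  shows "\<delta> poly_x \<in> point_ideal c d"
proof (rule ccontr)
  assume f: "\<delta> poly_x \<notin> point_ideal c d"
  obtain w where w: "u = [:- c, 1:] ^ Polynomial.order c u * w" "\<not> [:- c, 1:] dvd w"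
    using order_decomp[OF u(1)] by blast
  have "line_x c \<in> point_ideal c d" by (simp add: point_ideal_def line_x_def)
  moreover have "\<delta> (line_x c) \<notin> point_ideal c d" using f by (simp add: C_derivation_line_x[OF C])
  moreover have "[:w:] \<notin> point_ideal c d" using w(2) by (simp add: point_ideal_def poly_eq_0_iff_dvd)
  ultimately have "line_x c ^ Polynomial.order c u * [:w:] \<notin> J"
    using delta_ideal_power_not_in[OF C_derivation_ring[OF C] J(1) maximalideal_point_ideal J(2)] by blast
  moreover have "line_x c ^ n = [:[:- c, 1:] ^ n:]" for n
    by (induction n) (simp_all add: line_x_def one_pCons mult.commute)
  then have "line_x c ^ Polynomial.order c u * [:w:] = [:u:]"
    using w(1) by (simp add: mult.commute)
  ultimately show False using u(2) by simp
qed

text \<open>If \<open>\<delta> poly_x\<close> were zero, all the lines \<open>x = c\<close> would be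
  Darboux with cofactor 0.\<close>

lemma finite_darboux_primes_imp_delta_poly_x_neq_0:
  assumes C: "C_derivation \<delta>" and fin: "finite {p. prime p \<and> darboux \<delta> p}"
  shows "\<delta> poly_x \<noteq> 0"
proof
  assume 0: "\<delta> poly_x = 0"
  have prime: "prime_elem (line_x c)" for c
    by (simp add: line_x_def prime_elem_const_poly_iff prime_elem_linear_field_poly)
  have "darboux \<delta> (line_x c)" for c
    using prime_elem_not_zeroI[OF prime] by (simp add: darboux_def C_derivation_line_x[OF C] 0 exI[of _ 0])
  then have "darboux \<delta> (normalize (line_x c))" for c
    using darboux_prime_factor[OF C_derivation_ring[OF C], of "line_x c" "normalize (line_x c)"] prime
    by (simp add: prime_normalize_iff prime_imp_prime_elem)
  then have "range (\<lambda>c. normalize (line_x c)) \<subseteq> {p. prime p \<and> darboux \<delta> p}"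
    using prime by (auto simp: prime_normalize_iff)
  then have "finite (range (\<lambda>c. normalize (line_x c)))" using fin by (rule finite_subset)
  moreover have "inj (\<lambda>c. normalize (line_x c))"
  proof (rule injI)
    fix c e assume "normalize (line_x c) = normalize (line_x e)"
    then have "line_x c dvd line_x e" by (simp add: associated_iff_dvd)
    then have "[:- c, 1:] dvd [:- e, 1:]" by (simp add: line_x_def)
    then show "c = e" by (simp add: poly_eq_0_iff_dvd[symmetric])
  qed
  ultimately have "finite (UNIV :: complex set)" by (rule finite_imageD)
  then show False using infinite_UNIV_char_0[where 'a = complex] by blast
qed

lemma finite_darboux_primes_imp_delta_primitive:
  assumes C: "C_derivation \<delta>" and fin: "finite {p. prime p \<and> darboux \<delta> p}"
  shows "delta_primitive polyxy_ring \<delta>"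
proof -
  note der = C_derivation_ring[OF C]
  \<comment> \<open>A point where \<open>Q\<close> does not vanish has neither
    \<open>\<delta> poly_x\<close> nor any Darboux prime in its ideal. This rules out first the gcd
    of a \<open>\<delta>\<close>-ideal \<open>I\<close> below it, then the quotient of
    \<open>I\<close> by that gcd.\<close>
  define Q where "Q = \<delta> poly_x * \<Prod>{p. prime p \<and> darboux \<delta> p}"
  have "Q \<noteq> 0"
    using finite_darboux_primes_imp_delta_poly_x_neq_0[OF C fin] fin by (auto simp: Q_def)
  then obtain c d where Q: "Q \<notin> point_ideal c d" using exists_point_nonzero by blast
  note M = maximalideal_point_ideal[of c d]
  have MI: "ideal (point_ideal c d) polyxy_ring" using M by (simp add: maximalideal_def)
  have "I = {0}" if I: "delta_ideal polyxy_ring \<delta> I" "I \<subseteq> point_ideal c d" for I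
  proof (rule ccontr)
    assume I0: "I \<noteq> {0}"
    have ne: "I \<noteq> {}" using ideal_class_0[OF delta_ideal_classD(1)[OF I(1)]] by blast
    note h = darboux_Gcd[OF der I(1) I0]
    have "Gcd I \<notin> point_ideal c d"
    proof
      assume "Gcd I \<in> point_ideal c d"
      from darboux_prime_in_ideal[OF der h this MI maximalideal_class_one[OF M] maximalideal_class_prime[OF M]]
      obtain p where p: "p \<in> point_ideal c d" "prime p" "darboux \<delta> p" by blast
      then have "p dvd Q" using fin unfolding Q_def by (intro dvd_mult dvd_prodI[of _ _ "\<lambda>p. p", simplified]) auto
      then show False using ideal_class_dvd[OF MI p(1)] Q by blast
    qed
    then have "{a. Gcd I * a \<in> I} \<subseteq> point_ideal c d"
      using maximalideal_class_prime[OF M] I(2) by blast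
    moreover note J = delta_ideal_class_quotient[OF der I(1) h]
    moreover obtain u where "u \<noteq> 0" "[:u:] \<in> {a. Gcd I * a \<in> I}"
      using Gcd_1_imp_contains_poly_in_x[OF delta_ideal_classD(1)[OF J] Gcd_quotient_eq_1[OF I0 ne]] by blast
    ultimately have "\<delta> poly_x \<in> point_ideal c d"
      using delta_ideal_in_point_ideal[OF C] by blast
    then show False using Q ideal_class_mult_right[OF MI] by (simp add: Q_def)
  qed
  then show ?thesis using M unfolding delta_primitive_def zero_class by blast
qed

section \<open>Delta-prime ideals\<close>

lemma delta_prime_idealD:
  assumes "delta_prime_ideal cring_class_ops \<delta> P"
  shows "delta_ideal cring_class_ops \<delta> P" "ideal P cring_class_ops" "(1 :: 'a::comm_ring_1) \<notin> P"
    and "delta_ideal cring_class_ops \<delta> I \<Longrightarrow> delta_ideal cring_class_ops \<delta> J \<Longrightarrow>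
      (\<And>a b. a \<in> I \<Longrightarrow> b \<in> J \<Longrightarrow> a * b \<in> P) \<Longrightarrow> I \<subseteq> P \<or> J \<subseteq> P"
  using assms unfolding delta_prime_ideal_class_iff by (auto dest: delta_ideal_classD(1))

text \<open>Darboux elements generate principal \<open>\<delta>\<close>-ideals, to which
  \<open>\<delta>\<close>-primeness applies.\<close>

lemma delta_prime_ideal_darboux_split:
  fixes \<delta> :: "'a::idom \<Rightarrow> 'a"
  assumes der: "ring_derivation \<delta>" and P: "delta_prime_ideal cring_class_ops \<delta> P"
    and "darboux \<delta> a" "darboux \<delta> b" "a * b \<in> P"
  shows "a \<in> P \<or> b \<in> P"
proof -
  have "{x. a dvd x} \<subseteq> P \<or> {x. b dvd x} \<subseteq> P"
  proof (rule delta_prime_idealD(4)[OF P])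
    show "x * y \<in> P" if "x \<in> {x. a dvd x}" "y \<in> {x. b dvd x}" for x y
      using ideal_class_dvd[OF delta_prime_idealD(2)[OF P] assms(5)] that by (simp add: mult_dvd_mono)
  qed (use assms in \<open>auto intro: delta_ideal_class_principal\<close>)
  then show ?thesis using dvd_refl[of a] dvd_refl[of b] by blast
qed

text \<open>Idempotents modulo \<open>P\<close> are constants for the induced derivation.\<close>

lemma delta_prime_ideal_idempotent:
  fixes \<delta> :: "'a::comm_ring_1 \<Rightarrow> 'a"
  assumes der: "ring_derivation \<delta>" and P: "delta_prime_ideal cring_class_ops \<delta> P"
    and e: "e * (1 - e) \<in> P"
  shows "e \<in> P \<or> 1 - e \<in> P"
proof -
  note PI = delta_prime_idealD(2)[OF P] and PD = delta_prime_idealD(1)[OF P]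
  have "\<delta> (e * (1 - e)) = \<delta> e * (1 - 2 * e)"
    by (simp add: ring_derivation_mult[OF der] ring_derivation_diff[OF der] ring_derivation_1[OF der]
        algebra_simps)
  then have "\<delta> e * (1 - 2 * e) \<in> P" using delta_ideal_classD(2)[OF PD e] by simp
  \<comment> \<open>Since \<open>(1 - 2 * e)^2 = 1 - 4 * e * (1 - e)\<close>, the factor
    \<open>1 - 2 * e\<close> is its own inverse modulo \<open>P\<close> and can be removed.\<close>
  from ideal_class_add[OF PI ideal_class_mult_right[OF PI this, of "1 - 2 * e"]
      ideal_class_mult_right[OF PI e, of "4 * \<delta> e"]]
  have "\<delta> e * (1 - 2 * e) * (1 - 2 * e) + e * (1 - e) * (4 * \<delta> e) \<in> P" .
  moreover have "\<delta> e * (1 - 2 * e) * (1 - 2 * e) + e * (1 - e) * (4 * \<delta> e) = \<delta> e"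
    by (simp add: algebra_simps)
  ultimately have de: "\<delta> e \<in> P" by simp
  \<comment> \<open>The annihilators of \<open>e\<close> and \<open>1 - e\<close> modulo
    \<open>P\<close> are \<open>\<delta>\<close>-ideals with product in \<open>P\<close>; they
    contain \<open>1 - e\<close> and \<open>e\<close> respectively.\<close>
  have "delta_ideal cring_class_ops \<delta> {r. \<forall>x\<in>{e}. r * x \<in> P}"
    by (rule delta_ideal_class_colon[OF der PD]) (simp add: ideal_class_mult[OF PI de])
  moreover have "delta_ideal cring_class_ops \<delta> {r. \<forall>x\<in>{1 - e}. r * x \<in> P}"
    by (rule delta_ideal_class_colon[OF der PD])
      (use ideal_class_minus[OF PI ideal_class_mult[OF PI de]] in
        \<open>simp add: ring_derivation_diff[OF der] ring_derivation_1[OF der]\<close>)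
  moreover have "r * s \<in> P" if "r * e \<in> P" "s * (1 - e) \<in> P" for r s
  proof -
    have "r * s = s * (r * e) + r * (s * (1 - e))" by (simp add: algebra_simps)
    then show ?thesis
      using ideal_class_add[OF PI ideal_class_mult[OF PI that(1)] ideal_class_mult[OF PI that(2)]] by metis
  qed
  ultimately have "{r. \<forall>x\<in>{e}. r * x \<in> P} \<subseteq> P \<or> {r. \<forall>x\<in>{1 - e}. r * x \<in> P} \<subseteq> P"
    by (intro delta_prime_idealD(4)[OF P]) auto
  then show ?thesis using e by (auto simp: mult.commute)
qed

text \<open>For \<open>u\<close> of least degree, split off the full power \<open>v\<close> of a
  linear factor. Bezout for \<open>v\<close> and the cofactor \<open>w\<close> yields an idempotent
  modulo \<open>P\<close>, so \<open>\<phi> v\<close> or \<open>\<phi> w\<close> lies in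
  \<open>P\<close>, and minimality excludes \<open>\<phi> w\<close>. The map \<open>\<phi>\<close>
  will embed polynomials in \<open>x\<close> or in \<open>y\<close>.\<close>

lemma delta_prime_ideal_contains_power:
  fixes \<delta> :: "'a::comm_ring_1 \<Rightarrow> 'a" and \<phi> :: "complex poly \<Rightarrow> 'a"
  assumes der: "ring_derivation \<delta>" and P: "delta_prime_ideal cring_class_ops \<delta> P"
    and add: "\<And>u v. \<phi> (u + v) = \<phi> u + \<phi> v" and mult: "\<And>u v. \<phi> (u * v) = \<phi> u * \<phi> v" and one: "\<phi> 1 = 1"
    and "u \<noteq> 0" "\<phi> u \<in> P"
  shows "\<exists>c k. \<phi> ([:- c, 1:] ^ k) \<in> P"
proof -
  note PI = delta_prime_idealD(2)[OF P]
  obtain u where u: "u \<noteq> 0" "\<phi> u \<in> P"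
    and least: "\<And>v. v \<noteq> 0 \<Longrightarrow> \<phi> v \<in> P \<Longrightarrow> degree u \<le> degree v"
    using ex_has_least_nat[of "\<lambda>u. u \<noteq> 0 \<and> \<phi> u \<in> P" _ degree] assms(6,7) by blast
  have "degree u \<noteq> 0"
  proof
    assume "degree u = 0"
    then have "u dvd 1" using u(1) by (simp add: is_unit_iff_degree)
    then obtain v where "1 = u * v" by (elim dvdE)
    then have "\<phi> u * \<phi> v = 1" by (simp add: mult[symmetric] one)
    then show False using ideal_class_mult_right[OF PI u(2), of "\<phi> v"] delta_prime_idealD(3)[OF P] by simp
  qed
  then have "\<not> constant (poly u)" by (simp add: constant_degree)
  then obtain c where c: "poly u c = 0" using fundamental_theorem_of_algebra by blast
  define k where "k = Polynomial.order c u"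
  obtain w where w: "u = [:- c, 1:] ^ k * w" "\<not> [:- c, 1:] dvd w"
    using order_decomp[OF u(1), of c] by (auto simp: k_def)
  define v where "v = [:- c, 1:] ^ k"
  have uvw: "u = v * w" by (simp add: w(1) v_def)
  have w0: "w \<noteq> 0" using u(1) uvw by auto
  have "prime_elem [:- c, 1:]" by (rule prime_elem_linear_field_poly) simp
  then have "coprime [:- c, 1:] w" using w(2) by (intro prime_elem_imp_coprime)
  then have "coprime v w" unfolding v_def by simp
  then obtain \<alpha> \<beta> where bez: "\<alpha> * v + \<beta> * w = 1" by (metis bezout_coefficients_fst_snd coprime_imp_gcd_eq_1)
  have "\<phi> (\<alpha> * v) + \<phi> (\<beta> * w) = 1" by (simp add: add[symmetric] bez one)
  then have e: "1 - \<phi> (\<alpha> * v) = \<phi> (\<beta> * w)" by (simp add: algebra_simps)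
  have "\<phi> (\<alpha> * v) * (1 - \<phi> (\<alpha> * v)) = \<phi> u * \<phi> (\<alpha> * \<beta>)"
    unfolding e mult[symmetric] uvw by (simp only: mult_ac)
  then have "\<phi> (\<alpha> * v) * (1 - \<phi> (\<alpha> * v)) \<in> P" using ideal_class_mult_right[OF PI u(2)] by simp
  from delta_prime_ideal_idempotent[OF der P this] show ?thesis
  proof
    assume *: "\<phi> (\<alpha> * v) \<in> P"
    have "v = v * (\<alpha> * v + \<beta> * w)" by (simp add: bez)
    also have "\<dots> = v * (\<alpha> * v) + \<beta> * u" by (simp add: uvw algebra_simps)
    finally have "\<phi> v = \<phi> v * \<phi> (\<alpha> * v) + \<phi> \<beta> * \<phi> u" by (metis add mult)
    then have "\<phi> v \<in> P"
      using ideal_class_add[OF PI ideal_class_mult[OF PI *] ideal_class_mult[OF PI u(2)]] by metis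
    then show ?thesis unfolding v_def by blast
  next
    assume "1 - \<phi> (\<alpha> * v) \<in> P"
    then have *: "\<phi> (\<beta> * w) \<in> P" by (simp add: e)
    have "w = w * (\<alpha> * v + \<beta> * w)" by (simp add: bez)
    also have "\<dots> = w * (\<beta> * w) + \<alpha> * u" by (simp add: uvw algebra_simps)
    finally have "\<phi> w = \<phi> w * \<phi> (\<beta> * w) + \<phi> \<alpha> * \<phi> u" by (metis add mult)
    then have "\<phi> w \<in> P"
      using ideal_class_add[OF PI ideal_class_mult[OF PI *] ideal_class_mult[OF PI u(2)]] by metis
    then have "degree u \<le> degree w" using least w0 by blast
    moreover have "degree u = k + degree w"
      using w0 by (simp add: uvw v_def degree_mult_eq degree_linear_power)
    moreover have "k \<noteq> 0" using c u(1) by (simp add: k_def order_root)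
    ultimately show ?thesis by simp
  qed
qed

text \<open>Multiply \<open>s\<close> by \<open>a ^ i * b ^ j\<close> with \<open>i + j\<close> as
  large as possible while the product stays outside \<open>P\<close>.\<close>

lemma ideal_exists_socle_element:
  fixes P :: "'a::comm_ring_1 set"
  assumes P: "ideal P cring_class_ops" and "a ^ k \<in> P" "b ^ l \<in> P" "s \<notin> P"
  shows "\<exists>t. t \<notin> P \<and> s dvd t \<and> t * a \<in> P \<and> t * b \<in> P"
proof -
  let ?Q = "\<lambda>(i, j). s * (a ^ i * b ^ j) \<notin> P"
  have "?Q (0, 0)" using assms(4) by simp
  moreover have "\<forall>x. ?Q x \<longrightarrow> (\<lambda>(i, j). i + j) x < k + l"
  proof clarify
    fix i j assume *: "s * (a ^ i * b ^ j) \<notin> P"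
    have "i < k"
    proof (rule ccontr)
      assume "\<not> i < k"
      then have "a ^ i \<in> P" using ideal_class_power_mono[OF P assms(2)] by simp
      then show False using * ideal_class_mult[OF P ideal_class_mult_right[OF P]] by blast
    qed
    moreover have "j < l"
    proof (rule ccontr)
      assume "\<not> j < l"
      then have "b ^ j \<in> P" using ideal_class_power_mono[OF P assms(3)] by simp
      then show False using * ideal_class_mult[OF P ideal_class_mult[OF P]] by blast
    qed
    ultimately show "i + j < k + l" by simp
  qed
  ultimately obtain x where x: "?Q x" and greatest: "\<And>y. ?Q y \<Longrightarrow> (\<lambda>(i, j). i + j) y \<le> (\<lambda>(i, j). i + j) x"
    using ex_has_greatest_nat[of ?Q "(0, 0)" "\<lambda>(i, j). i + j" "k + l"] by blast
  obtain i j where ij: "x = (i, j)" by (cases x)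
  have "s * (a ^ i * b ^ j) * a \<in> P"
    using greatest[of "(Suc i, j)"] by (auto simp: ij mult_ac)
  moreover have "s * (a ^ i * b ^ j) * b \<in> P"
    using greatest[of "(i, Suc j)"] by (auto simp: ij mult_ac)
  ultimately show ?thesis using x by (intro exI[of _ "s * (a ^ i * b ^ j)"]) (simp add: ij)
qed

text \<open>The ideal \<open>M\<close> of the point is nilpotent modulo \<open>P\<close>. It is
  shown to be a \<open>\<delta>\<close>-ideal; its annihilator modulo \<open>P\<close> is then one
  too and is not contained in \<open>P\<close>, so \<open>\<delta>\<close>-primeness puts
  \<open>M\<close>, and with it \<open>\<delta> (line_x c)\<close>, into \<open>P\<close>.\<close>

lemma delta_prime_ideal_contains_local_generators:
  assumes C: "C_derivation \<delta>" and P: "delta_prime_ideal polyxy_ring \<delta> P"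
    and powers: "line_x c ^ k \<in> P" "line_y d ^ l \<in> P"
  shows "\<delta> poly_x \<in> P"
proof -
  note der = C_derivation_ring[OF C]
  note PI = delta_prime_idealD(2)[OF P] and PD = delta_prime_idealD(1)[OF P]
  define M where "M = {u * line_x c + v * line_y d |u v. True}"
  have M_I: "u * line_x c + v * line_y d \<in> M" for u v unfolding M_def by blast
  have in_P: "t * m \<in> P" if t: "t * line_x c \<in> P" "t * line_y d \<in> P" and m: "m \<in> M" for t m
  proof -
    obtain u v where "m = u * line_x c + v * line_y d" using m unfolding M_def by blast
    then have "t * m = u * (t * line_x c) + v * (t * line_y d)" by (simp add: algebra_simps)
    then show ?thesis
      using ideal_class_add[OF PI ideal_class_mult[OF PI t(1)] ideal_class_mult[OF PI t(2)]] by simp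
  qed
  \<comment> \<open>Differentiating the first power of \<open>r\<close> in \<open>P\<close> gives
    \<open>r ^ n' * \<delta> r\<close> in \<open>P\<close> up to a unit. A socle element
    \<open>t\<close> divisible by \<open>r ^ n'\<close> then has \<open>t * \<delta> r\<close> in
    \<open>P\<close>.\<close>
  have stable: "\<delta> r \<in> M" if r: "r ^ m \<in> P" for r m
  proof -
    define n where "n = (LEAST m. r ^ m \<in> P)"
    have n: "r ^ n \<in> P" unfolding n_def using r by (rule LeastI)
    have "n \<noteq> 0" using n delta_prime_idealD(3)[OF P] by (cases n) auto
    then obtain n' where n': "n = Suc n'" by (cases n) auto
    have "r ^ n' \<notin> P" using not_less_Least[of n' "\<lambda>m. r ^ m \<in> P"] n' unfolding n_def by simp
    from ideal_exists_socle_element[OF PI powers this] obtain t where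
      t: "t \<notin> P" "r ^ n' dvd t" "t * line_x c \<in> P" "t * line_y d \<in> P" by blast
    have "of_nat (Suc n') * r ^ n' * \<delta> r \<in> P"
      using delta_ideal_classD(2)[OF PD n] unfolding n' ring_derivation_power_Suc[OF der] .
    moreover have "of_nat (Suc n') * r ^ n' * \<delta> r dvd t * \<delta> r"
    proof -
      have "of_nat (Suc n') * r ^ n' dvd 1 * t"
        by (rule dvd_trans[OF mult_dvd_mono[OF is_unit_of_nat_polyxy t(2)]]) simp
      then show ?thesis by (simp add: mult_dvd_mono)
    qed
    ultimately have tr: "t * \<delta> r \<in> P" using ideal_class_dvd[OF PI] by blast
    \<comment> \<open>Modulo \<open>M\<close>, \<open>\<delta> r\<close> is the constant
      \<open>e\<close>, and \<open>M\<close> kills \<open>t\<close> modulo \<open>P\<close>; so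
      \<open>t\<close> times \<open>e\<close> is in \<open>P\<close>, which forces
      \<open>e = 0\<close>.\<close>
    obtain u v where uv: "\<delta> r = const_poly (poly (poly (\<delta> r) [:d:]) c) + u * line_x c + v * line_y d"
      using polyxy_taylor[of "\<delta> r" d c] by blast
    define e where "e = poly (poly (\<delta> r) [:d:]) c"
    have "e = 0"
    proof (rule ccontr)
      assume e: "e \<noteq> 0"
      have "t * \<delta> r = t * const_poly e + t * (u * line_x c + v * line_y d)"
        by (subst uv) (simp add: e_def algebra_simps)
      then have "t * const_poly e \<in> P"
        using ideal_class_diff[OF PI tr in_P[OF t(3,4) M_I[of u v]]] by simp
      moreover have "t * const_poly e dvd t" using e by (simp add: is_unit_const_poly)
      ultimately show False using ideal_class_dvd[OF PI] t(1) by blast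
    qed
    then show ?thesis using uv M_I[of u v] by (simp add: e_def[symmetric] const_poly_simps)
  qed
  have dx: "\<delta> (line_x c) \<in> M" and dy: "\<delta> (line_y d) \<in> M" using stable powers by blast+
  have M: "ideal M polyxy_ring"
  proof (rule ideal_classI)
    show "0 \<in> M" using M_I[of 0 0] by simp
    fix x y assume "x \<in> M" "y \<in> M"
    then obtain u v u' v' where "x = u * line_x c + v * line_y d" "y = u' * line_x c + v' * line_y d"
      unfolding M_def by blast
    then have "x + y = (u + u') * line_x c + (v + v') * line_y d" by (simp add: algebra_simps)
    then show "x + y \<in> M" using M_I by simp
  next
    fix r x assume "x \<in> M"
    then obtain u v where "x = u * line_x c + v * line_y d" unfolding M_def by blast
    then have "r * x = (r * u) * line_x c + (r * v) * line_y d" by (simp add: algebra_simps)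
    then show "r * x \<in> M" using M_I by simp
  qed
  have "\<delta> x \<in> M" if x: "x \<in> M" for x
  proof -
    obtain u v where "x = u * line_x c + v * line_y d" using x unfolding M_def by blast
    then have "\<delta> x = (\<delta> u * line_x c + \<delta> v * line_y d) + (u * \<delta> (line_x c) + v * \<delta> (line_y d))"
      by (simp add: ring_derivation_add[OF der] ring_derivation_mult[OF der] algebra_simps)
    then show ?thesis
      using ideal_class_add[OF M M_I ideal_class_add[OF M ideal_class_mult[OF M dx] ideal_class_mult[OF M dy]]]
      by simp
  qed
  then have MD: "delta_ideal polyxy_ring \<delta> M" using M by (auto simp: delta_ideal_def)
  let ?A = "{r. \<forall>e\<in>{line_x c, line_y d}. r * e \<in> P}"
  have "r * \<delta> e \<in> P" if "\<And>e. e \<in> {line_x c, line_y d} \<Longrightarrow> r * e \<in> P" "e \<in> {line_x c, line_y d}" for r e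
    using in_P[OF that(1) that(1), of "\<delta> e"] dx dy that(2) by auto
  then have "delta_ideal polyxy_ring \<delta> ?A" by (rule delta_ideal_class_colon[OF der PD])
  moreover have "r * m \<in> P" if "r \<in> ?A" "m \<in> M" for r m
    using in_P[of r m] that by simp
  ultimately have "?A \<subseteq> P \<or> M \<subseteq> P" by (intro delta_prime_idealD(4)[OF P _ MD])
  moreover obtain t where "t \<notin> P" "t * line_x c \<in> P" "t * line_y d \<in> P"
    using ideal_exists_socle_element[OF PI powers delta_prime_idealD(3)[OF P]] by blast
  ultimately have "M \<subseteq> P" by blast
  then show ?thesis using dx by (auto simp: C_derivation_line_x[OF C])
qed

text \<open>The difference of the two powers is divisible by \<open>b - (b - a) = a\<close>.\<close>

lemma power_mem_ideal_cong:
  fixes P :: "'a::comm_ring_1 set"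
  assumes "ideal P cring_class_ops" "a \<in> P" "(b - a) ^ k \<in> P"
  shows "b ^ k \<in> P"
proof -
  have "b - (b - a) dvd b ^ k - (b - a) ^ k"
    by (cases k) (simp_all only: power_diff_sumr2 dvd_triv_left power_0 diff_self dvd_0_right)
  then have "b ^ k - (b - a) ^ k \<in> P" using ideal_class_dvd[OF assms(1,2)] by simp
  then show ?thesis using ideal_class_add[OF assms(1) _ assms(3)] by fastforce
qed

text \<open>A polynomial in \<open>x\<close> in \<open>P\<close> yields a power of some
  \<open>x - c\<close>. Some \<open>q\<close> in \<open>P\<close> is not divisible by
  \<open>x - c\<close>, and its restriction to that line yields a power of some \<open>y - d\<close>
  in the same way.\<close>

lemma delta_prime_ideal_Gcd_1:
  assumes C: "C_derivation \<delta>" and P: "delta_prime_ideal polyxy_ring \<delta> P" and gcd: "Gcd P = 1"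
  shows "\<delta> poly_x \<in> P"
proof -
  note der = C_derivation_ring[OF C]
  note PI = delta_prime_idealD(2)[OF P]
  obtain u where u: "u \<noteq> 0" "[:u:] \<in> P" using Gcd_1_imp_contains_poly_in_x[OF PI gcd] by blast
  have "\<exists>c k. [:[:- c, 1:] ^ k:] \<in> P"
    by (rule delta_prime_ideal_contains_power[OF der P, where \<phi> = "\<lambda>u. [:u:]", OF _ _ _ u])
      (simp_all add: one_pCons)
  then obtain c k where "[:[:- c, 1:] ^ k:] \<in> P" by blast
  moreover have "line_x c ^ n = [:[:- c, 1:] ^ n:]" for n
    by (induction n) (simp_all add: line_x_def one_pCons mult.commute)
  ultimately have x: "line_x c ^ k \<in> P" by simp
  have "\<not> line_x c dvd Gcd P" by (simp add: gcd line_x_def is_unit_const_poly_iff is_unit_pCons_iff)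
  then obtain q where q: "q \<in> P" "\<not> line_x c dvd q" using Gcd_greatest by blast
  define \<phi> :: "complex poly \<Rightarrow> polyxy" where "\<phi> = map_poly (\<lambda>c. [:c:])"
  have coeff: "coeff (\<phi> v) n = [:coeff v n:]" for v n by (simp add: \<phi>_def coeff_map_poly)
  have \<phi>_add: "\<phi> (v + w) = \<phi> v + \<phi> w" for v w by (rule poly_eqI) (simp add: coeff)
  have \<phi>_mult: "\<phi> (v * w) = \<phi> v * \<phi> w" for v w
  proof (rule poly_eqI)
    fix n
    have "[:sum f A:] = (\<Sum>i\<in>A. [:f i:])" for f :: "nat \<Rightarrow> complex" and A
      by (rule poly_eqI) (simp add: coeff_sum coeff_pCons split: nat.splits)
    then show "coeff (\<phi> (v * w)) n = coeff (\<phi> v * \<phi> w) n" by (simp add: coeff coeff_mult mult.commute)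
  qed
  have \<phi>_1: "\<phi> 1 = 1" by (rule poly_eqI) (simp add: coeff one_pCons coeff_pCons split: nat.splits)
  define v where "v = map_poly (\<lambda>a. poly a c) q"
  have v: "coeff v n = poly (coeff q n) c" for n by (simp add: v_def coeff_map_poly)
  have "line_x c dvd q - \<phi> v"
    unfolding line_x_def const_poly_dvd_iff
    by (simp add: coeff v poly_eq_0_iff_dvd[symmetric])
  then obtain r where r: "q - \<phi> v = line_x c * r" by (elim dvdE)
  have "v \<noteq> 0"
  proof
    assume "v = 0"
    then have "\<phi> v = 0" by (simp add: \<phi>_def)
    then show False using r q(2) by simp
  qed
  \<comment> \<open>Modulo \<open>P\<close> the restriction \<open>\<phi> v\<close> is a multiple of
    the nilpotent \<open>line_x c\<close>, so its \<open>k\<close>-th power lies in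
    \<open>P\<close>.\<close>
  have "\<phi> v - q = line_x c * (- r)" using r by (simp add: algebra_simps)
  then have "(\<phi> v - q) ^ k \<in> P" using ideal_class_mult_right[OF PI x, of "(- r) ^ k"]
    by (simp only: power_mult_distrib)
  then have "\<phi> v ^ k \<in> P" by (rule power_mem_ideal_cong[OF PI q(1)])
  moreover have \<phi>_power: "\<phi> (w ^ n) = \<phi> w ^ n" for w n by (induction n) (simp_all add: \<phi>_1 \<phi>_mult)
  ultimately have "\<phi> (v ^ k) \<in> P" by simp
  then obtain d l where "\<phi> ([:- d, 1:] ^ l) \<in> P"
    using delta_prime_ideal_contains_power[OF der P \<phi>_add \<phi>_mult \<phi>_1, of "v ^ k"] \<open>v \<noteq> 0\<close> by auto
  moreover have "\<phi> [:- d, 1:] = line_y d" by (simp add: \<phi>_def line_y_def map_poly_pCons one_pCons)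
  ultimately have "line_y d ^ l \<in> P" by (simp add: \<phi>_power)
  from delta_prime_ideal_contains_local_generators[OF C P x this] show ?thesis .
qed

text \<open>Either the gcd \<open>h\<close> of \<open>P\<close> is in \<open>P\<close>, and so is
  one of its Darboux primes, or \<open>\<delta>\<close>-primeness puts the quotient of
  \<open>P\<close> by \<open>h\<close> into \<open>P\<close>. That quotient has gcd 1, so
  \<open>h = 1\<close>.\<close>

lemma delta_prime_ideal_cases:
  assumes C: "C_derivation \<delta>" and P: "delta_prime_ideal polyxy_ring \<delta> P" and "P \<noteq> {0}"
  shows "\<delta> poly_x \<in> P \<or> (\<exists>p\<in>P. prime p \<and> darboux \<delta> p)"
proof (cases "Gcd P \<in> P")
  case True
  note der = C_derivation_ring[OF C]
  note PD = delta_prime_idealD[OF P]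
  from darboux_prime_in_ideal[OF der darboux_Gcd[OF der PD(1) assms(3)] True PD(2,3)
      delta_prime_ideal_darboux_split[OF der P]]
  show ?thesis by blast
next
  case False
  note der = C_derivation_ring[OF C]
  note PD = delta_prime_idealD[OF P]
  have ne: "P \<noteq> {}" using ideal_class_0[OF PD(2)] by blast
  note h = darboux_Gcd[OF der PD(1) assms(3)]
  have "{a. Gcd P dvd a} \<subseteq> P \<or> {a. Gcd P * a \<in> P} \<subseteq> P"
  proof (rule PD(4)[OF delta_ideal_class_principal[OF der h] delta_ideal_class_quotient[OF der PD(1) h]])
    fix a b assume "a \<in> {a. Gcd P dvd a}" "b \<in> {a. Gcd P * a \<in> P}"
    then show "a * b \<in> P" using ideal_class_dvd[OF PD(2), of "Gcd P * b" "a * b"] by (simp add: mult_dvd_mono)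
  qed
  then have "{a. Gcd P * a \<in> P} \<subseteq> P" using False dvd_refl[of "Gcd P"] by blast
  then have "Gcd P dvd Gcd {a. Gcd P * a \<in> P}" by (intro Gcd_greatest Gcd_dvd) blast
  then have "is_unit (Gcd P)" by (simp only: Gcd_quotient_eq_1[OF assms(3) ne])
  then have "normalize (Gcd P) = 1" by (simp only: is_unit_normalize)
  then have "Gcd P = 1" by simp
  then show ?thesis using delta_prime_ideal_Gcd_1[OF C P] by blast
qed

lemma delta_prime_ring_polyxy: "ring_derivation \<delta> \<Longrightarrow> delta_prime_ring polyxy_ring \<delta>"
  unfolding delta_prime_ring_def zero_class delta_prime_ideal_class_iff
  by (auto simp: delta_ideal_def ring_derivation_0 intro: ideal_classI)

lemma delta_prime_ideal_principal:
  assumes der: "ring_derivation \<delta>" and p: "prime p" "darboux \<delta> p"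
  shows "delta_prime_ideal polyxy_ring \<delta> {a. p dvd a}"
proof -
  have "I \<subseteq> {a. p dvd a} \<or> J \<subseteq> {a. p dvd a}"
    if "\<forall>a\<in>I. \<forall>b\<in>J. a * b \<in> {a. p dvd a}" for I J
    using that p(1) by (auto simp: prime_dvd_mult_iff)
  then show ?thesis
    using p delta_ideal_class_principal[OF der p(2)] by (auto simp: delta_prime_ideal_class_iff)
qed

text \<open>Each Darboux prime generates a \<open>\<delta>\<close>-prime ideal, so it divides any
  non-zero element of the intersection. Conversely \<open>delta_prime_ideal_cases\<close> puts
  \<open>Q\<close> into every non-zero \<open>\<delta>\<close>-prime ideal.\<close>

lemma delta_G_ring_iff:
  assumes C: "C_derivation \<delta>"
  shows "delta_G_ring polyxy_ring \<delta> \<longleftrightarrow> finite {p. prime p \<and> darboux \<delta> p}"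
proof
  assume "delta_G_ring polyxy_ring \<delta>"
  then have "carrier polyxy_ring \<inter> \<Inter> {P. delta_prime_ideal polyxy_ring \<delta> P \<and> P \<noteq> {0}} \<noteq> {0}"
    by (simp add: delta_G_ring_def zero_class)
  \<comment> \<open>Being different from \<open>{0}\<close> gives a non-zero element only because 0
    belongs to the intersection.\<close>
  moreover have "0 \<in> carrier polyxy_ring \<inter> \<Inter> {P. delta_prime_ideal polyxy_ring \<delta> P \<and> P \<noteq> {0}}"
    by (auto simp: carrier_class intro: ideal_class_0 delta_prime_idealD(2))
  ultimately obtain r where r: "r \<noteq> 0" "\<And>P. delta_prime_ideal polyxy_ring \<delta> P \<Longrightarrow> P \<noteq> {0} \<Longrightarrow> r \<in> P"
    by blast
  have "p \<in> prime_factors r" if p: "prime p" "darboux \<delta> p" for p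
  proof -
    have "p \<in> {a. p dvd a}" "p \<noteq> 0" using p(1) by auto
    then have "{a. p dvd a} \<noteq> {0}" by blast
    then have "p dvd r" using r(2)[OF delta_prime_ideal_principal[OF C_derivation_ring[OF C] p]] by simp
    then show ?thesis using r(1) p(1) by (simp add: prime_factors_dvd)
  qed
  then have "{p. prime p \<and> darboux \<delta> p} \<subseteq> prime_factors r" by blast
  then show "finite {p. prime p \<and> darboux \<delta> p}" using finite_set_mset finite_subset by blast
next
  assume fin: "finite {p. prime p \<and> darboux \<delta> p}"
  define Q where "Q = \<delta> poly_x * \<Prod>{p. prime p \<and> darboux \<delta> p}"
  have "Q \<noteq> 0"
    using finite_darboux_primes_imp_delta_poly_x_neq_0[OF C fin] fin by (auto simp: Q_def)
  moreover have "Q \<in> P" if P: "delta_prime_ideal polyxy_ring \<delta> P" "P \<noteq> {0}" for P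
    using delta_prime_ideal_cases[OF C P]
  proof
    assume "\<delta> poly_x \<in> P"
    then show ?thesis unfolding Q_def by (rule ideal_class_mult_right[OF delta_prime_idealD(2)[OF P(1)]])
  next
    assume "\<exists>p\<in>P. prime p \<and> darboux \<delta> p"
    then obtain p where p: "p \<in> P" "prime p" "darboux \<delta> p" by blast
    then have "p dvd Q" using fin unfolding Q_def by (intro dvd_mult dvd_prodI[of _ _ "\<lambda>p. p", simplified]) auto
    then show ?thesis using ideal_class_dvd[OF delta_prime_idealD(2)[OF P(1)] p(1)] by blast
  qed
  then have "Q \<in> carrier polyxy_ring \<inter> \<Inter> {P. delta_prime_ideal polyxy_ring \<delta> P \<and> P \<noteq> {0}}"
    by (simp add: carrier_class)
  ultimately have "carrier polyxy_ring \<inter> \<Inter> {P. delta_prime_ideal polyxy_ring \<delta> P \<and> P \<noteq> {0}} \<noteq> {0}"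
    by (metis singletonD)
  then show "delta_G_ring polyxy_ring \<delta>"
    using delta_prime_ring_polyxy[OF C_derivation_ring[OF C]] by (simp add: delta_G_ring_def zero_class)
qed

text \<open>A Darboux element of \<open>M\<close> would generate a non-zero
  \<open>\<delta>\<close>-ideal inside \<open>M\<close>.\<close>

lemma delta_primitive_imp_maximalideal_without_darboux:
  assumes der: "ring_derivation \<delta>" and "delta_primitive polyxy_ring \<delta>"
  shows "\<exists>M. maximalideal M polyxy_ring \<and> M \<inter> irreducible_darboux \<delta> = {}"
proof -
  obtain M :: "polyxy set" where M: "maximalideal M polyxy_ring"
    and no_delta: "\<And>I. delta_ideal polyxy_ring \<delta> I \<Longrightarrow> I \<subseteq> M \<Longrightarrow> I = {0}"
    using assms(2) unfolding delta_primitive_def zero_class by blast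
  have MI: "ideal M polyxy_ring" using M by (simp add: maximalideal_def)
  have False if p: "p \<in> M" "p \<in> irreducible_darboux \<delta>" for p
  proof -
    have d: "darboux \<delta> p" using p(2) by (simp add: irreducible_darboux_def)
    have "{a. p dvd a} \<subseteq> M" using ideal_class_dvd[OF MI p(1)] by blast
    then have "{a. p dvd a} = {0}" by (rule no_delta[OF delta_ideal_class_principal[OF der d]])
    moreover have "p \<in> {a. p dvd a}" by simp
    ultimately have "p = 0" by simp
    then show False using d by (simp add: darboux_def)
  qed
  then show ?thesis using M by blast
qed

theorem proposition4p11:
  fixes \<delta> :: "polyxy \<Rightarrow> polyxy"
  assumes "C_derivation \<delta>" and "\<delta> \<noteq> (\<lambda>_. 0)"
  shows
    "(primitive_ring (diff_op_ring \<delta>) \<longleftrightarrow> delta_G_ring polyxy_ring \<delta>) \<and>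
     (primitive_ring (diff_op_ring \<delta>) \<longleftrightarrow>
        finite (irreducible_darboux \<delta> // associated_rel)) \<and>
     (primitive_ring (diff_op_ring \<delta>) \<longleftrightarrow> delta_primitive polyxy_ring \<delta>) \<and>
     (primitive_ring (diff_op_ring \<delta>) \<longleftrightarrow>
        (\<exists>M. maximalideal M polyxy_ring \<and> M \<inter> irreducible_darboux \<delta> = {})) \<and>
     (primitive_ring (diff_op_ring \<delta>) \<longleftrightarrow>
        fract_constants \<delta> = range const_fract)"
proof -
  note der = C_derivation_ring[OF assms(1)]
  let ?fin = "finite {p. prime p \<and> darboux \<delta> p}"
  let ?max = "\<exists>M. maximalideal M polyxy_ring \<and> M \<inter> irreducible_darboux \<delta> = {}"
  let ?const = "fract_constants \<delta> = range const_fract"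
  have pencil: "\<exists>a b c. darboux_pencil \<delta> a b c" if "\<not> ?const"
    using exists_darboux_pencil[OF assms(1) that] .
  \<comment> \<open>The cycle runs from primitivity through \<open>?const\<close>,
    \<open>?fin\<close> and \<open>\<delta>\<close>-primitivity back to primitivity.
    \<open>?max\<close> lies between \<open>\<delta>\<close>-primitivity and \<open>?const\<close>,
    and the other two conditions are equivalent to \<open>?fin\<close>.\<close>
  have "primitive_ring (diff_op_ring \<delta>) \<Longrightarrow> ?const"
    using pencil darboux_pencil.not_primitive_ring by blast
  moreover have "?const \<Longrightarrow> ?fin" by (rule finite_darboux_primes[OF assms(1)])
  moreover have "?fin \<Longrightarrow> delta_primitive polyxy_ring \<delta>"
    by (rule finite_darboux_primes_imp_delta_primitive[OF assms(1)])
  moreover have "delta_primitive polyxy_ring \<delta> \<Longrightarrow> primitive_ring (diff_op_ring \<delta>)"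
    by (rule delta_primitive_imp_primitive_ring[OF der assms(2)])
  moreover have "delta_primitive polyxy_ring \<delta> \<Longrightarrow> ?max"
    by (rule delta_primitive_imp_maximalideal_without_darboux[OF der])
  moreover have "?max \<Longrightarrow> ?const"
    using pencil darboux_pencil.exists_darboux_in_maximalideal by blast
  moreover have "finite (irreducible_darboux \<delta> // associated_rel) \<longleftrightarrow> ?fin"
    by (rule finite_irreducible_darboux_iff[OF der])
  moreover have "delta_G_ring polyxy_ring \<delta> \<longleftrightarrow> ?fin" by (rule delta_G_ring_iff[OF assms(1)])
  ultimately show ?thesis by argo
qed

end
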